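(* Let $\Gamma$ be a discrete amenable group and let $(T_n)$ be an ergodic sequence in $\Gamma$. Suppose that $A$ and $B$ are subsets of $\Gamma$ with \[ \overline{d}_{(T_n)}(A) = \alpha > 0 \quad\text{and}\quad d^*(B) = \beta > 0. \] Then there exist $a_o \in A$ and a set $S \subset \widehat{\Gamma}_{\mathrm{FD}} \setminus \{[\mathrm{id}]\}$ with $|S| \leq \frac{17(1-\alpha^2)}{d_\Gamma \alpha^2 \beta^2}$ such that \[ ABB^{-1} \supset a_o \, U_{S,\frac{\beta}{2}}, \] where $d_\Gamma$ denotes the smallest dimension of a non-trivial unitary $\Gamma$-representation. If $d_\Gamma = \infty$, that is to say, if $\Gamma$ does not admit any non-trivial finite-dimensional unitary representations, or if $\alpha = 1$, then $ABB^{-1} = \Gamma$.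
   Context: For a finite-dimensional unitary $\Gamma$-representation $(\mathcal{W},\sigma)$ define the semi-norm $|\gamma|_\sigma = \sup\{ \|\sigma(\gamma)w-w\|_{\mathcal{W}} : \|w\|_{\mathcal{W}} = 1\}$ for $\gamma \in \Gamma$; it depends only on the unitary equivalence class of $\sigma$. $\widehat{\Gamma}_{\mathrm{FD}}$ denotes the set of unitary equivalence classes of finite-dimensional irreducible unitary $\Gamma$-representations, and $[\mathrm{id}]$ is the class of the trivial (one-dimensional) representation. For a finite set $S \subset \widehat{\Gamma}_{\mathrm{FD}}$ and $\varepsilon > 0$, the Bohr set $U_{S,\varepsilon}$ is \[ U_{S,\varepsilon} = \{ \gamma \in \Gamma : |\gamma|_\sigma < \varepsilon \text{ for all } \sigma \in S\} \] (so $U_{\emptyset,\varepsilon}=\Gamma$). When $d_\Gamma=\infty$, the bound on $|S|$ is read as $0$. For a sequence $(T_n)$ of finite subsets of $\Gamma$ and $B \subset \Gamma$, the upper asymptotic density of $B$ along $(T_n)$ is $\overline{d}_{(T_n)}(B) = \limsup_n \frac{|B \cap T_n|}{|T_n|}$. For $\Gamma$ amenable, the upper Banach density of $B$ is $d^*(B) = \sup\{ \overline{d}_{(F_n)}(B) : (F_n) \text{ is a left F\o lner sequence in } \Gamma\}$. A sequence $(T_n)$ of finite subsets of $\Gamma$ is called ergodic if for every unitary $\Gamma$-representation $(\mathcal{H},\pi)$ and every $u \in \mathcal{H}$, $\frac{1}{|T_n|}\sum_{\gamma \in T_n} \pi(\gamma)u \to P_\pi u$ in the weak topology on $\mathcal{H}$,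 where $P_\pi$ is the orthogonal projection onto the subspace $\mathcal{H}^\pi$ of $\pi(\Gamma)$-fixed vectors. $ABB^{-1} = \{ab_1b_2^{-1} : a \in A,\ b_1,b_2 \in B\}$ and $a_oU = \{a_o u : u \in U\}$. *)

theory Defs
  imports
    "HOL-Analysis.Analysis"
    "HOL-Algebra.Coset"
    "HOL-Library.Function_Algebras"
begin

section \<open>Complex Hilbert spaces\<close>

text \<open>
  A complex Hilbert space is given by a linear subspace \<open>V\<close> of the space of all functions
  \<open>'i \<Rightarrow> complex\<close> (with pointwise operations) and an \<^emph>\<open>arbitrary\<close> complete inner product on \<open>V\<close>,
  linear in the first argument. Every Hilbert space which has an orthonormal basis indexed by
  a subset of \<open>'i\<close> is isomorphic to one of this form.
\<close>

definition cscale :: "complex \<Rightarrow> ('i \<Rightarrow> complex) \<Rightarrow> ('i \<Rightarrow> complex)"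
  where "cscale c v = (\<lambda>i. c * v i)"

global_interpretation cfun: vector_space "cscale :: complex \<Rightarrow> ('i \<Rightarrow> complex) \<Rightarrow> _"
  by unfold_locales (simp_all add: cscale_def fun_eq_iff algebra_simps)

definition ip_norm :: "(('i \<Rightarrow> complex) \<Rightarrow> ('i \<Rightarrow> complex) \<Rightarrow> complex) \<Rightarrow> ('i \<Rightarrow> complex) \<Rightarrow> real"
  where "ip_norm ip v = sqrt (Re (ip v v))"

locale hilbert_space =
  fixes V :: "('i \<Rightarrow> complex) set"
    and ip :: "('i \<Rightarrow> complex) \<Rightarrow> ('i \<Rightarrow> complex) \<Rightarrow> complex"
  assumes subspace: "cfun.subspace V"
    and ip_add_left: "\<lbrakk>u \<in> V; v \<in> V; w \<in> V\<rbrakk> \<Longrightarrow> ip (u + v) w = ip u w + ip v w"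
    and ip_scale_left: "\<lbrakk>u \<in> V; v \<in> V\<rbrakk> \<Longrightarrow> ip (cscale c u) v = c * ip u v"
    and ip_commute: "\<lbrakk>u \<in> V; v \<in> V\<rbrakk> \<Longrightarrow> ip v u = cnj (ip u v)"
    and ip_pos: "\<lbrakk>u \<in> V; u \<noteq> 0\<rbrakk> \<Longrightarrow> 0 < Re (ip u u)"
    and complete: "Metric_space.mcomplete V (\<lambda>u v. ip_norm ip (u - v))"

definition weakly_converges ::
  "('i \<Rightarrow> complex) set \<Rightarrow> (('i \<Rightarrow> complex) \<Rightarrow> ('i \<Rightarrow> complex) \<Rightarrow> complex) \<Rightarrow>
   (nat \<Rightarrow> 'i \<Rightarrow> complex) \<Rightarrow> ('i \<Rightarrow> complex) \<Rightarrow> bool"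
  where "weakly_converges V ip X x \<longleftrightarrow> (\<forall>w\<in>V. (\<lambda>n. ip (X n) w) \<longlonglongrightarrow> ip x w)"

text \<open>Only meaningful for a closed subspace \<open>M\<close> of a Hilbert space and \<open>u\<close> in that Hilbert space.\<close>

definition orth_proj ::
  "(('i \<Rightarrow> complex) \<Rightarrow> ('i \<Rightarrow> complex) \<Rightarrow> complex) \<Rightarrow> ('i \<Rightarrow> complex) set \<Rightarrow>
   ('i \<Rightarrow> complex) \<Rightarrow> ('i \<Rightarrow> complex)"
  where "orth_proj ip M u = (THE p. p \<in> M \<and> (\<forall>w\<in>M. ip (u - p) w = 0))"

section \<open>Unitary representations\<close>

record ('g, 'i) urep =
  vecs :: "('i \<Rightarrow> complex) set"
  inner_prod :: "('i \<Rightarrow> complex) \<Rightarrow> ('i \<Rightarrow> complex) \<Rightarrow> complex"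
  act :: "'g \<Rightarrow> ('i \<Rightarrow> complex) \<Rightarrow> ('i \<Rightarrow> complex)"

locale unitary_rep =
  group G + hilbert_space "vecs R" "inner_prod R"
  for G :: "('g, 'm) monoid_scheme" (structure) and R :: "('g, 'i) urep" +
  assumes act_closed: "\<lbrakk>g \<in> carrier G; v \<in> vecs R\<rbrakk> \<Longrightarrow> act R g v \<in> vecs R"
    and act_add: "\<lbrakk>g \<in> carrier G; u \<in> vecs R; v \<in> vecs R\<rbrakk>
        \<Longrightarrow> act R g (u + v) = act R g u + act R g v"
    and act_scale: "\<lbrakk>g \<in> carrier G; v \<in> vecs R\<rbrakk>
        \<Longrightarrow> act R g (cscale c v) = cscale c (act R g v)"
    and act_one: "v \<in> vecs R \<Longrightarrow> act R \<one> v = v"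
    and act_mult: "\<lbrakk>g \<in> carrier G; h \<in> carrier G; v \<in> vecs R\<rbrakk>
        \<Longrightarrow> act R (g \<otimes> h) v = act R g (act R h v)"
    and act_isometric: "\<lbrakk>g \<in> carrier G; u \<in> vecs R; v \<in> vecs R\<rbrakk>
        \<Longrightarrow> inner_prod R (act R g u) (act R g v) = inner_prod R u v"

definition fixed_vecs :: "('g, 'm) monoid_scheme \<Rightarrow> ('g, 'i) urep \<Rightarrow> ('i \<Rightarrow> complex) set"
  where "fixed_vecs G R = {v \<in> vecs R. \<forall>g\<in>carrier G. act R g v = v}"

definition acts_trivially :: "('g, 'm) monoid_scheme \<Rightarrow> ('g, 'i) urep \<Rightarrow> bool"
  where "acts_trivially G R \<longleftrightarrow> (\<forall>g\<in>carrier G. \<forall>v\<in>vecs R. act R g v = v)"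

definition fin_dim :: "('g, 'i) urep \<Rightarrow> bool"
  where "fin_dim R \<longleftrightarrow> (\<exists>B. finite B \<and> vecs R = cfun.span B)"

definition rep_dim :: "('g, 'i) urep \<Rightarrow> nat"
  where "rep_dim R = cfun.dim (vecs R)"

text \<open>Invariant subspaces need not be required to be closed, since the dimension is finite.\<close>

definition fd_irrep :: "('g, 'm) monoid_scheme \<Rightarrow> ('g, 'i) urep \<Rightarrow> bool"
  where "fd_irrep G R \<longleftrightarrow> unitary_rep G R \<and> fin_dim R \<and> vecs R \<noteq> {0} \<and>
    (\<forall>W. cfun.subspace W \<and> W \<subseteq> vecs R \<and> (\<forall>g\<in>carrier G. \<forall>w\<in>W. act R g w \<in> W)
       \<longrightarrow> W = {0} \<or> W = vecs R)"

definition unitarily_equiv ::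
  "('g, 'm) monoid_scheme \<Rightarrow> ('g, 'i) urep \<Rightarrow> ('g, 'j) urep \<Rightarrow> bool"
  where "unitarily_equiv G R R' \<longleftrightarrow> (\<exists>\<Phi>. bij_betw \<Phi> (vecs R) (vecs R') \<and>
    (\<forall>u\<in>vecs R. \<forall>v\<in>vecs R. \<Phi> (u + v) = \<Phi> u + \<Phi> v) \<and>
    (\<forall>c. \<forall>v\<in>vecs R. \<Phi> (cscale c v) = cscale c (\<Phi> v)) \<and>
    (\<forall>u\<in>vecs R. \<forall>v\<in>vecs R. inner_prod R' (\<Phi> u) (\<Phi> v) = inner_prod R u v) \<and>
    (\<forall>g\<in>carrier G. \<forall>v\<in>vecs R. \<Phi> (act R g v) = act R' g (\<Phi> v)))"

definition rep_seminorm :: "('g, 'i) urep \<Rightarrow> 'g \<Rightarrow> real"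
  where "rep_seminorm R g =
    Sup {ip_norm (inner_prod R) (act R g w - w) | w. w \<in> vecs R \<and> ip_norm (inner_prod R) w = 1}"

section \<open>The finite-dimensional dual and Bohr sets\<close>

text \<open>
  From here on, representations range over the ambient space \<open>'g \<times> nat \<Rightarrow> complex\<close>, where \<open>'g\<close> is
  the element type of the group. As \<open>'g \<times> nat\<close> is infinite and at least as large as the group,
  every finite-dimensional unitary representation and every cyclic unitary representation
  of the group is unitarily equivalent to one on a subspace of this ambient space.
\<close>

type_synonym 'g rep = "('g, 'g \<times> nat) urep"

definition fd_dual :: "('g, 'm) monoid_scheme \<Rightarrow> 'g rep set set"
  where "fd_dual G = {R. fd_irrep G R} //
    {(R, R'). fd_irrep G R \<and> fd_irrep G R' \<and> unitarily_equiv G R R'}"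

text \<open>
  The one-dimensional representations with trivial action form a single unitary equivalence
  class, since all one-dimensional Hilbert spaces are isometric.
\<close>

definition trivial_class :: "('g, 'm) monoid_scheme \<Rightarrow> 'g rep set"
  where "trivial_class G = {R. unitary_rep G R \<and> fin_dim R \<and> rep_dim R = 1 \<and> acts_trivially G R}"

definition bohr_set :: "('g, 'm) monoid_scheme \<Rightarrow> 'g rep set set \<Rightarrow> real \<Rightarrow> 'g set"
  where "bohr_set G S \<epsilon> = {g \<in> carrier G. \<forall>\<sigma>\<in>S. \<forall>R\<in>\<sigma>. rep_seminorm R g < \<epsilon>}"

text \<open>
  A representation is non-trivial if some group element does not act as the identity. The infimum
  is \<open>\<infinity>\<close> if there is no such finite-dimensional representation.
\<close>

definition min_nontrivial_dim :: "('g, 'm) monoid_scheme \<Rightarrow> enat"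
  where "min_nontrivial_dim G =
    (INF R\<in>{R :: 'g rep. unitary_rep G R \<and> fin_dim R \<and> \<not> acts_trivially G R}. enat (rep_dim R))"

section \<open>Amenability, densities and ergodic sequences\<close>

definition amenable :: "('g, 'm) monoid_scheme \<Rightarrow> bool"
  where "amenable G \<longleftrightarrow> (\<exists>\<mu> :: 'g set \<Rightarrow> real.
    (\<forall>X\<subseteq>carrier G. 0 \<le> \<mu> X) \<and> \<mu> (carrier G) = 1 \<and>
    (\<forall>X\<subseteq>carrier G. \<forall>Y\<subseteq>carrier G. X \<inter> Y = {} \<longrightarrow> \<mu> (X \<union> Y) = \<mu> X + \<mu> Y) \<and>
    (\<forall>g\<in>carrier G. \<forall>X\<subseteq>carrier G. \<mu> (g <#\<^bsub>G\<^esub> X) = \<mu> X))"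

definition finite_subset_seq :: "('g, 'm) monoid_scheme \<Rightarrow> (nat \<Rightarrow> 'g set) \<Rightarrow> bool"
  where "finite_subset_seq G T \<longleftrightarrow> (\<forall>n. finite (T n) \<and> T n \<noteq> {} \<and> T n \<subseteq> carrier G)"

definition left_folner :: "('g, 'm) monoid_scheme \<Rightarrow> (nat \<Rightarrow> 'g set) \<Rightarrow> bool"
  where "left_folner G F \<longleftrightarrow> finite_subset_seq G F \<and>
    (\<forall>g\<in>carrier G. (\<lambda>n. real (card (sym_diff (g <#\<^bsub>G\<^esub> F n) (F n))) / real (card (F n))) \<longlonglongrightarrow> 0)"

definition upper_density :: "(nat \<Rightarrow> 'g set) \<Rightarrow> 'g set \<Rightarrow> ereal"
  where "upper_density T B = limsup (\<lambda>n. ereal (real (card (B \<inter> T n)) / real (card (T n))))"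

text \<open>If there is no left Folner sequence (as for uncountable groups), the value is \<open>-\<infinity>\<close>.\<close>

definition upper_banach_density :: "('g, 'm) monoid_scheme \<Rightarrow> 'g set \<Rightarrow> ereal"
  where "upper_banach_density G B = (SUP F\<in>{F. left_folner G F}. upper_density F B)"

text \<open>
  Convergence of the averages of \<open>u\<close> depends only on the cyclic subrepresentation generated by \<open>u\<close>,
  so the restriction to the ambient space \<open>'g \<times> nat \<Rightarrow> complex\<close> is no loss of generality.
\<close>

definition ergodic_seq :: "('g, 'm) monoid_scheme \<Rightarrow> (nat \<Rightarrow> 'g set) \<Rightarrow> bool"
  where "ergodic_seq G T \<longleftrightarrow> finite_subset_seq G T \<and>
    (\<forall>R :: 'g rep. unitary_rep G R \<longrightarrow> (\<forall>u\<in>vecs R.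
       weakly_converges (vecs R) (inner_prod R)
         (\<lambda>n. cscale (1 / of_nat (card (T n))) (\<Sum>g\<in>T n. act R g u))
         (orth_proj (inner_prod R) (fixed_vecs G R) u)))"

end

theory Submission
  imports Defs "HOL-Complex_Analysis.Great_Picard"
begin

text \<open>
  Let \<open>\<xi>\<close> be the indicator function of \<open>B\<close> in the \<open>L\<^sup>2\<close>-space of an invariant mean taken along a Folner
  sequence that almost realises the upper Banach density of \<open>B\<close>. The matrix coefficient
  \<open>\<phi>(\<gamma>) = \<langle>\<gamma>\<xi>, \<xi>\<rangle>\<close> is the mean of \<open>B \<inter> \<gamma>B\<close>, so it vanishes off \<open>BB\<^sup>-\<^sup>1\<close>. If \<open>\<eta>\<close> is a weak limit of the averages
  over \<open>T n\<close> of \<open>1\<^sub>A(a) a\<xi>\<close>, then \<open>\<langle>\<gamma>\<xi>, \<eta>\<rangle>\<close> is a limit of averages of \<open>\<phi>(a\<^sup>-\<^sup>1\<gamma>)\<close> over \<open>a \<in> A\<close>; hence it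
  suffices to make it positive for \<open>\<gamma>\<close> in a translate of a Bohr set.

  Ergodicity on the tensor square gives a limit \<open>K\<close> of the averages of the rank one forms of \<open>a\<xi>\<close>. It is
  an invariant compact form of trace at most \<open>\<parallel>\<xi>\<parallel>\<^sup>2\<close>, and by Cauchy-Schwarz
  \<open>|\<langle>\<eta>, w\<rangle> - \<alpha>\<langle>p, w\<rangle>|\<^sup>2 \<le> (\<alpha> - \<alpha>\<^sup>2) K(w, w)\<close>, where \<open>p\<close> is the projection of \<open>\<xi>\<close> to the fixed vectors.
  The spectral subspace on which \<open>K\<close> is at least \<open>\<kappa>\<close> is a sum of irreducible representations of total
  dimension at most \<open>\<parallel>\<xi>\<parallel>\<^sup>2 / \<kappa>\<close>; the non-trivial ones form \<open>S\<close>. The Bohr set of \<open>S\<close> moves the component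
  of \<open>\<xi>\<close> in this subspace by at most \<open>\<beta>/2 \<parallel>\<xi>\<parallel>\<close>, and the other component is almost orthogonal to \<open>\<eta>\<close>.
  Both errors together are smaller than \<open>\<parallel>\<eta>\<parallel>\<^sup>2/\<alpha> \<ge> \<alpha>\<beta>\<^sup>2\<close>, which \<open>\<langle>a\<xi>, \<eta>\<rangle>\<close> almost attains for some \<open>a \<in> A\<close>.
\<close>

section \<open>Inner product spaces of functions\<close>

text \<open>Ergodicity is assumed only for representations on spaces of functions on
  \<open>'g \<times> nat\<close>, while the argument needs a space attached to averages along a
  Folner sequence and also its tensor square. Both are realised as reproducing kernel spaces over
  this index set. Pairs of indices can be coded as indices because the carrier is countable, which
  the existence of a Folner sequence forces. Kernel vectors span a dense subspace, so for bounded
  sequences weak convergence is pointwise convergence, and weak limits come from a diagonal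
  argument. Compactness of \<open>K\<close> has the same source: \<open>K\<close> corresponds to an
  invariant vector of the tensor square, and approximating that vector by finite combinations of
  kernel vectors approximates \<open>K\<close> by finite rank forms. Indices with positive second
  component carry the constant function 1; Cauchy-Schwarz against it gives the lower bound on the
  norm of \<eta>. Constants: a density within one percent of \<beta> and an \<open>a0\<close> within
  two percent of \<open>\<alpha> * \<beta>0\<^sup>2\<close> leave more than 0.96 of
  \<open>\<alpha> * \<beta>\<^sup>2\<close>, against errors of 1/2 and 2/5.\<close>

lemma discriminant_bound:
  fixes z :: complex
  assumes *: "\<And>t. 0 \<le> a + 2 * Re (t * z) + (cmod t)\<^sup>2 * b" and "0 \<le> b"
  shows "(cmod z)\<^sup>2 \<le> a * b"
proof -
  define m where "m = (cmod z)\<^sup>2"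
  \<comment> \<open>Restricting to \<open>t = - s * cnj z\<close> leaves a real quadratic polynomial
    in s, minimal at \<open>1 / b\<close>. With \<open>a = 0\<close> the resulting bound says
    \<open>z = 0\<close>, which is how first-order optimality conditions are exploited
    below.\<close>
  have le: "0 \<le> a - 2 * (s * m) + s * s * m * b" for s :: real
  proof -
    have "- of_real s * cnj z * z = of_real (- (s * m))"
      unfolding m_def by (simp add: complex_norm_square del: of_real_power)
    then have 1: "Re (- of_real s * cnj z * z) = - (s * m)" by (simp only: Re_complex_of_real)
    have 2: "(cmod (- of_real s * cnj z))\<^sup>2 = s * s * m"
      by (simp add: m_def norm_mult power_mult_distrib power2_eq_square[of s])
    show ?thesis using *[of "- of_real s * cnj z"] unfolding 1 2 by simp
  qed
  show ?thesis
  proof (cases "b = 0")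
    case True
    have "m = 0"
    proof (rule ccontr)
      assume "m \<noteq> 0"
      \<comment> \<open>For \<open>b = 0\<close> the polynomial is linear in s and equals -1 at this
        point.\<close>
      then show False using le[of "(a + 1) / (2 * m)"] le[of 0] True by simp
    qed
    then show ?thesis by (simp add: True m_def)
  next
    case False
    then have "b > 0" using assms(2) by simp
    then show ?thesis using le[of "1 / b"] by (simp add: m_def[symmetric] field_simps)
  qed
qed

text \<open>Completeness is left out so that the kernel space below can use this theory before it is
  shown complete. \<open>ip_outside\<close> fixes junk values: a \<open>Metric_space\<close>
  requires its distance to be nonnegative and symmetric on the whole type.\<close>

locale inner_space =
  fixes V :: "('i \<Rightarrow> complex) set"
    and ip :: "('i \<Rightarrow> complex) \<Rightarrow> ('i \<Rightarrow> complex) \<Rightarrow> complex"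
  assumes V_subspace: "cfun.subspace V"
    and ip_add: "\<lbrakk>u \<in> V; v \<in> V; w \<in> V\<rbrakk> \<Longrightarrow> ip (u + v) w = ip u w + ip v w"
    and ip_scale: "\<lbrakk>u \<in> V; v \<in> V\<rbrakk> \<Longrightarrow> ip (cscale c u) v = c * ip u v"
    and ip_cnj: "\<lbrakk>u \<in> V; v \<in> V\<rbrakk> \<Longrightarrow> ip v u = cnj (ip u v)"
    and ip_positive: "\<lbrakk>u \<in> V; u \<noteq> 0\<rbrakk> \<Longrightarrow> 0 < Re (ip u u)"
    and ip_outside: "u \<notin> V \<Longrightarrow> ip u u = 0"
begin

abbreviation nrm :: "('i \<Rightarrow> complex) \<Rightarrow> real"
  where "nrm \<equiv> ip_norm ip"

abbreviation orth :: "('i \<Rightarrow> complex) set \<Rightarrow> ('i \<Rightarrow> complex) set"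
  where "orth B \<equiv> {v \<in> V. \<forall>e\<in>B. ip v e = 0}"

lemma V_zero [simp]: "0 \<in> V"
  and V_add [simp]: "u \<in> V \<Longrightarrow> v \<in> V \<Longrightarrow> u + v \<in> V"
  and V_scale [simp]: "u \<in> V \<Longrightarrow> cscale c u \<in> V"
  and V_diff [simp]: "u \<in> V \<Longrightarrow> v \<in> V \<Longrightarrow> u - v \<in> V"
  and V_sum: "(\<And>x. x \<in> I \<Longrightarrow> f x \<in> V) \<Longrightarrow> sum f I \<in> V"
  using V_subspace
  by (auto intro: cfun.subspace_0 cfun.subspace_add cfun.subspace_scale cfun.subspace_diff
      cfun.subspace_sum)

lemma diff_conv_cscale: "u - v = u + cscale (- 1) v"
  by (simp add: cscale_def fun_eq_iff)

lemma ip_diff_left: "\<lbrakk>u \<in> V; v \<in> V; w \<in> V\<rbrakk> \<Longrightarrow> ip (u - v) w = ip u w - ip v w"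
  unfolding diff_conv_cscale[of u] by (simp add: ip_add ip_scale del: cfun.scale_minus_left)

lemma ip_zero_left [simp]: "w \<in> V \<Longrightarrow> ip 0 w = 0"
  using ip_diff_left[of 0 0 w] by simp

lemma ip_zero_right [simp]: "w \<in> V \<Longrightarrow> ip w 0 = 0"
  using ip_cnj[of 0 w] by simp

lemma ip_add_right: "\<lbrakk>u \<in> V; v \<in> V; w \<in> V\<rbrakk> \<Longrightarrow> ip w (u + v) = ip w u + ip w v"
  using ip_cnj[of "u + v" w] ip_cnj[of u w] ip_cnj[of v w] by (simp add: ip_add)

lemma ip_scale_right: "\<lbrakk>u \<in> V; v \<in> V\<rbrakk> \<Longrightarrow> ip v (cscale c u) = cnj c * ip v u"
  using ip_cnj[of "cscale c u" v] ip_cnj[of u v] by (simp add: ip_scale)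

lemma ip_diff_right: "\<lbrakk>u \<in> V; v \<in> V; w \<in> V\<rbrakk> \<Longrightarrow> ip w (u - v) = ip w u - ip w v"
  unfolding diff_conv_cscale[of u] by (simp add: ip_add_right ip_scale_right del: cfun.scale_minus_left)

lemma ip_sum_left:
  "\<lbrakk>\<And>x. x \<in> I \<Longrightarrow> f x \<in> V; w \<in> V\<rbrakk> \<Longrightarrow> ip (sum f I) w = (\<Sum>x\<in>I. ip (f x) w)"
  by (induction I rule: infinite_finite_induct) (simp_all add: ip_add V_sum)

lemma ip_sum_right:
  "\<lbrakk>\<And>x. x \<in> I \<Longrightarrow> f x \<in> V; w \<in> V\<rbrakk> \<Longrightarrow> ip w (sum f I) = (\<Sum>x\<in>I. ip w (f x))"
  by (induction I rule: infinite_finite_induct) (simp_all add: ip_add_right V_sum)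

lemma ip_self_nonneg: "u \<in> V \<Longrightarrow> 0 \<le> Re (ip u u)"
  using ip_positive[of u] by (cases "u = 0") auto

lemma nrm_sq: "u \<in> V \<Longrightarrow> (nrm u)\<^sup>2 = Re (ip u u)"
  by (simp add: ip_norm_def ip_self_nonneg)

lemma ip_self: "u \<in> V \<Longrightarrow> ip u u = of_real ((nrm u)\<^sup>2)"
  using ip_cnj[of u u] nrm_sq[of u] by (simp add: complex_eq_iff)

lemma nrm_nonneg [simp]: "u \<in> V \<Longrightarrow> 0 \<le> nrm u"
  by (simp add: ip_norm_def ip_self_nonneg)

lemma nrm_zero [simp]: "nrm 0 = 0"
  by (simp add: ip_norm_def)

lemma nrm_eq_0_iff: "u \<in> V \<Longrightarrow> nrm u = 0 \<longleftrightarrow> u = 0"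
  using ip_positive[of u] by (cases "u = 0") (auto simp: ip_norm_def)

lemma nrm_scale: "u \<in> V \<Longrightarrow> nrm (cscale c u) = cmod c * nrm u"
proof -
  assume u: "u \<in> V"
  have "(nrm (cscale c u))\<^sup>2 = Re (of_real ((cmod c)\<^sup>2) * ip u u)"
    using u unfolding complex_norm_square
    by (simp only: nrm_sq V_scale ip_scale ip_scale_right mult_ac)
  also have "\<dots> = (cmod c * nrm u)\<^sup>2" using u by (simp add: nrm_sq power_mult_distrib)
  finally show ?thesis using u by (simp add: power2_eq_iff_nonneg)
qed

lemma nrm_add_sq: "\<lbrakk>u \<in> V; v \<in> V\<rbrakk> \<Longrightarrow> (nrm (u + v))\<^sup>2 = (nrm u)\<^sup>2 + 2 * Re (ip u v) + (nrm v)\<^sup>2"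
  using ip_cnj[of u v] by (simp add: nrm_sq ip_add ip_add_right)

lemma nrm_diff_sq: "\<lbrakk>u \<in> V; v \<in> V\<rbrakk> \<Longrightarrow> (nrm (u - v))\<^sup>2 = (nrm u)\<^sup>2 - 2 * Re (ip u v) + (nrm v)\<^sup>2"
  using ip_cnj[of u v] by (simp add: nrm_sq ip_diff_left ip_diff_right)

lemma cauchy_schwarz: "\<lbrakk>u \<in> V; v \<in> V\<rbrakk> \<Longrightarrow> cmod (ip u v) \<le> nrm u * nrm v"
proof -
  assume uv: "u \<in> V" "v \<in> V"
  have "(cmod (ip u v))\<^sup>2 \<le> (nrm u)\<^sup>2 * (nrm v)\<^sup>2"
  proof (rule discriminant_bound)
    fix t
    have "0 \<le> (nrm (u + cscale (cnj t) v))\<^sup>2" by simp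
    then show "0 \<le> (nrm u)\<^sup>2 + 2 * Re (t * ip u v) + (cmod t)\<^sup>2 * (nrm v)\<^sup>2"
      using uv by (simp add: nrm_add_sq ip_scale_right nrm_scale power_mult_distrib)
  qed simp
  then have "(cmod (ip u v))\<^sup>2 \<le> (nrm u * nrm v)\<^sup>2" by (simp add: power_mult_distrib)
  then show ?thesis by (rule power2_le_imp_le) (use uv in simp)
qed

lemma nrm_triangle: "\<lbrakk>u \<in> V; v \<in> V\<rbrakk> \<Longrightarrow> nrm (u + v) \<le> nrm u + nrm v"
proof -
  assume uv: "u \<in> V" "v \<in> V"
  have "Re (ip u v) \<le> nrm u * nrm v"
    by (rule order_trans[OF complex_Re_le_cmod cauchy_schwarz[OF uv]])
  then have "(nrm (u + v))\<^sup>2 \<le> (nrm u + nrm v)\<^sup>2"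
    using uv by (simp add: nrm_add_sq power2_sum)
  then show ?thesis by (rule power2_le_imp_le) (use uv in simp)
qed

lemma nrm_minus_commute: "\<lbrakk>u \<in> V; v \<in> V\<rbrakk> \<Longrightarrow> nrm (u - v) = nrm (v - u)"
proof -
  assume uv: "u \<in> V" "v \<in> V"
  have "u - v = cscale (- 1) (v - u)" by (simp add: cscale_def fun_eq_iff)
  then have "nrm (u - v) = nrm (cscale (- 1) (v - u))" by (rule arg_cong)
  also have "\<dots> = nrm (v - u)" using uv by (subst nrm_scale) simp_all
  finally show ?thesis .
qed

lemma nrm_diff_triangle: "\<lbrakk>u \<in> V; v \<in> V; w \<in> V\<rbrakk> \<Longrightarrow> nrm (u - w) \<le> nrm (u - v) + nrm (v - w)"
  using nrm_triangle[of "u - v" "v - w"] by simp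

lemma nrm_diff_le: "\<lbrakk>u \<in> V; v \<in> V\<rbrakk> \<Longrightarrow> nrm (u - v) \<le> nrm u + nrm v"
  using nrm_diff_triangle[of u 0 v] nrm_minus_commute[of 0 v] by simp

lemma parallelogram:
  "\<lbrakk>u \<in> V; v \<in> V\<rbrakk> \<Longrightarrow> (nrm (u + v))\<^sup>2 + (nrm (u - v))\<^sup>2 = 2 * (nrm u)\<^sup>2 + 2 * (nrm v)\<^sup>2"
  by (simp add: nrm_add_sq nrm_diff_sq)

lemma Metric_space_nrm: "W \<subseteq> V \<Longrightarrow> Metric_space W (\<lambda>u v. nrm (u - v))"
proof
  show "0 \<le> nrm (u - v)" for u v
    by (cases "u - v \<in> V") (simp_all add: ip_norm_def ip_self_nonneg ip_outside)
  show "nrm (u - v) = nrm (v - u)" for u v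
  proof (cases "u - v \<in> V")
    case True
    then show ?thesis using nrm_minus_commute[of 0 "u - v"] by simp
  next
    case False
    then have "v - u \<notin> V" using V_diff[of 0 "v - u"] by auto
    with False show ?thesis by (simp add: ip_norm_def ip_outside)
  qed
qed (auto simp: nrm_eq_0_iff nrm_diff_triangle subset_eq)

end

section \<open>Complete subspaces, orthonormal systems and finite-dimensional projections\<close>

context inner_space
begin

lemma hilbert_space_subspaceI:
  assumes "cfun.subspace W" "W \<subseteq> V"
    and cauchy: "\<And>x. \<lbrakk>\<And>n. x n \<in> W; \<And>e. e > 0 \<Longrightarrow> \<exists>N. \<forall>m\<ge>N. \<forall>n\<ge>N. nrm (x m - x n) < e\<rbrakk>
      \<Longrightarrow> \<exists>l\<in>W. (\<lambda>n. nrm (x n - l)) \<longlonglongrightarrow> 0"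
  shows "hilbert_space W ip"
proof
  interpret M: Metric_space W "\<lambda>u v. nrm (u - v)"
    using assms by (intro Metric_space_nrm)
  show "M.mcomplete"
    unfolding M.mcomplete_def
  proof (intro allI impI)
    fix \<sigma> assume \<sigma>: "M.MCauchy \<sigma>"
    then have "\<exists>l\<in>W. (\<lambda>n. nrm (\<sigma> n - l)) \<longlonglongrightarrow> 0"
    proof (intro cauchy)
      show "\<sigma> n \<in> W" for n using \<sigma> by (auto simp: M.MCauchy_def)
      show "\<exists>N. \<forall>m\<ge>N. \<forall>n\<ge>N. nrm (\<sigma> m - \<sigma> n) < e" if "e > 0" for e
        using \<sigma> that unfolding M.MCauchy_def by meson
    qed
    then obtain l where "l \<in> W" "(\<lambda>n. nrm (\<sigma> n - l)) \<longlonglongrightarrow> 0" by blast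
    moreover have "range \<sigma> \<subseteq> W" using \<sigma> by (simp add: M.MCauchy_def)
    ultimately show "\<exists>x. limitin M.mtopology \<sigma> x sequentially"
      using assms(2) by (intro exI[of _ l]) (auto simp: M.limitin_metric_dist_null image_subset_iff)
  qed
  show "ip v u = cnj (ip u v)" if "u \<in> W" "v \<in> W" for u v
    using that assms(2) by (intro ip_cnj) auto
qed (use assms in \<open>auto simp: ip_add ip_scale ip_positive subset_eq\<close>)

lemma nrm_tendsto:
  assumes "\<And>n. x n \<in> V" "l \<in> V" "(\<lambda>n. nrm (x n - l)) \<longlonglongrightarrow> 0"
  shows "(\<lambda>n. nrm (x n)) \<longlonglongrightarrow> nrm l"
proof (rule LIM_zero_cancel, rule tendsto_0_le[OF assms(3), where K = 1], rule always_eventually, rule allI)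
  fix n
  have "nrm (x n) \<le> nrm (x n - l) + nrm l" using nrm_triangle[of "x n - l" l] assms by simp
  moreover have "nrm l \<le> nrm (x n - l) + nrm (x n)"
    using nrm_triangle[of "l - x n" "x n"] nrm_minus_commute[of l "x n"] assms by simp
  ultimately show "norm (nrm (x n) - nrm l) \<le> norm (nrm (x n - l)) * 1"
    using assms by (simp add: abs_le_iff)
qed

definition orthonormal :: "('i \<Rightarrow> complex) set \<Rightarrow> bool"
  where "orthonormal B \<longleftrightarrow> finite B \<and> B \<subseteq> V \<and>
    (\<forall>e\<in>B. \<forall>f\<in>B. ip e f = (if e = f then 1 else 0))"

definition fproj :: "('i \<Rightarrow> complex) set \<Rightarrow> ('i \<Rightarrow> complex) \<Rightarrow> ('i \<Rightarrow> complex)"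
  where "fproj B u = (\<Sum>e\<in>B. cscale (ip u e) e)"

lemma orthonormal_empty [simp]: "orthonormal {}"
  by (simp add: orthonormal_def)

lemma orthonormal_finite [simp]: "orthonormal B \<Longrightarrow> finite B"
  and orthonormal_in: "orthonormal B \<Longrightarrow> e \<in> B \<Longrightarrow> e \<in> V"
  and orthonormal_ip: "orthonormal B \<Longrightarrow> e \<in> B \<Longrightarrow> f \<in> B \<Longrightarrow> ip e f = (if e = f then 1 else 0)"
  by (auto simp: orthonormal_def)

lemma orthonormal_nrm: "orthonormal B \<Longrightarrow> e \<in> B \<Longrightarrow> nrm e = 1"
  by (simp add: ip_norm_def orthonormal_ip)

lemma orthonormal_Un:
  assumes "orthonormal B" "orthonormal C" and *: "\<And>e f. e \<in> B \<Longrightarrow> f \<in> C \<Longrightarrow> ip e f = 0"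
  shows "orthonormal (B \<union> C)" and "B \<inter> C = {}"
proof -
  show "B \<inter> C = {}"
    using *[of x x for x] orthonormal_ip[OF assms(1), of x x for x] by force
  have "ip f e = 0" if "e \<in> B" "f \<in> C" for e f
    using ip_cnj[of e f] *[OF that] that assms orthonormal_in by auto
  then show "orthonormal (B \<union> C)"
    using assms \<open>B \<inter> C = {}\<close> unfolding orthonormal_def by (metis IntI UnE Un_least emptyE finite_UnI)
qed

lemma span_subset_V: "B \<subseteq> V \<Longrightarrow> cfun.span B \<subseteq> V"
  using V_subspace cfun.span_minimal by blast

context
  fixes B assumes B: "orthonormal B"
begin

lemma fproj_in_span: "fproj B u \<in> cfun.span B"
  unfolding fproj_def by (intro cfun.span_sum cfun.span_scale cfun.span_base)

lemma orthonormal_span: "cfun.span B \<subseteq> V"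
  using orthonormal_in[OF B] by (intro span_subset_V subsetI)

lemma fproj_in [simp]: "fproj B u \<in> V"
  using fproj_in_span orthonormal_span by blast

lemma ip_fproj_base: "e \<in> B \<Longrightarrow> ip (fproj B u) e = ip u e"
proof -
  assume e: "e \<in> B"
  have "ip (fproj B u) e = (\<Sum>f\<in>B. ip (cscale (ip u f) f) e)"
    unfolding fproj_def using B e orthonormal_in by (intro ip_sum_left) auto
  also have "\<dots> = (\<Sum>f\<in>B. if f = e then ip u f else 0)"
    using B e by (intro sum.cong) (auto simp: ip_scale orthonormal_in orthonormal_ip)
  also have "\<dots> = ip u e" using B e by (simp add: sum.delta)
  finally show ?thesis .
qed

lemma orth_span:
  assumes "u \<in> V" "\<And>e. e \<in> B \<Longrightarrow> ip u e = 0" "w \<in> cfun.span B"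
  shows "ip u w = 0"
proof -
  have "B \<subseteq> {w \<in> V. ip u w = 0}" using assms B orthonormal_in by auto
  moreover have "cfun.subspace {w \<in> V. ip u w = 0}"
    using assms(1) by (auto simp: cfun.subspace_def ip_add_right ip_scale_right)
  ultimately show ?thesis using cfun.span_minimal assms(3) by blast
qed

lemma fproj_orth: "u \<in> V \<Longrightarrow> w \<in> cfun.span B \<Longrightarrow> ip (u - fproj B u) w = 0"
  by (rule orth_span) (use B in \<open>auto simp: ip_diff_left ip_fproj_base orthonormal_in\<close>)

lemma fproj_span_eq: "u \<in> cfun.span B \<Longrightarrow> fproj B u = u"
proof -
  assume u: "u \<in> cfun.span B"
  have uV: "u \<in> V" using u orthonormal_span by blast
  have "ip (u - fproj B u) (u - fproj B u) = 0"
    using u uV fproj_in_span by (intro fproj_orth cfun.span_diff) auto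
  then have "nrm (u - fproj B u) = 0" by (simp add: ip_norm_def)
  then show ?thesis using uV by (simp add: nrm_eq_0_iff)
qed

lemma nrm_pythagoras: "u \<in> V \<Longrightarrow> (nrm u)\<^sup>2 = (nrm (u - fproj B u))\<^sup>2 + (nrm (fproj B u))\<^sup>2"
  using nrm_add_sq[of "u - fproj B u" "fproj B u"] fproj_orth[of u "fproj B u"] fproj_in_span
  by simp

lemma nrm_fproj_sq: "u \<in> V \<Longrightarrow> (nrm (fproj B u))\<^sup>2 = (\<Sum>e\<in>B. (cmod (ip u e))\<^sup>2)"
proof -
  assume u: "u \<in> V"
  have "ip (fproj B u) (fproj B u) = (\<Sum>e\<in>B. ip (fproj B u) (cscale (ip u e) e))"
    by (subst (2) fproj_def, rule ip_sum_right) (use B orthonormal_in in auto)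
  also have "\<dots> = (\<Sum>e\<in>B. of_real ((cmod (ip u e))\<^sup>2))"
    using B unfolding complex_norm_square
    by (intro sum.cong) (simp_all add: ip_scale_right orthonormal_in ip_fproj_base)
  finally show ?thesis using u by (simp add: nrm_sq)
qed

lemma bessel: "u \<in> V \<Longrightarrow> (\<Sum>e\<in>B. (cmod (ip u e))\<^sup>2) \<le> (nrm u)\<^sup>2"
  using nrm_pythagoras[of u] nrm_fproj_sq[of u] by simp

lemma nrm_fproj_le: "u \<in> V \<Longrightarrow> nrm (fproj B u) \<le> nrm u"
  by (rule power2_le_imp_le) (use nrm_pythagoras[of u] in auto)

lemma nrm_diff_fproj_le: "u \<in> V \<Longrightarrow> nrm (u - fproj B u) \<le> nrm u"
  by (rule power2_le_imp_le) (use nrm_pythagoras[of u] in auto)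

lemma orthonormal_independent: "cfun.independent B"
proof (rule ccontr)
  assume "\<not> ?thesis"
  then obtain a where a: "\<exists>v\<in>B. a v \<noteq> 0" "(\<Sum>v\<in>B. cscale (a v) v) = 0"
    using cfun.dependent_finite[of B] B by auto
  then obtain e where e: "e \<in> B" "a e \<noteq> 0" by blast
  have "0 = ip (\<Sum>v\<in>B. cscale (a v) v) e" using a e B by (simp add: orthonormal_in)
  also have "\<dots> = (\<Sum>v\<in>B. ip (cscale (a v) v) e)"
    using B e orthonormal_in by (intro ip_sum_left) auto
  also have "\<dots> = (\<Sum>v\<in>B. if v = e then a v else 0)"
    using B e by (intro sum.cong) (auto simp: ip_scale orthonormal_in orthonormal_ip)
  also have "\<dots> = a e" using B e by (simp add: sum.delta)
  finally show False using e by simp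
qed

lemma dim_orthonormal_span: "cfun.dim (cfun.span B) = card B"
  using orthonormal_independent by (simp add: cfun.dim_eq_card_independent)

lemma fproj_diff: "u \<in> V \<Longrightarrow> v \<in> V \<Longrightarrow> fproj B (u - v) = fproj B u - fproj B v"
  unfolding fproj_def sum_subtractf[symmetric]
  by (intro sum.cong) (use B in \<open>auto simp: ip_diff_left orthonormal_in cfun.scale_left_diff_distrib\<close>)

end

lemma orthonormal_normalize: "w \<in> V \<Longrightarrow> w \<noteq> 0 \<Longrightarrow> orthonormal {cscale (of_real (1 / nrm w)) w}"
  using ip_self[of "cscale (of_real (1 / nrm w)) w"]
  by (simp add: orthonormal_def nrm_scale norm_divide nrm_eq_0_iff del: of_real_divide)

lemma orthonormal_extend:
  assumes "orthonormal B" "w \<in> V" "w \<noteq> 0" "\<And>e. e \<in> B \<Longrightarrow> ip w e = 0"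
  defines "f \<equiv> cscale (of_real (1 / nrm w)) w"
  shows "orthonormal (insert f B)" "f \<notin> B"
proof -
  have "ip f e = 0" if "e \<in> B" for e
    using assms that by (simp add: f_def ip_scale orthonormal_in)
  moreover have "orthonormal {f}" unfolding f_def using assms by (intro orthonormal_normalize)
  ultimately show "orthonormal (insert f B)" "f \<notin> B"
    using orthonormal_Un[of "{f}" B] assms(1) by auto
qed

text \<open>An orthonormal set in \<open>W\<close> of greatest size spans \<open>W\<close>, since
  normalising the residual of a missed vector would enlarge it. Finite dimension is expressed as a
  bound on such sets because that is the form in which a trace estimate later supplies it.\<close>

lemma orthonormal_basis_exists:
  assumes W: "cfun.subspace W" "W \<subseteq> V"
    and bound: "\<And>B. orthonormal B \<Longrightarrow> B \<subseteq> W \<Longrightarrow> card B \<le> N"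
  obtains B where "orthonormal B" "cfun.span B = W"
proof -
  have "\<exists>B. (orthonormal B \<and> B \<subseteq> W) \<and> (\<forall>C. orthonormal C \<and> C \<subseteq> W \<longrightarrow> card C \<le> card B)"
    by (rule ex_has_greatest_nat[of _ "{}" card "Suc N"]) (use bound in \<open>auto simp: less_Suc_eq_le\<close>)
  then obtain B where B: "orthonormal B" "B \<subseteq> W"
    and max: "\<And>C. orthonormal C \<Longrightarrow> C \<subseteq> W \<Longrightarrow> card C \<le> card B" by blast
  have sub: "cfun.span B \<subseteq> W" using B W cfun.span_minimal by blast
  moreover have "w \<in> cfun.span B" if w: "w \<in> W" for w
  proof (rule ccontr)
    assume "w \<notin> cfun.span B"
    then have nz: "w - fproj B w \<noteq> 0" using fproj_in_span[OF B(1), of w] by auto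
    have wW: "w - fproj B w \<in> W"
      using w sub fproj_in_span[OF B(1)] W by (intro cfun.subspace_diff) auto
    define f where "f = cscale (of_real (1 / nrm (w - fproj B w))) (w - fproj B w)"
    have "orthonormal (insert f B)" "f \<notin> B"
      unfolding f_def using nz wW W w B fproj_orth[OF B(1)] cfun.span_base
      by (intro orthonormal_extend; blast)+
    moreover have "f \<in> W" unfolding f_def using wW W(1) by (intro cfun.subspace_scale)
    ultimately show False using max[of "insert f B"] B by simp
  qed
  ultimately show ?thesis using B that by blast
qed

end

section \<open>Hilbert spaces and orthogonal projections\<close>

locale hspace = inner_space V ip
  for V :: "('i \<Rightarrow> complex) set" and ip :: "('i \<Rightarrow> complex) \<Rightarrow> ('i \<Rightarrow> complex) \<Rightarrow> complex" +
  assumes cauchy_convergent: "\<lbrakk>\<And>n. x n \<in> V; \<And>e. e > 0 \<Longrightarrow> \<exists>N. \<forall>m\<ge>N. \<forall>n\<ge>N. nrm (x m - x n) < e\<rbrakk>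
      \<Longrightarrow> \<exists>l\<in>V. (\<lambda>n. nrm (x n - l)) \<longlonglongrightarrow> 0"
begin

lemma hilbert_space: "hilbert_space V ip"
  using V_subspace cauchy_convergent by (intro hilbert_space_subspaceI) auto

lemma hilbert_space_span:
  assumes B: "orthonormal B"
  shows "hilbert_space (cfun.span B) ip"
proof (rule hilbert_space_subspaceI)
  fix x :: "nat \<Rightarrow> 'i \<Rightarrow> complex"
  assume x: "\<And>n. x n \<in> cfun.span B"
    and cauchy: "\<And>e. e > 0 \<Longrightarrow> \<exists>N. \<forall>m\<ge>N. \<forall>n\<ge>N. nrm (x m - x n) < e"
  have xV: "x n \<in> V" for n using x orthonormal_span[OF B] by blast
  obtain l where l: "l \<in> V" "(\<lambda>n. nrm (x n - l)) \<longlonglongrightarrow> 0"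
    using cauchy_convergent[of x] xV cauchy by blast
  \<comment> \<open>The map \<open>u - fproj B u\<close> is a contraction that kills
    \<open>x n\<close>, so \<open>l\<close> is no farther from its projection than from
    \<open>x n\<close>.\<close>
  have "nrm (l - fproj B l) \<le> nrm (x n - l)" for n
    using nrm_diff_fproj_le[OF B, of "x n - l"] nrm_minus_commute[of l "fproj B l"] xV l(1) B
    by (simp add: fproj_diff[OF B] fproj_span_eq[OF B x])
  then have "nrm (l - fproj B l) \<le> 0" by (intro LIMSEQ_le_const[OF l(2)]) auto
  then have "nrm (l - fproj B l) = 0" using l(1) B by (intro order_antisym) auto
  then have "l = fproj B l" using l(1) B nrm_eq_0_iff[of "l - fproj B l"] by simp
  then show "\<exists>l\<in>cfun.span B. (\<lambda>n. nrm (x n - l)) \<longlonglongrightarrow> 0"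
    using fproj_in_span[OF B, of l] l(2) by auto
qed (use orthonormal_span[OF B] in auto)

text \<open>Closest point argument: the parallelogram law, with the midpoint of two approximants as
  competitor, makes a minimising sequence Cauchy, and minimality against
  \<open>p - cscale (cnj t) w\<close> gives orthogonality. It is applied to the fixed vectors, which
  may be infinite-dimensional, so \<open>fproj\<close> does not serve.\<close>

lemma projection_exists:
  assumes M: "cfun.subspace M" "M \<subseteq> V" and u: "u \<in> V"
    and closed: "\<And>x l. \<lbrakk>\<And>n. x n \<in> M; l \<in> V; (\<lambda>n. nrm (x n - l)) \<longlonglongrightarrow> 0\<rbrakk> \<Longrightarrow> l \<in> M"
  obtains p where "p \<in> M" "\<And>w. w \<in> M \<Longrightarrow> ip (u - p) w = 0"
proof -
  have MV: "m \<in> V" if "m \<in> M" for m using that M by blast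
  define D where "D = (\<lambda>m. (nrm (u - m))\<^sup>2) ` M"
  define d where "d = Inf D"
  have ne: "D \<noteq> {}" using cfun.subspace_0[OF M(1)] by (auto simp: D_def)
  have bdd: "bdd_below D" by (rule bdd_belowI[of _ 0]) (auto simp: D_def)
  have d_le: "d \<le> (nrm (u - m))\<^sup>2" if "m \<in> M" for m
    unfolding d_def using bdd that by (intro cInf_lower) (auto simp: D_def)
  have "\<exists>m\<in>M. (nrm (u - m))\<^sup>2 < d + 1 / real (Suc n)" for n
    using cInf_less_iff[OF ne bdd, of "d + 1 / real (Suc n)"] by (auto simp: d_def D_def)
  then obtain m where m: "\<And>n. m n \<in> M" "\<And>n. (nrm (u - m n))\<^sup>2 < d + 1 / real (Suc n)"
    by metis
  have close: "(nrm (m i - m j))\<^sup>2 \<le> 2 / real (Suc i) + 2 / real (Suc j)" for i j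
  proof -
    have mid: "cscale (1 / 2) (m i + m j) \<in> M"
      using m M by (intro cfun.subspace_scale cfun.subspace_add) auto
    have e1: "(u - m j) + (u - m i) = cscale 2 (u - cscale (1 / 2) (m i + m j))"
      and e2: "(u - m j) - (u - m i) = m i - m j"
      by (auto simp: fun_eq_iff cscale_def algebra_simps)
    have "(nrm (cscale 2 (u - cscale (1 / 2) (m i + m j))))\<^sup>2 + (nrm (m i - m j))\<^sup>2 =
        2 * (nrm (u - m j))\<^sup>2 + 2 * (nrm (u - m i))\<^sup>2"
      using parallelogram[of "u - m j" "u - m i"] m MV u unfolding e1 e2 by simp
    moreover have "(nrm (cscale 2 (u - cscale (1 / 2) (m i + m j))))\<^sup>2 \<ge> 4 * d"
      using d_le[OF mid] u MV[OF mid] by (simp add: nrm_scale power_mult_distrib)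
    ultimately show ?thesis using m(2)[of i] m(2)[of j] by simp
  qed
  have "\<exists>l\<in>V. (\<lambda>n. nrm (m n - l)) \<longlonglongrightarrow> 0"
  proof (rule cauchy_convergent)
    fix e :: real assume e: "e > 0"
    obtain N where N: "4 / e\<^sup>2 < real N" using reals_Archimedean2 by blast
    have "nrm (m i - m j) < e" if "i \<ge> N" "j \<ge> N" for i j
    proof (rule power2_less_imp_less)
      have "N > 0" using N e by (intro gr0I) (auto simp: field_simps)
      have "(nrm (m i - m j))\<^sup>2 \<le> 2 / real (Suc i) + 2 / real (Suc j)" by (rule close)
      also have "\<dots> \<le> 2 / real N + 2 / real N"
        using that \<open>N > 0\<close> by (intro add_mono divide_left_mono) auto
      also have "\<dots> < e\<^sup>2" using N e \<open>N > 0\<close> by (simp add: field_simps)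
      finally show "(nrm (m i - m j))\<^sup>2 < e\<^sup>2" .
    qed (use e in simp)
    then show "\<exists>N. \<forall>i\<ge>N. \<forall>j\<ge>N. nrm (m i - m j) < e" by blast
  qed (use m MV in blast)
  then obtain p where p: "p \<in> V" "(\<lambda>n. nrm (m n - p)) \<longlonglongrightarrow> 0" by blast
  have pM: "p \<in> M" using closed m p by blast
  have lim: "(\<lambda>n. (nrm (m n - u))\<^sup>2) \<longlonglongrightarrow> (nrm (p - u))\<^sup>2"
    using m MV p u by (intro tendsto_power nrm_tendsto) auto
  moreover have "(\<lambda>n. d + 1 / real (Suc n)) \<longlonglongrightarrow> d + 0"
    by (intro tendsto_intros LIMSEQ_Suc lim_1_over_n)
  ultimately have "(nrm (p - u))\<^sup>2 \<le> d + 0"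
    using m(2) MV m(1) u
    by (intro LIMSEQ_le[OF lim]) (auto simp: nrm_minus_commute intro!: less_imp_le exI[of _ 0])
  then have pd: "(nrm (u - p))\<^sup>2 \<le> d" using p u by (simp add: nrm_minus_commute)
  have "ip (u - p) w = 0" if w: "w \<in> M" for w
  proof -
    have "(cmod (ip (u - p) w))\<^sup>2 \<le> 0 * (nrm w)\<^sup>2"
    proof (rule discriminant_bound)
      fix t
      have "p - cscale (cnj t) w \<in> M"
        using pM w M by (intro cfun.subspace_diff cfun.subspace_scale)
      then have "d \<le> (nrm (u - (p - cscale (cnj t) w)))\<^sup>2" by (rule d_le)
      also have "u - (p - cscale (cnj t) w) = (u - p) + cscale (cnj t) w" by simp
      also have "(nrm \<dots>)\<^sup>2 = (nrm (u - p))\<^sup>2 + 2 * Re (t * ip (u - p) w) + (cmod t)\<^sup>2 * (nrm w)\<^sup>2"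
        using p u MV[OF w] by (simp add: nrm_add_sq ip_scale_right nrm_scale power_mult_distrib)
      finally show "0 \<le> 0 + 2 * Re (t * ip (u - p) w) + (cmod t)\<^sup>2 * (nrm w)\<^sup>2"
        using pd by simp
    qed simp
    then show ?thesis by simp
  qed
  with pM show ?thesis using that by blast
qed

lemma orth_proj_eqI:
  assumes M: "cfun.subspace M" "M \<subseteq> V" and u: "u \<in> V"
    and p: "p \<in> M" "\<And>w. w \<in> M \<Longrightarrow> ip (u - p) w = 0"
  shows "orth_proj ip M u = p"
  unfolding orth_proj_def
proof (rule the_equality)
  fix q assume q: "q \<in> M \<and> (\<forall>w\<in>M. ip (u - q) w = 0)"
  have qp: "q - p \<in> M" using q p M by (intro cfun.subspace_diff) auto
  have inV: "p \<in> V" "q \<in> V" using p q M by auto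
  have "ip (u - p) (q - p) = 0" "ip (u - q) (q - p) = 0" using q p qp by blast+
  then have "ip (q - p) (q - p) = 0"
    using inV u by (simp add: ip_diff_left)
  then have "nrm (q - p) = 0" by (simp add: ip_norm_def)
  then show "q = p" using inV by (simp add: nrm_eq_0_iff)
qed (use p in blast)

end

section \<open>Reproducing kernel Hilbert spaces\<close>

text \<open>
  A list \<open>c\<close> of pairs \<open>(x, a)\<close> stands for the vector \<open>\<Sum> cnj a \<cdot> e\<^sub>x\<close>, where \<open>e\<^sub>x\<close> is the point
  evaluation at \<open>x\<close>; thus \<open>pairing f c\<close> is the inner product of \<open>f\<close> with that vector.
\<close>

definition pairing :: "('i \<Rightarrow> complex) \<Rightarrow> ('i \<times> complex) list \<Rightarrow> complex"
  where "pairing f c = (\<Sum>(x, a)\<leftarrow>c. a * f x)"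

definition scale_list :: "complex \<Rightarrow> ('i \<times> complex) list \<Rightarrow> ('i \<times> complex) list"
  where "scale_list t c = map (\<lambda>(x, a). (x, t * a)) c"

lemma pairing_Nil [simp]: "pairing f [] = 0"
  and pairing_Cons [simp]: "pairing f (p # c) = snd p * f (fst p) + pairing f c"
  and pairing_append [simp]: "pairing f (c @ d) = pairing f c + pairing f d"
  by (simp_all add: pairing_def case_prod_beta)

lemma pairing_scale_list [simp]: "pairing f (scale_list t c) = t * pairing f c"
  by (induction c) (auto simp: scale_list_def algebra_simps)

lemma pairing_zero [simp]: "pairing 0 c = 0"
  and pairing_add [simp]: "pairing (f + g) c = pairing f c + pairing g c"
  and pairing_diff [simp]: "pairing (f - g) c = pairing f c - pairing g c"
  and pairing_cscale [simp]: "pairing (cscale t f) c = t * pairing f c"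
  by (induction c) (auto simp: cscale_def algebra_simps)

lemma pairing_cong: "(\<And>x. x \<in> fst ` set c \<Longrightarrow> f x = g x) \<Longrightarrow> pairing f c = pairing g c"
  by (induction c) auto

lemma pairing_tendsto:
  "(\<And>x. x \<in> fst ` set c \<Longrightarrow> (\<lambda>n. f n x) \<longlonglongrightarrow> g x) \<Longrightarrow> (\<lambda>n. pairing (f n) c) \<longlonglongrightarrow> pairing g c"
  by (induction c) (auto intro!: tendsto_intros)

lemma fst_set_scale_list [simp]: "fst ` set (scale_list t c) = fst ` set c"
  by (force simp: scale_list_def)

lemma Cauchy_if_null_bound:
  fixes a :: "nat \<Rightarrow> complex"
  assumes "s \<longlonglongrightarrow> 0" and le: "\<And>m n. cmod (a m - a n) \<le> s m + s n"
  shows "convergent a"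
proof (subst Cauchy_convergent_iff[symmetric], rule CauchyI)
  fix r :: real assume "r > 0"
  then obtain N where N: "\<And>n. n \<ge> N \<Longrightarrow> \<bar>s n\<bar> < r / 2"
    using LIMSEQ_D[OF assms(1), of "r / 2"] by auto
  have "norm (a m - a n) < r" if "m \<ge> N" "n \<ge> N" for m n
    using le[of m n] N[OF that(1)] N[OF that(2)] by simp
  then show "\<exists>N. \<forall>m\<ge>N. \<forall>n\<ge>N. norm (a m - a n) < r" by blast
qed

lemma sq_le_imp_le_sq:
  fixes q K :: real
  assumes "0 \<le> q" "0 \<le> K" "q \<le> K * sqrt q"
  shows "q \<le> K\<^sup>2"
proof (cases "q = 0")
  case False
  then have "sqrt q * sqrt q \<le> K * sqrt q" "sqrt q > 0" using assms by simp_all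
  then have "sqrt q \<le> K" by (simp only: mult_le_cancel_right_pos)
  then show ?thesis by (rule sqrt_le_D)
qed simp

text \<open>In \<open>k_pos\<close> the form is the sum of \<open>cnj a * b * k x y\<close> over
  entries \<open>(x, a)\<close> and \<open>(y, b)\<close> of \<open>c\<close>: the square norm of
  the vector for which \<open>c\<close> stands, when \<open>k x y\<close> is the inner product of
  the point evaluations.\<close>

locale pd_kernel =
  fixes X :: "'i set" and k :: "'i \<Rightarrow> 'i \<Rightarrow> complex"
  assumes k_cnj: "\<lbrakk>x \<in> X; y \<in> X\<rbrakk> \<Longrightarrow> k y x = cnj (k x y)"
    and k_pos: "fst ` set c \<subseteq> X \<Longrightarrow> 0 \<le> Re (pairing (\<lambda>y. cnj (pairing (k y) c)) c)"
begin

abbreviation L :: "('i \<times> complex) list \<Rightarrow> bool" where "L c \<equiv> fst ` set c \<subseteq> X"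

definition comb :: "('i \<times> complex) list \<Rightarrow> 'i \<Rightarrow> complex"
  where "comb c = (\<lambda>y. if y \<in> X then cnj (pairing (k y) c) else 0)"

definition gram :: "('i \<times> complex) list \<Rightarrow> ('i \<times> complex) list \<Rightarrow> complex"
  where "gram c d = pairing (comb c) d"

definition qnorm :: "('i \<times> complex) list \<Rightarrow> real" where "qnorm c = Re (gram c c)"

lemma comb_append [simp]: "comb (c @ d) = comb c + comb d"
  and comb_scale_list [simp]: "comb (scale_list t c) = cscale (cnj t) (comb c)"
  by (auto simp: comb_def cscale_def)

lemma gram_append [simp]: "gram c (d @ d') = gram c d + gram c d'" "gram (c @ c') d = gram c d + gram c' d"
  and gram_scale_list [simp]: "gram c (scale_list t d) = t * gram c d"
    "gram (scale_list t c) d = cnj t * gram c d"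
  by (simp_all add: gram_def)

lemma gram_cnj: "L c \<Longrightarrow> L d \<Longrightarrow> gram d c = cnj (gram c d)"
proof (induction d)
  case Nil
  have "comb [] = 0" by (simp add: comb_def fun_eq_iff)
  then show ?case by (simp add: gram_def)
next
  case (Cons p d)
  have "gram [p] c = cnj (gram c [p])"
    using Cons.prems(1)
  proof (induction c)
    case Nil
    have "comb [] = 0" by (simp add: comb_def fun_eq_iff)
    then show ?case by (simp add: gram_def)
  next
    case (Cons q c)
    then show ?case using Cons.prems \<open>L (p # d)\<close> k_cnj[of "fst p" "fst q"]
      by (auto simp: gram_def comb_def algebra_simps)
  qed
  then show ?case
    using Cons gram_append(1)[of c "[p]" d] gram_append(2)[of "[p]" d c] by simp
qed

lemma qnorm_nonneg: "L c \<Longrightarrow> 0 \<le> qnorm c"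
proof -
  assume c: "L c"
  have "gram c c = pairing (\<lambda>y. cnj (pairing (k y) c)) c"
    unfolding gram_def by (rule pairing_cong) (use c in \<open>auto simp: comb_def\<close>)
  then show ?thesis using k_pos[OF c] by (simp add: qnorm_def)
qed

lemma qnorm_append_scale:
  "L c \<Longrightarrow> L d \<Longrightarrow> qnorm (c @ scale_list t d) = qnorm c + 2 * Re (t * gram c d) + (cmod t)\<^sup>2 * qnorm d"
proof -
  assume cd: "L c" "L d"
  show ?thesis
    unfolding qnorm_def gram_append gram_scale_list gram_cnj[OF cd]
    by (simp add: cmod_power2 algebra_simps power2_eq_square[of "Re t"] power2_eq_square[of "Im t"])
qed

lemma gram_cauchy_schwarz: "L c \<Longrightarrow> L d \<Longrightarrow> (cmod (gram c d))\<^sup>2 \<le> qnorm c * qnorm d"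
proof (rule discriminant_bound)
  assume cd: "L c" "L d"
  show "0 \<le> qnorm c + 2 * Re (t * gram c d) + (cmod t)\<^sup>2 * qnorm d" for t
    using qnorm_nonneg[of "c @ scale_list t d"] cd qnorm_append_scale[OF cd, of t]
    by (simp add: image_Un)
qed (rule qnorm_nonneg)

text \<open>The reproducing kernel Hilbert space, described from outside by bounded pairing with
  finite combinations. Its elements are functions from the start, so neither a quotient by null
  vectors nor a completion is formed.\<close>

definition H :: "('i \<Rightarrow> complex) set"
  where "H = {f. (\<forall>x. x \<notin> X \<longrightarrow> f x = 0) \<and>
    (\<exists>C. \<forall>c. L c \<longrightarrow> (cmod (pairing f c))\<^sup>2 \<le> C * qnorm c)}"

lemma H_outside: "f \<in> H \<Longrightarrow> x \<notin> X \<Longrightarrow> f x = 0"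
  by (simp add: H_def)

lemma H_bounded:
  assumes "f \<in> H"
  obtains C where "C \<ge> 0" "\<And>c. L c \<Longrightarrow> (cmod (pairing f c))\<^sup>2 \<le> C * qnorm c"
proof -
  obtain C where C: "\<And>c. L c \<Longrightarrow> (cmod (pairing f c))\<^sup>2 \<le> C * qnorm c"
    using assms by (auto simp: H_def)
  have "(cmod (pairing f c))\<^sup>2 \<le> \<bar>C\<bar> * qnorm c" if "L c" for c
    using C[OF that] mult_right_mono[OF abs_ge_self[of C] qnorm_nonneg[OF that]] by linarith
  then show ?thesis using that[of "\<bar>C\<bar>"] by simp
qed

lemma HI:
  assumes "\<And>x. x \<notin> X \<Longrightarrow> f x = 0" "\<And>c. L c \<Longrightarrow> (cmod (pairing f c))\<^sup>2 \<le> C * qnorm c"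
  shows "f \<in> H"
  using assms by (auto simp: H_def)

lemma comb_in_H [simp]: "L c \<Longrightarrow> comb c \<in> H"
  by (rule HI[where C = "qnorm c"]) (auto simp: gram_def[symmetric] gram_cauchy_schwarz, simp add: comb_def)

lemma subspace_H: "cfun.subspace H"
proof (rule cfun.subspaceI)
  show "0 \<in> H" by (rule HI[where C = 0]) auto
next
  fix f g assume fg: "f \<in> H" "g \<in> H"
  obtain C where C: "\<And>c. L c \<Longrightarrow> (cmod (pairing f c))\<^sup>2 \<le> C * qnorm c"
    using H_bounded[OF fg(1)] by blast
  obtain D where D: "\<And>c. L c \<Longrightarrow> (cmod (pairing g c))\<^sup>2 \<le> D * qnorm c"
    using H_bounded[OF fg(2)] by blast
  show "f + g \<in> H"
  proof (rule HI[where C = "2 * C + 2 * D"])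
    fix c assume c: "L c"
    have "(cmod (pairing f c + pairing g c))\<^sup>2 \<le> (cmod (pairing f c) + cmod (pairing g c))\<^sup>2"
      by (intro power_mono norm_triangle_ineq) simp
    also have "\<dots> \<le> 2 * (cmod (pairing f c))\<^sup>2 + 2 * (cmod (pairing g c))\<^sup>2"
      using zero_le_power2[of "cmod (pairing f c) - cmod (pairing g c)"]
      by (simp add: power2_diff power2_sum)
    finally show "(cmod (pairing (f + g) c))\<^sup>2 \<le> (2 * C + 2 * D) * qnorm c"
      using C[OF c] D[OF c] by (simp add: algebra_simps)
  qed (use fg in \<open>simp add: H_outside\<close>)
next
  fix t f assume f: "f \<in> H"
  obtain C where C: "\<And>c. L c \<Longrightarrow> (cmod (pairing f c))\<^sup>2 \<le> C * qnorm c"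
    using H_bounded[OF f] by blast
  show "cscale t f \<in> H"
  proof (rule HI[where C = "(cmod t)\<^sup>2 * C"])
    show "(cmod (pairing (cscale t f) c))\<^sup>2 \<le> (cmod t)\<^sup>2 * C * qnorm c" if "L c" for c
      using mult_left_mono[OF C[OF that], of "(cmod t)\<^sup>2"]
      by (simp add: norm_mult power_mult_distrib mult.assoc)
  qed (use f in \<open>simp add: H_outside cscale_def\<close>)
qed

text \<open>
  An almost maximiser of \<open>c \<mapsto> 2 Re (pairing f c) - qnorm c\<close> is an approximation of \<open>f\<close>
  in the dual norm. This replaces the Riesz representation theorem.
\<close>

lemma H_approx:
  assumes f: "f \<in> H" and "\<epsilon> > 0"
  shows "\<exists>c. L c \<and> (\<forall>d. L d \<longrightarrow> (cmod (pairing f d - gram c d))\<^sup>2 \<le> \<epsilon> * qnorm d)"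
proof -
  define J where "J c = 2 * Re (pairing f c) - qnorm c" for c
  obtain C where C: "C \<ge> 0" "\<And>c. L c \<Longrightarrow> (cmod (pairing f c))\<^sup>2 \<le> C * qnorm c"
    using H_bounded[OF f] by blast
  have "J c \<le> C" if c: "L c" for c
  proof -
    have "(cmod (pairing f c))\<^sup>2 \<le> (sqrt C * sqrt (qnorm c))\<^sup>2"
      using C c qnorm_nonneg by (simp add: power_mult_distrib)
    then have "cmod (pairing f c) \<le> sqrt C * sqrt (qnorm c)"
      by (rule power2_le_imp_le) (use C c qnorm_nonneg in simp)
    moreover have "2 * (sqrt C * sqrt (qnorm c)) \<le> C + qnorm c"
      using C c qnorm_nonneg[OF c] zero_le_power2[of "sqrt C - sqrt (qnorm c)"]
      by (simp add: power2_diff)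
    ultimately show ?thesis
      using complex_Re_le_cmod[of "pairing f c"] by (simp add: J_def)
  qed
  then have bdd: "bdd_above (J ` {c. L c})" by (intro bdd_aboveI[of _ C]) auto
  have ne: "J ` {c. L c} \<noteq> {}" by (auto intro: exI[of _ "[]"])
  obtain c where c: "L c" "Sup (J ` {c. L c}) - \<epsilon> < J c"
    using less_cSup_iff[OF ne bdd, of "Sup (J ` {c. L c}) - \<epsilon>"] \<open>\<epsilon> > 0\<close> by auto
  have "(cmod (gram c d - pairing f d))\<^sup>2 \<le> \<epsilon> * qnorm d" if d: "L d" for d
  proof (rule discriminant_bound)
    fix t
    have "L (c @ scale_list t d)" using c d by (simp add: image_Un)
    then have "J (c @ scale_list t d) \<le> Sup (J ` {c. L c})"
      by (intro cSup_upper[OF _ bdd]) simp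
    then have "J (c @ scale_list t d) < J c + \<epsilon>" using c(2) by linarith
    then show "0 \<le> \<epsilon> + 2 * Re (t * (gram c d - pairing f d)) + (cmod t)\<^sup>2 * qnorm d"
      by (simp add: J_def qnorm_append_scale c d algebra_simps)
  qed (rule qnorm_nonneg[OF d])
  then show ?thesis using c by (metis norm_minus_commute)
qed

definition ap :: "('i \<Rightarrow> complex) \<Rightarrow> nat \<Rightarrow> ('i \<times> complex) list"
  where "ap f n = (SOME c. L c \<and> (\<forall>d. L d \<longrightarrow> (cmod (pairing f d - gram c d))\<^sup>2 \<le> 1 / real (Suc n) * qnorm d))"

lemma ap: "f \<in> H \<Longrightarrow> L (ap f n)"
  and ap_le: "f \<in> H \<Longrightarrow> L d \<Longrightarrow> (cmod (pairing f d - gram (ap f n) d))\<^sup>2 \<le> 1 / real (Suc n) * qnorm d"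
  using someI_ex[OF H_approx[of f "1 / real (Suc n)"]] unfolding ap_def[symmetric] by auto

lemma ap_le_sqrt:
  "f \<in> H \<Longrightarrow> L d \<Longrightarrow> cmod (pairing f d - gram (ap f n) d) \<le> sqrt (1 / real (Suc n)) * sqrt (qnorm d)"
  using real_sqrt_le_mono[OF ap_le[of f d n]] by (simp only: real_sqrt_mult real_sqrt_abs abs_norm_cancel)

text \<open>The limit along the almost maximisers \<open>ap\<close>; it exists by
  \<open>hip_limits\<close>. The value 0 outside \<open>H\<close> is what \<open>ip_outside\<close>
  asks for.\<close>

definition hip :: "('i \<Rightarrow> complex) \<Rightarrow> ('i \<Rightarrow> complex) \<Rightarrow> complex"
  where "hip f g = (if f \<in> H \<and> g \<in> H then lim (\<lambda>n. gram (ap f n) (ap g n)) else 0)"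

lemma null_sqrt: "(\<lambda>n. sqrt (1 / real (Suc n))) \<longlonglongrightarrow> 0"
  using tendsto_real_sqrt[OF LIMSEQ_Suc[OF lim_1_over_n]] by simp

lemma gram_ap_tendsto: "f \<in> H \<Longrightarrow> L c \<Longrightarrow> (\<lambda>n. gram (ap f n) c) \<longlonglongrightarrow> pairing f c"
proof (rule LIM_zero_cancel)
  assume "f \<in> H" "L c"
  show "(\<lambda>n. gram (ap f n) c - pairing f c) \<longlonglongrightarrow> 0"
    by (rule tendsto_0_le[OF null_sqrt, where K = "sqrt (qnorm c)"])
       (use ap_le_sqrt[OF \<open>f \<in> H\<close> \<open>L c\<close>] in \<open>auto simp: norm_minus_commute\<close>)
qed

lemma qnorm_ap_bounded:
  assumes f: "f \<in> H"
  obtains K where "K \<ge> 0" "\<And>n. sqrt (qnorm (ap f n)) \<le> K"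
proof -
  obtain C where C: "C \<ge> 0" "\<And>c. L c \<Longrightarrow> (cmod (pairing f c))\<^sup>2 \<le> C * qnorm c"
    using H_bounded[OF f] by blast
  have "sqrt (qnorm (ap f n)) \<le> sqrt C + 1" for n
  proof -
    let ?c = "ap f n"
    have q: "0 \<le> qnorm ?c" and Lc: "L ?c" using ap[OF f] qnorm_nonneg by auto
    have 1: "cmod (pairing f ?c) \<le> sqrt C * sqrt (qnorm ?c)"
      using real_sqrt_le_mono[OF C(2)[OF Lc]] by (simp add: real_sqrt_mult)
    have 2: "cmod (pairing f ?c - gram ?c ?c) \<le> 1 * sqrt (qnorm ?c)"
      by (rule order_trans[OF ap_le_sqrt[OF f Lc]], rule mult_right_mono) (use q in auto)
    have "qnorm ?c \<le> cmod (gram ?c ?c)" unfolding qnorm_def by (rule complex_Re_le_cmod)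
    also have "\<dots> \<le> cmod (pairing f ?c) + cmod (pairing f ?c - gram ?c ?c)"
      using norm_triangle_ineq4[of "pairing f ?c" "pairing f ?c - gram ?c ?c"] by simp
    also have "\<dots> \<le> (sqrt C + 1) * sqrt (qnorm ?c)" using 1 2 by (simp add: algebra_simps)
    finally have "qnorm ?c \<le> (sqrt C + 1)\<^sup>2" using q C by (intro sq_le_imp_le_sq) auto
    then show ?thesis using C by (intro real_le_lsqrt) auto
  qed
  then show ?thesis using that[of "sqrt C + 1"] C by simp
qed

text \<open>The approximation property of both lists is tested on their own difference. This bounds
  its square norm q by the sum of the two errors times \<open>sqrt q\<close>.\<close>

lemma qnorm_ap_diff:
  assumes f: "f \<in> H"
  shows "qnorm (ap f m @ scale_list (- 1) (ap f n)) \<le> (sqrt (1 / real (Suc m)) + sqrt (1 / real (Suc n)))\<^sup>2"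
proof -
  let ?d = "ap f m @ scale_list (- 1) (ap f n)"
  have Ld: "L ?d" using ap[OF f] by (simp add: image_Un)
  have "qnorm ?d \<le> cmod (gram ?d ?d)" unfolding qnorm_def by (rule complex_Re_le_cmod)
  also have "gram ?d ?d = (pairing f ?d - gram (ap f n) ?d) - (pairing f ?d - gram (ap f m) ?d)"
    by (simp add: algebra_simps)
  also have "cmod \<dots> \<le> cmod (pairing f ?d - gram (ap f n) ?d) + cmod (pairing f ?d - gram (ap f m) ?d)"
    by (rule norm_triangle_ineq4)
  also have "\<dots> \<le> (sqrt (1 / real (Suc m)) + sqrt (1 / real (Suc n))) * sqrt (qnorm ?d)"
    using ap_le_sqrt[OF f Ld, of m] ap_le_sqrt[OF f Ld, of n] by (simp add: distrib_right)
  finally show ?thesis using qnorm_nonneg[OF Ld] by (intro sq_le_imp_le_sq) auto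
qed

lemma pairing_ap_convergent:
  assumes f: "f \<in> H" and g: "g \<in> H"
  shows "convergent (\<lambda>n. pairing g (ap f n))"
proof -
  obtain C where C: "C \<ge> 0" "\<And>c. L c \<Longrightarrow> (cmod (pairing g c))\<^sup>2 \<le> C * qnorm c"
    using H_bounded[OF g] by blast
  show ?thesis
  proof (rule Cauchy_if_null_bound[of "\<lambda>n. sqrt C * sqrt (1 / real (Suc n))"])
    show "(\<lambda>n. sqrt C * sqrt (1 / real (Suc n))) \<longlonglongrightarrow> 0"
      using tendsto_mult_right_zero[OF null_sqrt, of "sqrt C"] by simp
    fix m n
    let ?d = "ap f m @ scale_list (- 1) (ap f n)"
    have Ld: "L ?d" using ap[OF f] by (simp add: image_Un)
    have "(cmod (pairing g ?d))\<^sup>2 \<le> C * qnorm ?d" by (rule C(2)[OF Ld])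
    also have "\<dots> \<le> C * (sqrt (1 / real (Suc m)) + sqrt (1 / real (Suc n)))\<^sup>2"
      using qnorm_ap_diff[OF f] C by (intro mult_left_mono)
    finally have "(cmod (pairing g ?d))\<^sup>2 \<le> (sqrt C * (sqrt (1 / real (Suc m)) + sqrt (1 / real (Suc n))))\<^sup>2"
      using C by (simp add: power_mult_distrib)
    then have "cmod (pairing g ?d) \<le> sqrt C * (sqrt (1 / real (Suc m)) + sqrt (1 / real (Suc n)))"
      by (rule power2_le_imp_le) (use C in simp)
    then show "cmod (pairing g (ap f m) - pairing g (ap f n))
        \<le> sqrt C * sqrt (1 / real (Suc m)) + sqrt C * sqrt (1 / real (Suc n))"
      by (simp add: distrib_left)
  qed
qed

text \<open>The first expression is linear in \<open>g\<close> and the second is conjugate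
  symmetric, so together they yield the axioms of an inner product.\<close>

lemma hip_limits:
  assumes f: "f \<in> H" and g: "g \<in> H"
  shows "(\<lambda>n. pairing g (ap f n)) \<longlonglongrightarrow> hip g f"
    and "(\<lambda>n. gram (ap g n) (ap f n)) \<longlonglongrightarrow> hip g f"
proof -
  obtain z where z: "(\<lambda>n. pairing g (ap f n)) \<longlonglongrightarrow> z"
    using pairing_ap_convergent[OF f g] by (auto simp: convergent_def)
  obtain K where K: "K \<ge> 0" "\<And>n. sqrt (qnorm (ap f n)) \<le> K" by (rule qnorm_ap_bounded[OF f]) blast
  have "(\<lambda>n. pairing g (ap f n) - gram (ap g n) (ap f n)) \<longlonglongrightarrow> 0"
  proof (rule tendsto_0_le[OF null_sqrt, where K = K], rule always_eventually, rule allI)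
    fix n
    have "cmod (pairing g (ap f n) - gram (ap g n) (ap f n)) \<le> sqrt (1 / real (Suc n)) * sqrt (qnorm (ap f n))"
      using f g by (intro ap_le_sqrt ap)
    also have "\<dots> \<le> sqrt (1 / real (Suc n)) * K" using K by (intro mult_left_mono) auto
    finally show "cmod (pairing g (ap f n) - gram (ap g n) (ap f n)) \<le> norm (sqrt (1 / real (Suc n))) * K"
      by simp
  qed
  from tendsto_diff[OF z this] have *: "(\<lambda>n. gram (ap g n) (ap f n)) \<longlonglongrightarrow> z" by simp
  then have "hip g f = z" using f g by (simp add: hip_def limI)
  with z * show "(\<lambda>n. pairing g (ap f n)) \<longlonglongrightarrow> hip g f" "(\<lambda>n. gram (ap g n) (ap f n)) \<longlonglongrightarrow> hip g f"
    by simp_all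
qed

lemma hip_cnj: "hip g f = cnj (hip f g)"
proof (cases "f \<in> H \<and> g \<in> H")
  case True
  have "(\<lambda>n. cnj (gram (ap f n) (ap g n))) \<longlonglongrightarrow> cnj (hip f g)"
    using True by (intro tendsto_intros hip_limits) auto
  moreover have "cnj (gram (ap f n) (ap g n)) = gram (ap g n) (ap f n)" for n
    using True gram_cnj[OF ap[of f n] ap[of g n]] by simp
  ultimately have "(\<lambda>n. gram (ap g n) (ap f n)) \<longlonglongrightarrow> cnj (hip f g)" by simp
  moreover have "(\<lambda>n. gram (ap g n) (ap f n)) \<longlonglongrightarrow> hip g f"
    using True by (intro hip_limits) auto
  ultimately show ?thesis using LIMSEQ_unique by blast
qed (auto simp: hip_def)

lemma hip_add: "\<lbrakk>f \<in> H; g \<in> H; h \<in> H\<rbrakk> \<Longrightarrow> hip (f + g) h = hip f h + hip g h"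
proof -
  assume H: "f \<in> H" "g \<in> H" "h \<in> H"
  then have "f + g \<in> H" using subspace_H cfun.subspace_add by blast
  then have "(\<lambda>n. pairing (f + g) (ap h n)) \<longlonglongrightarrow> hip (f + g) h" using H by (intro hip_limits)
  moreover have "(\<lambda>n. pairing f (ap h n) + pairing g (ap h n)) \<longlonglongrightarrow> hip f h + hip g h"
    using H by (intro tendsto_intros hip_limits)
  ultimately show ?thesis using LIMSEQ_unique by auto
qed

lemma hip_scale: "\<lbrakk>f \<in> H; h \<in> H\<rbrakk> \<Longrightarrow> hip (cscale t f) h = t * hip f h"
proof -
  assume H: "f \<in> H" "h \<in> H"
  then have "cscale t f \<in> H" using subspace_H cfun.subspace_scale by blast
  then have "(\<lambda>n. pairing (cscale t f) (ap h n)) \<longlonglongrightarrow> hip (cscale t f) h" using H by (intro hip_limits)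
  moreover have "(\<lambda>n. t * pairing f (ap h n)) \<longlonglongrightarrow> t * hip f h"
    using H by (intro tendsto_intros hip_limits)
  ultimately show ?thesis using LIMSEQ_unique by auto
qed

lemma hip_comb: "f \<in> H \<Longrightarrow> L c \<Longrightarrow> hip f (comb c) = pairing f c"
proof -
  assume f: "f \<in> H" and c: "L c"
  have "(\<lambda>n. gram c (ap f n)) \<longlonglongrightarrow> hip (comb c) f"
    using hip_limits(1)[OF f comb_in_H[OF c]] by (simp add: gram_def)
  moreover have "(\<lambda>n. cnj (gram (ap f n) c)) \<longlonglongrightarrow> cnj (pairing f c)"
    using f c by (intro tendsto_intros gram_ap_tendsto)
  moreover have "gram c (ap f n) = cnj (gram (ap f n) c)" for n
    using gram_cnj[OF ap[OF f] c] by simp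
  ultimately have "hip (comb c) f = cnj (pairing f c)" using LIMSEQ_unique by fastforce
  then show ?thesis using hip_cnj[of f "comb c"] by simp
qed

lemma qnorm_ap_tendsto: "f \<in> H \<Longrightarrow> (\<lambda>n. qnorm (ap f n)) \<longlonglongrightarrow> Re (hip f f)"
  unfolding qnorm_def by (intro tendsto_intros hip_limits)

lemma hip_self_nonneg: "0 \<le> Re (hip f f)"
proof (cases "f \<in> H")
  case True
  then show ?thesis
    using qnorm_nonneg[OF ap[OF True]] by (intro LIMSEQ_le_const[OF qnorm_ap_tendsto]) auto
qed (simp add: hip_def)

lemma pairing_le: "f \<in> H \<Longrightarrow> L c \<Longrightarrow> (cmod (pairing f c))\<^sup>2 \<le> Re (hip f f) * qnorm c"
proof (rule LIMSEQ_le)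
  assume f: "f \<in> H" and c: "L c"
  show "(\<lambda>n. (cmod (gram (ap f n) c))\<^sup>2) \<longlonglongrightarrow> (cmod (pairing f c))\<^sup>2"
    using f c by (intro tendsto_intros gram_ap_tendsto)
  show "(\<lambda>n. qnorm (ap f n) * qnorm c) \<longlonglongrightarrow> Re (hip f f) * qnorm c"
    using f by (intro tendsto_intros qnorm_ap_tendsto)
  show "\<exists>N. \<forall>n\<ge>N. (cmod (gram (ap f n) c))\<^sup>2 \<le> qnorm (ap f n) * qnorm c"
    using gram_cauchy_schwarz[OF ap[OF f] c] by blast
qed

text \<open>Testing the bound on the approximants of \<open>f\<close> gives
  \<open>x * x \<le> C * x\<close> for \<open>x = Re (hip f f)\<close>. With
  \<open>pairing_le\<close> this identifies the square norm as the least nonnegative admissible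
  constant, so norms can be estimated by pairing with finite combinations
  (\<open>nrm_le\<close>).\<close>

lemma hip_self_le:
  assumes f: "f \<in> H" and "C \<ge> 0" and le: "\<And>c. L c \<Longrightarrow> (cmod (pairing f c))\<^sup>2 \<le> C * qnorm c"
  shows "Re (hip f f) \<le> C"
proof -
  have "(cmod (hip f f))\<^sup>2 \<le> C * Re (hip f f)"
  proof (rule LIMSEQ_le)
    show "(\<lambda>n. (cmod (pairing f (ap f n)))\<^sup>2) \<longlonglongrightarrow> (cmod (hip f f))\<^sup>2"
      using f by (intro tendsto_intros hip_limits)
    show "(\<lambda>n. C * qnorm (ap f n)) \<longlonglongrightarrow> C * Re (hip f f)"
      using f by (intro tendsto_intros qnorm_ap_tendsto)
  qed (use le ap[OF f] in blast)
  moreover have "(Re (hip f f))\<^sup>2 \<le> (cmod (hip f f))\<^sup>2"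
    by (simp add: cmod_power2)
  ultimately have "Re (hip f f) * Re (hip f f) \<le> C * Re (hip f f)"
    by (simp add: power2_eq_square)
  then show ?thesis
    using hip_self_nonneg[of f] \<open>C \<ge> 0\<close> by (cases "Re (hip f f) = 0") auto
qed

sublocale inner_space H hip
proof
  show "0 < Re (hip f f)" if "f \<in> H" "f \<noteq> 0" for f
  proof (rule ccontr)
    assume "\<not> 0 < Re (hip f f)"
    then have "Re (hip f f) = 0" using hip_self_nonneg[of f] by simp
    then have "f x = 0" for x
      using H_outside[OF that(1), of x] pairing_le[OF that(1), of "[(x, 1)]"] by (cases "x \<in> X") auto
    then show False using that by auto
  qed
  show "hip g f = cnj (hip f g)" for f g by (rule hip_cnj)
qed (use subspace_H in \<open>auto simp: hip_add hip_scale, auto simp: hip_def\<close>)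

end

lemma norm_add_diff_le: "norm (a + b - c) \<le> norm a + norm b + norm c"
  for a b c :: "'b :: real_normed_vector"
  by (rule order_trans[OF norm_triangle_ineq4 add_right_mono[OF norm_triangle_ineq]])

section \<open>Bounded sesquilinear forms\<close>

context inner_space
begin

text \<open>Operators are handled through their sesquilinear forms, since weak limits of averages
  produce forms directly. \<open>C\<close> is any bound, not the operator norm.\<close>

definition bounded_form :: "(('i \<Rightarrow> complex) \<Rightarrow> ('i \<Rightarrow> complex) \<Rightarrow> complex) \<Rightarrow> real \<Rightarrow> bool"
  where "bounded_form F C \<longleftrightarrow>
    (\<forall>u\<in>V. \<forall>v\<in>V. \<forall>w\<in>V. F (u + v) w = F u w + F v w \<and> F w (u + v) = F w u + F w v) \<and>
    (\<forall>t. \<forall>u\<in>V. \<forall>v\<in>V. F (cscale t u) v = t * F u v \<and> F u (cscale t v) = cnj t * F u v) \<and>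
    (\<forall>u\<in>V. \<forall>v\<in>V. cmod (F u v) \<le> C * nrm u * nrm v)"

lemma bounded_form_add: "\<lbrakk>bounded_form F C; u \<in> V; v \<in> V; w \<in> V\<rbrakk> \<Longrightarrow> F (u + v) w = F u w + F v w"
    "\<lbrakk>bounded_form F C; u \<in> V; v \<in> V; w \<in> V\<rbrakk> \<Longrightarrow> F w (u + v) = F w u + F w v"
  and bounded_form_scale: "\<lbrakk>bounded_form F C; u \<in> V; v \<in> V\<rbrakk> \<Longrightarrow> F (cscale t u) v = t * F u v"
    "\<lbrakk>bounded_form F C; u \<in> V; v \<in> V\<rbrakk> \<Longrightarrow> F u (cscale t v) = cnj t * F u v"
  and bounded_form_le: "\<lbrakk>bounded_form F C; u \<in> V; v \<in> V\<rbrakk> \<Longrightarrow> cmod (F u v) \<le> C * nrm u * nrm v"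
  by (simp_all add: bounded_form_def)

lemma bounded_form_diff:
  assumes "bounded_form F C" "u \<in> V" "v \<in> V" "w \<in> V"
  shows "F (u - v) w = F u w - F v w" "F w (u - v) = F w u - F w v"
  using bounded_form_add[OF assms(1), of "u - v" v w] assms by simp_all

lemma bounded_form_zero:
  assumes "bounded_form F C" "w \<in> V"
  shows "F 0 w = 0" "F w 0 = 0"
  using bounded_form_diff[OF assms(1), of 0 0 w] assms(2) by simp_all

lemma bounded_form_mono: "bounded_form F C \<Longrightarrow> C \<le> D \<Longrightarrow> bounded_form F D"
  unfolding bounded_form_def by (meson mult_right_mono nrm_nonneg order_trans)

lemma bounded_form_add_scaled:
  assumes F: "bounded_form F C" and F': "bounded_form F' D"
  shows "bounded_form (\<lambda>u v. z * F u v + F' u v) (cmod z * C + D)"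
  unfolding bounded_form_def
proof (intro conjI ballI allI)
  fix u v assume uv: "u \<in> V" "v \<in> V"
  have "cmod (z * F u v + F' u v) \<le> cmod z * cmod (F u v) + cmod (F' u v)"
    using norm_triangle_ineq[of "z * F u v" "F' u v"] by (simp add: norm_mult)
  also have "\<dots> \<le> cmod z * (C * nrm u * nrm v) + D * nrm u * nrm v"
    by (intro add_mono mult_left_mono bounded_form_le[OF F uv] bounded_form_le[OF F' uv]) simp
  also have "\<dots> = (cmod z * C + D) * nrm u * nrm v" by (simp add: algebra_simps)
  finally show "cmod (z * F u v + F' u v) \<le> (cmod z * C + D) * nrm u * nrm v" .
qed (use assms in \<open>simp_all add: bounded_form_add[OF F] bounded_form_add[OF F']
    bounded_form_scale[OF F] bounded_form_scale[OF F'] algebra_simps\<close>)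

lemma bounded_form_minus:
  assumes "bounded_form F C" "bounded_form F' D"
  shows "bounded_form (\<lambda>u v. F u v - F' u v) (C + D)"
  using bounded_form_add_scaled[OF assms(2,1), of "- 1"] by (simp add: add.commute)

lemma bounded_form_tendsto:
  assumes F: "bounded_form F C" and "C \<ge> 0"
    and x: "\<And>n. x n \<in> V" "u \<in> V" "(\<lambda>n. nrm (x n - u)) \<longlonglongrightarrow> 0"
    and y: "\<And>n. y n \<in> V" "v \<in> V" "(\<lambda>n. nrm (y n - v)) \<longlonglongrightarrow> 0"
  shows "(\<lambda>n. F (x n) (y n)) \<longlonglongrightarrow> F u v"
proof (rule LIM_zero_cancel, rule Lim_null_comparison)
  have "(\<lambda>n. C * nrm (x n - u) * nrm (y n) + C * nrm u * nrm (y n - v))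
      \<longlonglongrightarrow> C * 0 * nrm v + C * nrm u * 0"
    by (intro tendsto_intros x y nrm_tendsto[OF y])
  then show "(\<lambda>n. C * nrm (x n - u) * nrm (y n) + C * nrm u * nrm (y n - v)) \<longlonglongrightarrow> 0" by simp
  have "norm (F (x n) (y n) - F u v) \<le> C * nrm (x n - u) * nrm (y n) + C * nrm u * nrm (y n - v)" for n
  proof -
    have eq: "F (x n) (y n) - F u v = F (x n - u) (y n) + F u (y n - v)"
      using x y by (simp add: bounded_form_diff[OF F])
    show ?thesis
      unfolding eq using x y by (intro norm_triangle_mono bounded_form_le[OF F]) auto
  qed
  then show "\<forall>\<^sub>F n in sequentially. norm (F (x n) (y n) - F u v)
      \<le> C * nrm (x n - u) * nrm (y n) + C * nrm u * nrm (y n - v)" by simp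
qed

end

section \<open>Kernel vectors, weak compactness and completeness\<close>

context pd_kernel
begin

definition kvec :: "'i \<Rightarrow> 'i \<Rightarrow> complex" where "kvec x = comb [(x, 1)]"

lemma kvec_in_H [simp]: "x \<in> X \<Longrightarrow> kvec x \<in> H"
  by (simp add: kvec_def)

lemma kvec_apply: "x \<in> X \<Longrightarrow> y \<in> X \<Longrightarrow> kvec x y = k x y"
  using k_cnj[of x y] by (simp add: kvec_def comb_def)

lemma reproducing: "f \<in> H \<Longrightarrow> x \<in> X \<Longrightarrow> hip f (kvec x) = f x"
  by (simp add: kvec_def hip_comb)

lemma hip_kvec: "x \<in> X \<Longrightarrow> y \<in> X \<Longrightarrow> hip (kvec x) (kvec y) = k x y"
  by (simp add: reproducing kvec_apply)

lemma comb_Nil [simp]: "comb [] = 0"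
  by (simp add: comb_def fun_eq_iff)

lemma comb_Cons: "comb (p # c) = cscale (cnj (snd p)) (kvec (fst p)) + comb c"
  by (auto simp: comb_def kvec_def cscale_def)

lemma gram_eq: "L c \<Longrightarrow> L d \<Longrightarrow> hip (comb c) (comb d) = gram c d"
  by (simp add: hip_comb gram_def)

lemma nrm_comb_sq: "L c \<Longrightarrow> (nrm (comb c))\<^sup>2 = qnorm c"
  by (simp add: nrm_sq gram_eq qnorm_def)

lemma norm_pairing_le: "f \<in> H \<Longrightarrow> L c \<Longrightarrow> cmod (pairing f c) \<le> nrm f * nrm (comb c)"
  using cauchy_schwarz[of f "comb c"] by (simp add: hip_comb)

lemma nrm_le:
  assumes "f \<in> H" "C \<ge> 0" "\<And>c. L c \<Longrightarrow> cmod (pairing f c) \<le> C * nrm (comb c)"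
  shows "nrm f \<le> C"
proof -
  have "(nrm f)\<^sup>2 \<le> C\<^sup>2"
    unfolding nrm_sq[OF assms(1)]
  proof (rule hip_self_le[OF assms(1)])
    fix c assume c: "L c"
    have "(cmod (pairing f c))\<^sup>2 \<le> (C * nrm (comb c))\<^sup>2" using assms c by (intro power_mono) auto
    then show "(cmod (pairing f c))\<^sup>2 \<le> C\<^sup>2 * qnorm c"
      using c by (simp add: power_mult_distrib nrm_comb_sq)
  qed simp
  then show ?thesis by (rule power2_le_imp_le) fact
qed

lemma approx_in_H: "f \<in> H \<Longrightarrow> comb (ap f n) \<in> H"
  using ap by simp

lemma approx_tendsto: "f \<in> H \<Longrightarrow> (\<lambda>n. nrm (comb (ap f n) - f)) \<longlonglongrightarrow> 0"
proof (rule tendsto_0_le[OF null_sqrt, where K = 1], rule always_eventually, rule allI)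
  fix n assume f: "f \<in> H"
  have fn: "f - comb (ap f n) \<in> H" using f approx_in_H by simp
  have "nrm (f - comb (ap f n)) \<le> sqrt (1 / real (Suc n))"
  proof (rule nrm_le[OF fn])
    fix c assume c: "L c"
    show "cmod (pairing (f - comb (ap f n)) c) \<le> sqrt (1 / real (Suc n)) * nrm (comb c)"
      using ap_le_sqrt[OF f c, of n] c nrm_comb_sq[OF c, symmetric] by (simp add: gram_def)
  qed simp
  then show "norm (nrm (comb (ap f n) - f)) \<le> norm (sqrt (1 / real (Suc n))) * 1"
    using f approx_in_H[OF f, of n] nrm_minus_commute[of f "comb (ap f n)"] fn by simp
qed

lemma approx_exists:
  assumes "f \<in> H" "e > 0"
  obtains c where "L c" "nrm (f - comb c) < e"
proof -
  obtain n where "\<forall>m\<ge>n. norm (nrm (comb (ap f m) - f) - 0) < e"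
    using LIMSEQ_D[OF approx_tendsto[OF assms(1)] assms(2)] by blast
  then have "nrm (comb (ap f n) - f) < e" by (simp add: abs_less_iff)
  then show ?thesis
    using that[of "ap f n"] ap[OF assms(1)] approx_in_H[OF assms(1), of n] assms(1)
    by (simp add: nrm_minus_commute)
qed

lemma convergent_by_density:
  fixes a :: "nat \<Rightarrow> ('i \<Rightarrow> complex) \<Rightarrow> complex"
  assumes lip: "\<And>n v w. \<lbrakk>v \<in> H; w \<in> H\<rbrakk> \<Longrightarrow> cmod (a n w - a n v) \<le> C * nrm (w - v)"
    and conv: "\<And>c. L c \<Longrightarrow> convergent (\<lambda>n. a n (comb c))" and w: "w \<in> H"
  shows "convergent (\<lambda>n. a n w)"
proof (subst Cauchy_convergent_iff[symmetric], rule CauchyI)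
  fix r :: real assume r: "r > 0"
  define D where "D = \<bar>C\<bar> + 1"
  obtain c where c: "L c" "nrm (w - comb c) < r / (4 * D)"
    using approx_exists[OF w, of "r / (4 * D)"] r by (auto simp: D_def)
  have d: "cmod (a n w - a n (comb c)) < r / 3" for n
  proof -
    have "cmod (a n w - a n (comb c)) \<le> C * nrm (w - comb c)" using c w by (intro lip) auto
    also have "\<dots> \<le> D * nrm (w - comb c)" using c w by (intro mult_right_mono) (auto simp: D_def)
    also have "\<dots> \<le> D * (r / (4 * D))" using c by (intro mult_left_mono) (auto simp: D_def)
    also have "D \<noteq> 0" by (simp add: D_def add_nonneg_eq_0_iff)
    then have "D * (r / (4 * D)) = r / 4" by simp
    also have "\<dots> < r / 3" using r by simp
    finally show ?thesis .
  qed
  obtain N where N: "\<forall>m\<ge>N. \<forall>n\<ge>N. cmod (a m (comb c) - a n (comb c)) < r / 3"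
    using CauchyD[of "\<lambda>n. a n (comb c)" "r / 3"] conv[OF c(1)] r
    by (auto simp: Cauchy_convergent_iff)
  have "cmod (a m w - a n w) < r" if "m \<ge> N" "n \<ge> N" for m n
  proof -
    have eq: "a m w - a n w = (a m w - a m (comb c)) + (a m (comb c) - a n (comb c)) - (a n w - a n (comb c))"
      by simp
    have "cmod (a m w - a n w) \<le> cmod (a m w - a m (comb c)) + cmod (a m (comb c) - a n (comb c))
        + cmod (a n w - a n (comb c))" unfolding eq by (rule norm_add_diff_le)
    also have "\<dots> < r" using d[of m] d[of n] N that by force
    finally show ?thesis .
  qed
  then show "\<exists>N. \<forall>m\<ge>N. \<forall>n\<ge>N. norm (a m w - a n w) < r" by blast
qed

text \<open>Point evaluations are inner products with kernel vectors, whose combinations are dense.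
  A uniform norm bound therefore upgrades pointwise to weak convergence, and it survives in the
  limit as a bound on pairings.\<close>

lemma weak_limit:
  assumes f: "\<And>n. f n \<in> H" "\<And>n. nrm (f n) \<le> C"
    and lim: "\<And>x. x \<in> X \<Longrightarrow> (\<lambda>n. f n x) \<longlonglongrightarrow> g x" and out: "\<And>x. x \<notin> X \<Longrightarrow> g x = 0"
  shows "g \<in> H" "nrm g \<le> C" "\<And>w. w \<in> H \<Longrightarrow> (\<lambda>n. hip (f n) w) \<longlonglongrightarrow> hip g w"
proof -
  have C: "C \<ge> 0" using f[of 0] nrm_nonneg[of "f 0"] by linarith
  have lp: "(\<lambda>n. pairing (f n) c) \<longlonglongrightarrow> pairing g c" if "L c" for c
    by (rule pairing_tendsto) (use lim that in blast)
  have le: "cmod (pairing g c) \<le> C * nrm (comb c)" if c: "L c" for c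
  proof (rule LIMSEQ_le_const2)
    show "(\<lambda>n. cmod (pairing (f n) c)) \<longlonglongrightarrow> cmod (pairing g c)"
      using lp[OF c] by (rule tendsto_norm)
    have "cmod (pairing (f n) c) \<le> C * nrm (comb c)" for n
      by (rule order_trans[OF norm_pairing_le[OF f(1) c]]) (use f c in \<open>auto intro: mult_right_mono\<close>)
    then show "\<exists>N. \<forall>n\<ge>N. cmod (pairing (f n) c) \<le> C * nrm (comb c)" by blast
  qed
  show g: "g \<in> H"
  proof (rule HI[where C = "C\<^sup>2"])
    fix c assume c: "L c"
    have "(cmod (pairing g c))\<^sup>2 \<le> (C * nrm (comb c))\<^sup>2" using le[OF c] by (intro power_mono) auto
    then show "(cmod (pairing g c))\<^sup>2 \<le> C\<^sup>2 * qnorm c" by (simp add: power_mult_distrib nrm_comb_sq[OF c])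
  qed (rule out)
  show nrm_g: "nrm g \<le> C" using g C le by (rule nrm_le)
  show "(\<lambda>n. hip (f n) w) \<longlonglongrightarrow> hip g w" if w: "w \<in> H" for w
  proof (rule LIMSEQ_I)
    fix r :: real assume r: "r > 0"
    define D where "D = 2 * C + 1"
    have D: "D > 0" using C by (simp add: D_def)
    obtain c where c: "L c" "nrm (w - comb c) < r / (2 * D)"
      using approx_exists[OF w, of "r / (2 * D)"] r D by auto
    obtain N where N: "\<And>n. n \<ge> N \<Longrightarrow> cmod (pairing (f n) c - pairing g c) < r / 2"
      using LIMSEQ_D[OF lp[OF c(1)], of "r / 2"] r by auto
    have "cmod (hip (f n) w - hip g w) < r" if n: "n \<ge> N" for n
    proof -
      have eq: "hip (f n) w - hip g w = hip (f n - g) (w - comb c) + (pairing (f n) c - pairing g c)"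
        using f(1) g w c(1) by (simp add: ip_diff_left ip_diff_right hip_comb)
      have "cmod (hip (f n - g) (w - comb c)) \<le> nrm (f n - g) * nrm (w - comb c)"
        using f(1) g w c(1) by (intro cauchy_schwarz) auto
      also have "nrm (f n - g) \<le> D"
        using nrm_diff_le[OF f(1) g, of n] f(2)[of n] nrm_g by (simp add: D_def)
      then have "nrm (f n - g) * nrm (w - comb c) \<le> D * (r / (2 * D))"
        using c w D by (intro mult_mono less_imp_le[OF c(2)]) auto
      also have "\<dots> = r / 2" using D by simp
      finally show ?thesis
        using norm_triangle_ineq[of "hip (f n - g) (w - comb c)" "pairing (f n) c - pairing g c"] N[OF n]
        unfolding eq by linarith
    qed
    then show "\<exists>N. \<forall>n\<ge>N. norm (hip (f n) w - hip g w) < r" by blast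
  qed
qed

sublocale hspace H hip
proof
  fix x :: "nat \<Rightarrow> 'i \<Rightarrow> complex"
  assume x: "\<And>n. x n \<in> H" and cauchy: "\<And>e. e > 0 \<Longrightarrow> \<exists>N. \<forall>m\<ge>N. \<forall>n\<ge>N. nrm (x m - x n) < e"
  have "convergent (\<lambda>n. x n i)" for i
  proof (cases "i \<in> X")
    case True
    show ?thesis
    proof (subst Cauchy_convergent_iff[symmetric], rule CauchyI)
      fix r :: real assume r: "r > 0"
      define q where "q = nrm (kvec i) + 1"
      have q: "q > 0" using True by (simp add: q_def add_nonneg_pos)
      obtain N where N: "\<forall>m\<ge>N. \<forall>n\<ge>N. nrm (x m - x n) < r / q" using cauchy[of "r / q"] r q by auto
      have "norm (x m i - x n i) < r" if "m \<ge> N" "n \<ge> N" for m n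
      proof -
        have "cmod (hip (x m - x n) (kvec i)) \<le> nrm (x m - x n) * nrm (kvec i)"
          using x True by (intro cauchy_schwarz) auto
        also have "\<dots> \<le> nrm (x m - x n) * q" using x by (intro mult_left_mono) (auto simp: q_def)
        also have "\<dots> < r / q * q" using N that q by (intro mult_strict_right_mono) auto
        finally show ?thesis using q x True by (simp add: reproducing)
      qed
      then show "\<exists>N. \<forall>m\<ge>N. \<forall>n\<ge>N. norm (x m i - x n i) < r" by blast
    qed
  qed (simp add: H_outside[OF x] convergent_const)
  then obtain f where f: "\<And>i. (\<lambda>n. x n i) \<longlonglongrightarrow> f i" unfolding convergent_def by metis
  have out: "f i = 0" if "i \<notin> X" for i
    using f[of i] H_outside[OF x that] by (simp add: LIMSEQ_const_iff)
  \<comment> \<open>The differences \<open>x m - x (n + N)\<close> have norm at most e and converge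
    pointwise to \<open>x m - f\<close>; balls are closed under such limits by
    \<open>weak_limit\<close>. This turns the pointwise limit into a norm limit.\<close>
  have close: "x m - f \<in> H \<and> nrm (x m - f) \<le> e"
    if N: "\<forall>m\<ge>N. \<forall>n\<ge>N. nrm (x m - x n) < e" and m: "m \<ge> N" for e N m
  proof -
    have "(\<lambda>n. (x m - x (n + N)) i) \<longlonglongrightarrow> (x m - f) i" for i
      using LIMSEQ_ignore_initial_segment[OF f[of i], of N] by (auto intro!: tendsto_intros)
    moreover have "nrm (x m - x (n + N)) \<le> e" for n using N m by (simp add: less_imp_le)
    ultimately show ?thesis
      using weak_limit(1,2)[of "\<lambda>n. x m - x (n + N)" e "x m - f"] x H_outside[OF x] out by simp
  qed
  obtain N1 where "\<forall>m\<ge>N1. \<forall>n\<ge>N1. nrm (x m - x n) < 1" using cauchy[of 1] by auto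
  then have "x N1 - f \<in> H" using close by blast
  then have fH: "f \<in> H" using V_diff[OF x[of N1], of "x N1 - f"] by simp
  have "(\<lambda>n. nrm (x n - f)) \<longlonglongrightarrow> 0"
  proof (rule LIMSEQ_I)
    fix r :: real assume "r > 0"
    then obtain N where N: "\<forall>m\<ge>N. \<forall>n\<ge>N. nrm (x m - x n) < r / 2" using cauchy[of "r / 2"] by auto
    have "norm (nrm (x m - f) - 0) < r" if "m \<ge> N" for m
      using close[OF N that] \<open>r > 0\<close> nrm_nonneg[of "x m - f"] by auto
    then show "\<exists>N. \<forall>n\<ge>N. norm (nrm (x n - f) - 0) < r" by blast
  qed
  with fH show "\<exists>l\<in>H. (\<lambda>n. nrm (x n - l)) \<longlonglongrightarrow> 0" by blast
qed

lemma weak_subsequence: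
  fixes f :: "nat \<Rightarrow> 'i \<Rightarrow> complex"
  assumes X: "countable X" and f: "\<And>n. f n \<in> H" "\<And>n. nrm (f n) \<le> C"
  obtains r g where "strict_mono r" "g \<in> H" "nrm g \<le> C"
    "\<And>w. w \<in> H \<Longrightarrow> (\<lambda>n. hip (f (r n)) w) \<longlonglongrightarrow> hip g w"
proof -
  have C: "C \<ge> 0" using f[of 0] nrm_nonneg[of "f 0"] by linarith
  \<comment> \<open>The diagonal argument over the countably many evaluations asks for one bound at
    all points, so evaluations are divided by the norm of the kernel vector; adding 1 avoids
    division by 0.\<close>
  define q where "q x = nrm (kvec x) + 1" for x
  have q: "q x > 0" if "x \<in> X" for x using that by (simp add: q_def add_nonneg_pos)
  have "norm (f n x / of_real (q x)) \<le> C" if "x \<in> X" for n x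
  proof -
    have "cmod (f n x) \<le> nrm (f n) * nrm (kvec x)"
      using cauchy_schwarz[of "f n" "kvec x"] f that by (simp add: reproducing)
    also have "\<dots> \<le> C * q x" using f C that by (intro mult_mono) (auto simp: q_def)
    finally show ?thesis using q[OF that] by (simp add: norm_divide field_simps)
  qed
  with X obtain r where r: "strict_mono (r :: nat \<Rightarrow> nat)"
    and "\<And>x. x \<in> X \<Longrightarrow> \<exists>l. (\<lambda>n. f (r n) x / of_real (q x)) \<longlonglongrightarrow> l"
    using function_convergent_subsequence[of X "\<lambda>n x. f n x / of_real (q x)" C] by blast
  then obtain l where l: "\<And>x. x \<in> X \<Longrightarrow> (\<lambda>n. f (r n) x / of_real (q x)) \<longlonglongrightarrow> l x" by metis
  define g where "g x = (if x \<in> X then l x * of_real (q x) else 0)" for x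
  have lim: "(\<lambda>n. f (r n) x) \<longlonglongrightarrow> g x" if "x \<in> X" for x
    using tendsto_mult_right[OF l[OF that], of "of_real (q x)"] q[OF that] that by (simp add: g_def)
  show ?thesis
    by (rule that[OF r weak_limit[where f = "\<lambda>n. f (r n)" and g = g and C = C]])
       (use f lim in \<open>auto simp: g_def\<close>)
qed

lemma bounded_form_comb:
  assumes F: "bounded_form F C" and "L c" "L d"
  shows "F (comb c) (comb d) = cnj (pairing (\<lambda>x. cnj (pairing (\<lambda>y. F (kvec x) (kvec y)) d)) c)"
proof -
  have 1: "F u (comb d) = pairing (\<lambda>y. F u (kvec y)) d" if "u \<in> H" for u
    using \<open>L d\<close>
    by (induction d) (use that in \<open>auto simp: comb_Cons bounded_form_zero[OF F]
        bounded_form_add[OF F] bounded_form_scale[OF F]\<close>)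
  have "F (comb c) (comb d) = cnj (pairing (\<lambda>x. cnj (F (kvec x) (comb d))) c)"
    using \<open>L c\<close>
    by (induction c) (use \<open>L d\<close> in \<open>auto simp: comb_Cons bounded_form_zero[OF F]
        bounded_form_add[OF F] bounded_form_scale[OF F]\<close>)
  also have "pairing (\<lambda>x. cnj (F (kvec x) (comb d))) c
      = pairing (\<lambda>x. cnj (pairing (\<lambda>y. F (kvec x) (kvec y)) d)) c"
    by (rule pairing_cong) (use \<open>L c\<close> in \<open>auto intro!: arg_cong[of _ _ cnj] 1 kvec_in_H\<close>)
  finally show ?thesis .
qed

lemma bounded_form_bound_by_density:
  assumes F: "bounded_form F C" and "\<epsilon> \<ge> 0"
    and le: "\<And>c d. \<lbrakk>L c; L d\<rbrakk> \<Longrightarrow> cmod (F (comb c) (comb d)) \<le> \<epsilon> * nrm (comb c) * nrm (comb d)"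
    and uv: "u \<in> H" "v \<in> H"
  shows "cmod (F u v) \<le> \<epsilon> * nrm u * nrm v"
proof (rule LIMSEQ_le)
  have "bounded_form F \<bar>C\<bar>" using F by (rule bounded_form_mono) simp
  then show "(\<lambda>n. cmod (F (comb (ap u n)) (comb (ap v n)))) \<longlonglongrightarrow> cmod (F u v)"
    using uv by (intro tendsto_norm bounded_form_tendsto approx_tendsto approx_in_H) auto
  show "(\<lambda>n. \<epsilon> * nrm (comb (ap u n)) * nrm (comb (ap v n))) \<longlonglongrightarrow> \<epsilon> * nrm u * nrm v"
    using uv by (intro tendsto_intros nrm_tendsto approx_tendsto approx_in_H)
qed (use le ap uv in blast)

lemma bounded_form_eq_by_density:
  assumes F: "bounded_form F C" and F': "bounded_form F' D"
    and eq: "\<And>x y. \<lbrakk>x \<in> X; y \<in> X\<rbrakk> \<Longrightarrow> F (kvec x) (kvec y) = F' (kvec x) (kvec y)"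
    and uv: "u \<in> H" "v \<in> H"
  shows "F u v = F' u v"
proof -
  have D: "bounded_form (\<lambda>u v. F u v - F' u v) (C + D)" using F F' by (rule bounded_form_minus)
  have "F (comb c) (comb d) - F' (comb c) (comb d) = 0" if cd: "L c" "L d" for c d
  proof -
    have "pairing (\<lambda>x. cnj (pairing (\<lambda>y. F (kvec x) (kvec y) - F' (kvec x) (kvec y)) d)) c = pairing 0 c"
    proof (rule pairing_cong)
      fix x assume x: "x \<in> fst ` set c"
      have "pairing (\<lambda>y. F (kvec x) (kvec y) - F' (kvec x) (kvec y)) d = pairing 0 d"
      proof (rule pairing_cong)
        fix y assume "y \<in> fst ` set d"
        then have "F (kvec x) (kvec y) = F' (kvec x) (kvec y)" using x cd by (intro eq) blast+
        then show "F (kvec x) (kvec y) - F' (kvec x) (kvec y) = 0 y" by simp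
      qed
      then show "cnj (pairing (\<lambda>y. F (kvec x) (kvec y) - F' (kvec x) (kvec y)) d) = 0 x" by simp
    qed
    then show ?thesis by (simp add: bounded_form_comb[OF D cd])
  qed
  then have "cmod (F u v - F' u v) \<le> 0 * nrm u * nrm v"
    by (intro bounded_form_bound_by_density[OF D _ _ uv]) auto
  then show ?thesis by simp
qed

text \<open>The common bound \<open>C\<close> makes the forms equicontinuous, so convergence on
  kernel vectors extends by density, first in the second argument and then in the first.\<close>

lemma bounded_form_limit:
  assumes b: "\<And>n. bounded_form (b n) C" and C: "C \<ge> 0"
    and conv: "\<And>x y. \<lbrakk>x \<in> X; y \<in> X\<rbrakk> \<Longrightarrow> convergent (\<lambda>n. b n (kvec x) (kvec y))"
  obtains F where "bounded_form F C" "\<And>u v. \<lbrakk>u \<in> H; v \<in> H\<rbrakk> \<Longrightarrow> (\<lambda>n. b n u v) \<longlonglongrightarrow> F u v"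
proof -
  obtain l where l: "\<And>x y. \<lbrakk>x \<in> X; y \<in> X\<rbrakk> \<Longrightarrow> (\<lambda>n. b n (kvec x) (kvec y)) \<longlonglongrightarrow> l x y"
    using conv unfolding convergent_def by metis
  have 2: "convergent (\<lambda>n. b n (comb c) (comb d))" if "L c" "L d" for c d
  proof -
    have "(\<lambda>n. b n (comb c) (comb d)) \<longlonglongrightarrow> cnj (pairing (\<lambda>x. cnj (pairing (l x) d)) c)"
      unfolding bounded_form_comb[OF b that]
      by (intro tendsto_cnj pairing_tendsto l) (use that in blast)+
    then show ?thesis by (rule convergentI)
  qed
  have 3: "convergent (\<lambda>n. b n (comb c) v)" if c: "L c" and v: "v \<in> H" for c v
  proof (rule convergent_by_density[where C = "C * nrm (comb c)", OF _ _ v])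
    show "cmod (b n (comb c) w - b n (comb c) v) \<le> C * nrm (comb c) * nrm (w - v)"
      if "v \<in> H" "w \<in> H" for n v w
      using bounded_form_le[OF b, of "comb c" "w - v" n] that c by (simp add: bounded_form_diff[OF b])
  qed (use c 2 in blast)
  have 4: "convergent (\<lambda>n. b n u v)" if u: "u \<in> H" and v: "v \<in> H" for u v
  proof (rule convergent_by_density[where C = "C * nrm v", OF _ _ u])
    show "cmod (b n w v - b n u v) \<le> C * nrm v * nrm (w - u)" if "u \<in> H" "w \<in> H" for n u w
      using bounded_form_le[OF b, of "w - u" v n] that v by (simp add: bounded_form_diff[OF b] mult_ac)
  qed (use v 3 in blast)
  define F where "F u v = lim (\<lambda>n. b n u v)" for u v
  have lim: "(\<lambda>n. b n u v) \<longlonglongrightarrow> F u v" if "u \<in> H" "v \<in> H" for u v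
    unfolding F_def using 4[OF that] by (simp add: convergent_LIMSEQ_iff)
  have "bounded_form F C"
    unfolding bounded_form_def
  proof (intro conjI ballI allI)
    fix u v w assume H: "u \<in> H" "v \<in> H" "w \<in> H"
    have "(\<lambda>n. b n (u + v) w) \<longlonglongrightarrow> F u w + F v w" "(\<lambda>n. b n w (u + v)) \<longlonglongrightarrow> F w u + F w v"
      using H by (simp_all add: bounded_form_add[OF b] tendsto_add lim)
    then show "F (u + v) w = F u w + F v w" "F w (u + v) = F w u + F w v"
      using H lim LIMSEQ_unique by (metis V_add)+
  next
    fix t u v assume H: "u \<in> H" "v \<in> H"
    have "(\<lambda>n. b n (cscale t u) v) \<longlonglongrightarrow> t * F u v" "(\<lambda>n. b n u (cscale t v)) \<longlonglongrightarrow> cnj t * F u v"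
      using H by (simp_all add: bounded_form_scale[OF b] tendsto_mult_left lim)
    then show "F (cscale t u) v = t * F u v" "F u (cscale t v) = cnj t * F u v"
      using H lim LIMSEQ_unique by (metis V_scale)+
  next
    fix u v assume H: "u \<in> H" "v \<in> H"
    show "cmod (F u v) \<le> C * nrm u * nrm v"
      using H bounded_form_le[OF b] by (intro LIMSEQ_le_const2[OF tendsto_norm[OF lim]]) auto
  qed
  then show ?thesis using that lim by blast
qed

end

section \<open>Invariant subspaces of unitary representations\<close>

context inner_space
begin

text \<open>Polarisation: real parts come from norms of sums, imaginary parts from replacing
  \<open>v\<close> by \<open>cscale \<i> v\<close>.\<close>

lemma ip_eq_if_isometric:
  assumes add: "\<And>u v. \<lbrakk>u \<in> V; v \<in> V\<rbrakk> \<Longrightarrow> \<Phi> (u + v) = \<Phi> u + \<Phi> v"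
    and scale: "\<And>c u. u \<in> V \<Longrightarrow> \<Phi> (cscale c u) = cscale c (\<Phi> u)"
    and closed: "\<And>u. u \<in> V \<Longrightarrow> \<Phi> u \<in> V" and iso: "\<And>u. u \<in> V \<Longrightarrow> nrm (\<Phi> u) = nrm u"
    and uv: "u \<in> V" "v \<in> V"
  shows "ip (\<Phi> u) (\<Phi> v) = ip u v"
proof -
  have Re: "Re (ip (\<Phi> u) (\<Phi> v)) = Re (ip u v)" if "u \<in> V" "v \<in> V" for u v
    using nrm_add_sq[of "\<Phi> u" "\<Phi> v"] nrm_add_sq[of u v] that closed iso add[of u v, symmetric]
    by simp
  have "Im (ip (\<Phi> u) (\<Phi> v)) = Im (ip u v)"
    using Re[of u "cscale \<i> v"] uv closed by (simp add: scale ip_scale_right)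
  with Re[OF uv] show ?thesis by (simp add: complex_eq_iff)
qed

end

locale inner_unitary_rep = unitary_rep G R + hspace "vecs R" "inner_prod R"
  for G :: "('g, 'm) monoid_scheme" (structure) and R :: "('g, 'i) urep"
begin

definition invariant :: "('i \<Rightarrow> complex) set \<Rightarrow> bool"
  where "invariant W \<longleftrightarrow> cfun.subspace W \<and> W \<subseteq> vecs R \<and> (\<forall>g\<in>carrier G. \<forall>w\<in>W. act R g w \<in> W)"

lemma act_diff: "\<lbrakk>g \<in> carrier G; u \<in> vecs R; v \<in> vecs R\<rbrakk> \<Longrightarrow> act R g (u - v) = act R g u - act R g v"
  using act_add[of g "u - v" v] by (simp add: algebra_simps)

lemma nrm_act: "\<lbrakk>g \<in> carrier G; v \<in> vecs R\<rbrakk> \<Longrightarrow> nrm (act R g v) = nrm v"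
  by (simp add: ip_norm_def act_isometric)

lemma act_inv_act [simp]: "\<lbrakk>g \<in> carrier G; v \<in> vecs R\<rbrakk> \<Longrightarrow> act R (inv g) (act R g v) = v"
  and act_act_inv [simp]: "\<lbrakk>g \<in> carrier G; v \<in> vecs R\<rbrakk> \<Longrightarrow> act R g (act R (inv g) v) = v"
  using act_mult[of "inv g" g v] act_mult[of g "inv g" v] by (simp_all add: act_one)

lemma ip_act_left:
  "\<lbrakk>g \<in> carrier G; u \<in> vecs R; v \<in> vecs R\<rbrakk> \<Longrightarrow> inner_prod R (act R g u) v = inner_prod R u (act R (inv g) v)"
  using act_isometric[of g u "act R (inv g) v"] by (simp add: act_closed)

lemma invariant_orth:
  assumes B: "orthonormal B" and inv: "invariant (cfun.span B)"
  shows "invariant (orth B)"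
  unfolding invariant_def
proof (intro conjI ballI)
  show "cfun.subspace (orth B)"
    using orthonormal_in[OF B] by (auto simp: cfun.subspace_def ip_add ip_scale)
  fix g w assume g: "g \<in> carrier G" and w: "w \<in> orth B"
  have "inner_prod R (act R g w) e = 0" if e: "e \<in> B" for e
  proof -
    have "act R (inv g) e \<in> cfun.span B"
      using inv g cfun.span_base[OF e] by (simp add: invariant_def)
    then have "inner_prod R w (act R (inv g) e) = 0" by (rule orth_span[OF B, rotated 2]) (use w in auto)
    then show ?thesis using g w orthonormal_in[OF B e] by (simp add: ip_act_left)
  qed
  then show "act R g w \<in> orth B"
    using g w by (auto simp: act_closed)
qed auto

lemma subrep:
  assumes B: "orthonormal B" and inv: "invariant (cfun.span B)"
  shows "unitary_rep G (R\<lparr>vecs := cfun.span B\<rparr>)" "fin_dim (R\<lparr>vecs := cfun.span B\<rparr>)"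
    "rep_dim (R\<lparr>vecs := cfun.span B\<rparr>) = card B"
proof -
  have sub: "w \<in> vecs R" if "w \<in> cfun.span B" for w using that orthonormal_span[OF B] by blast
  show "unitary_rep G (R\<lparr>vecs := cfun.span B\<rparr>)"
    using hilbert_space_span[OF B] is_group inv sub
    by (auto simp: unitary_rep_def unitary_rep_axioms_def invariant_def act_add act_scale act_one
        act_mult act_isometric)
  show "fin_dim (R\<lparr>vecs := cfun.span B\<rparr>)" 
    using orthonormal_finite[OF B] by (auto simp: fin_dim_def)
  show "rep_dim (R\<lparr>vecs := cfun.span B\<rparr>) = card B"
    using dim_orthonormal_span[OF B] by (simp add: rep_dim_def)
qed

text \<open>Among the nonzero invariant subspaces of \<open>W\<close>, one of least dimension is
  irreducible; dimension is measured by the size of an orthonormal basis.\<close>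

lemma irreducible_subrep_exists:
  assumes W: "invariant W" "W \<noteq> {0}"
    and bound: "\<And>B. orthonormal B \<Longrightarrow> B \<subseteq> W \<Longrightarrow> card B \<le> N"
  obtains B where "orthonormal B" "B \<noteq> {}" "cfun.span B \<subseteq> W" "invariant (cfun.span B)"
    "fd_irrep G (R\<lparr>vecs := cfun.span B\<rparr>)"
proof -
  let ?P = "\<lambda>B. orthonormal B \<and> B \<noteq> {} \<and> cfun.span B \<subseteq> W \<and> invariant (cfun.span B)"
  have basis: "\<exists>B. orthonormal B \<and> cfun.span B = U" if "invariant U" "U \<subseteq> W" for U
    by (rule orthonormal_basis_exists[of U N]) (use that bound in \<open>auto simp: invariant_def\<close>)
  obtain B0 where "orthonormal B0" "cfun.span B0 = W" using basis[of W] W by auto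
  then have "?P B0" using W by auto
  then obtain B where B: "?P B" and min: "\<And>C. ?P C \<Longrightarrow> card B \<le> card C"
    using ex_has_least_nat[of ?P B0 card] by blast
  have on: "orthonormal B" using B by blast
  have "U = {0} \<or> U = cfun.span B" if U: "cfun.subspace U" "U \<subseteq> cfun.span B"
    "\<forall>g\<in>carrier G. \<forall>w\<in>U. act R g w \<in> U" for U
  proof (rule ccontr)
    assume neg: "\<not> (U = {0} \<or> U = cfun.span B)"
    have "invariant U" using U B orthonormal_span[of B] by (auto simp: invariant_def)
    then obtain C where C: "orthonormal C" "cfun.span C = U" using basis U B by blast
    then have "?P C" using \<open>invariant U\<close> U B neg by auto
    then have le: "card B \<le> card C" by (rule min)
    obtain w where w: "w \<in> cfun.span B" "w \<notin> U" using neg U by blast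
    have wV: "w \<in> vecs R" using w orthonormal_span[OF on] by blast
    define v where "v = w - fproj C w"
    have pU: "fproj C w \<in> U" using fproj_in_span[OF C(1)] C by simp
    have v: "v \<noteq> 0" "v \<in> vecs R" "v \<in> cfun.span B"
      using w wV pU U C(1) unfolding v_def by (auto intro!: cfun.span_diff)
    define f where "f = cscale (of_real (1 / nrm v)) v"
    have f: "orthonormal (insert f C)" "f \<notin> C"
      unfolding f_def using v C fproj_orth[OF C(1) wV] cfun.span_base[of _ C]
      by (intro orthonormal_extend; force simp: v_def)+
    have "f \<in> cfun.span B" unfolding f_def using v by (intro cfun.span_scale)
    moreover have "C \<subseteq> cfun.span B" using C U cfun.span_superset by blast
    ultimately have "card (insert f C) \<le> card B"
      using cfun.independent_span_bound[of B "insert f C"] on orthonormal_independent[OF f(1)] by simp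
    then show False using f le C by simp
  qed
  moreover obtain e where "e \<in> B" using B by blast
  then have "cfun.span B \<noteq> {0}"
    using orthonormal_nrm[OF on] cfun.span_base[of e B] by (metis nrm_zero singletonD zero_neq_one)
  ultimately have "fd_irrep G (R\<lparr>vecs := cfun.span B\<rparr>)"
    using subrep[of B] B by (simp add: fd_irrep_def)
  then show ?thesis using that B by blast
qed

lemma nrm_act_diff_le_seminorm:
  assumes W: "cfun.subspace W" "W \<subseteq> vecs R" and g: "g \<in> carrier G" and w: "w \<in> W"
  shows "nrm (act R g w - w) \<le> rep_seminorm (R\<lparr>vecs := W\<rparr>) g * nrm w"
proof (cases "w = 0")
  case True
  have "act R g 0 = 0" using act_diff[OF g, of 0 0] by simp
  then show ?thesis using True by simp
next
  case False
  have wV: "w \<in> vecs R" using w W by blast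
  then have n: "nrm w > 0" using False nrm_eq_0_iff[OF wV] nrm_nonneg[OF wV] by linarith
  define S where "S = {nrm (act R g w - w) | w. w \<in> W \<and> nrm w = 1}"
  \<comment> \<open>A supremum of reals is an upper bound only for a bounded set; unitarity provides
    the bound 2.\<close>
  have bdd: "bdd_above S"
  proof (rule bdd_aboveI[of _ 2])
    fix x assume "x \<in> S"
    then obtain w where x: "x = nrm (act R g w - w)" "w \<in> W" "nrm w = 1" by (auto simp: S_def)
    then have "w \<in> vecs R" using W by blast
    then show "x \<le> 2" using nrm_diff_le[of "act R g w" w] x g by (simp add: act_closed nrm_act)
  qed
  define v where "v = cscale (of_real (1 / nrm w)) w"
  have v: "v \<in> W" "nrm v = 1"
    using W w n wV by (auto simp: v_def nrm_scale norm_divide intro: cfun.subspace_scale)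
  have e: "act R g v - v = cscale (of_real (1 / nrm w)) (act R g w - w)"
    using g wV by (simp add: v_def act_scale cfun.scale_right_diff_distrib)
  have "nrm (act R g v - v) \<le> Sup S"
    using v by (intro cSup_upper[OF _ bdd]) (auto simp: S_def)
  moreover have "nrm (act R g v - v) = nrm (act R g w - w) / nrm w"
    unfolding e using g wV n by (simp add: nrm_scale act_closed norm_divide)
  ultimately show ?thesis using n by (simp add: rep_seminorm_def S_def field_simps)
qed

end

section \<open>The representation attached to an invariant kernel\<close>

locale pd_rep = group G + pd_kernel "carrier G \<times> (UNIV :: nat set)" k
  for G :: "('g, 'm) monoid_scheme" (structure) and k :: "'g \<times> nat \<Rightarrow> 'g \<times> nat \<Rightarrow> complex" +
  assumes k_invariant: "\<lbrakk>b \<in> carrier G; g \<in> carrier G; h \<in> carrier G\<rbrakk>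
    \<Longrightarrow> k (b \<otimes> g, m) (b \<otimes> h, n) = k (g, m) (h, n)"
begin

definition shift :: "'g \<Rightarrow> ('g \<times> nat \<Rightarrow> complex) \<Rightarrow> 'g \<times> nat \<Rightarrow> complex"
  where "shift b f = (\<lambda>(g, n). if g \<in> carrier G then f (inv b \<otimes> g, n) else 0)"

definition move :: "'g \<Rightarrow> (('g \<times> nat) \<times> complex) list \<Rightarrow> (('g \<times> nat) \<times> complex) list"
  where "move b c = map (\<lambda>((g, n), a). ((b \<otimes> g, n), a)) c"

lemma L_move [simp]: "L c \<Longrightarrow> b \<in> carrier G \<Longrightarrow> L (move b c)"
  by (force simp: move_def)

lemma pairing_move: "pairing f (move b c) = pairing (\<lambda>(g, n). f (b \<otimes> g, n)) c"
  by (induction c) (auto simp: move_def)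

lemma move_inv_move: "L c \<Longrightarrow> b \<in> carrier G \<Longrightarrow> move (inv b) (move b c) = c"
  by (induction c) (auto simp: move_def m_assoc[symmetric])

lemma pairing_shift: "L c \<Longrightarrow> pairing (shift b f) c = pairing f (move (inv b) c)"
  unfolding pairing_move by (rule pairing_cong) (auto simp: shift_def)

lemma comb_move:
  assumes c: "L c" and b: "b \<in> carrier G"
  shows "comb (move b c) = shift b (comb c)"
proof
  fix y :: "'g \<times> nat"
  obtain h n where y: "y = (h, n)" by (cases y)
  show "comb (move b c) y = shift b (comb c) y"
  proof (cases "h \<in> carrier G")
    case True
    have "pairing (k (h, n)) (move b c) = pairing (k (inv b \<otimes> h, n)) c"
      unfolding pairing_move
    proof (rule pairing_cong)
      fix x assume "x \<in> fst ` set c"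
      then obtain g m where x: "x = (g, m)" "g \<in> carrier G" using c by auto
      have "k (b \<otimes> (inv b \<otimes> h), n) (b \<otimes> g, m) = k (inv b \<otimes> h, n) (g, m)"
        using b x True by (intro k_invariant) auto
      then show "(\<lambda>(g, m). k (h, n) (b \<otimes> g, m)) x = k (inv b \<otimes> h, n) x"
        using b x True by (simp add: m_assoc[symmetric])
    qed
    then show ?thesis using True b by (simp add: comb_def shift_def y)
  qed (simp add: comb_def shift_def y)
qed

lemma gram_move: "\<lbrakk>L c; L d; b \<in> carrier G\<rbrakk> \<Longrightarrow> gram (move b c) (move b d) = gram c d"
  by (simp add: gram_def comb_move pairing_shift move_inv_move)

lemma qnorm_move: "\<lbrakk>L c; b \<in> carrier G\<rbrakk> \<Longrightarrow> qnorm (move b c) = qnorm c"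
  by (simp add: qnorm_def gram_move)

lemma shift_in_H: "f \<in> H \<Longrightarrow> b \<in> carrier G \<Longrightarrow> shift b f \<in> H"
proof -
  assume f: "f \<in> H" and b: "b \<in> carrier G"
  obtain C where C: "\<And>c. L c \<Longrightarrow> (cmod (pairing f c))\<^sup>2 \<le> C * qnorm c" using H_bounded[OF f] by blast
  show ?thesis
  proof (rule HI[where C = C])
    show "(cmod (pairing (shift b f) c))\<^sup>2 \<le> C * qnorm c" if "L c" for c
      using C[of "move (inv b) c"] that b by (simp add: pairing_shift qnorm_move)
  qed (auto simp: shift_def split: if_splits)
qed

lemma shift_add: "shift b (f + g) = shift b f + shift b g"
  and shift_cscale: "shift b (cscale t f) = cscale t (shift b f)"
  by (auto simp: shift_def cscale_def fun_eq_iff)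

lemma shift_one: "f \<in> H \<Longrightarrow> shift \<one> f = f"
  by (auto simp: shift_def fun_eq_iff H_outside)

lemma shift_mult: "b \<in> carrier G \<Longrightarrow> b' \<in> carrier G \<Longrightarrow> shift (b \<otimes> b') f = shift b (shift b' f)"
  by (auto simp: shift_def fun_eq_iff inv_mult_group m_assoc)

lemma nrm_shift_le: "f \<in> H \<Longrightarrow> b \<in> carrier G \<Longrightarrow> nrm (shift b f) \<le> nrm f"
proof (rule nrm_le)
  assume f: "f \<in> H" and b: "b \<in> carrier G"
  show "shift b f \<in> H" "0 \<le> nrm f" using f b by (simp_all add: shift_in_H)
  fix c assume c: "L c"
  have "(nrm (comb (move (inv b) c)))\<^sup>2 = (nrm (comb c))\<^sup>2"
    using c b by (simp add: nrm_comb_sq qnorm_move)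
  then have "nrm (comb (move (inv b) c)) = nrm (comb c)"
    using c b by (simp add: power2_eq_iff_nonneg)
  then show "cmod (pairing (shift b f) c) \<le> nrm f * nrm (comb c)"
    using norm_pairing_le[OF f, of "move (inv b) c"] c b by (simp add: pairing_shift)
qed

lemma nrm_shift: "f \<in> H \<Longrightarrow> b \<in> carrier G \<Longrightarrow> nrm (shift b f) = nrm f"
  using nrm_shift_le[of f b] nrm_shift_le[of "shift b f" "inv b"] shift_mult[of "inv b" b f]
  by (simp add: shift_in_H shift_one)

lemma hip_shift: "\<lbrakk>f \<in> H; g \<in> H; b \<in> carrier G\<rbrakk> \<Longrightarrow> hip (shift b f) (shift b g) = hip f g"
  by (rule ip_eq_if_isometric[of "shift b", OF shift_add shift_cscale shift_in_H nrm_shift])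

lemma shift_kvec: "b \<in> carrier G \<Longrightarrow> g \<in> carrier G \<Longrightarrow> shift b (kvec (g, n)) = kvec (b \<otimes> g, n)"
  using comb_move[of "[((g, n), 1)]" b] by (simp add: kvec_def move_def)

definition rep :: "('g, 'g \<times> nat) urep"
  where "rep = \<lparr>vecs = H, inner_prod = hip, act = shift\<rparr>"

lemma rep_simps [simp]: "vecs rep = H" "inner_prod rep = hip" "act rep = shift"
  by (simp_all add: rep_def)

lemma unitary_rep_rep: "unitary_rep G rep"
  using hilbert_space is_group
  by (auto simp: unitary_rep_def unitary_rep_axioms_def shift_in_H shift_add shift_cscale shift_one
      shift_mult hip_shift)

lemma inner_unitary_rep_rep: "inner_unitary_rep G rep"
  unfolding inner_unitary_rep_def using unitary_rep_rep hspace_axioms by simp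

end

sublocale pd_rep \<subseteq> R: inner_unitary_rep G rep
  rewrites "vecs rep = H" and "inner_prod rep = hip" and "act rep = shift"
  by (rule inner_unitary_rep_rep) simp_all

section \<open>Spectral subspaces of an invariant compact form\<close>

text \<open>\<open>K_weakly_continuous\<close> is compactness in the shape in which it is used: the
  weak limit of a maximising sequence in the unit ball still attains the supremum.
  \<open>K_trace\<close> limits the number of orthonormal vectors on which \<open>K\<close> is
  large; at the empty set it also yields \<open>0 \<le> C\<close>.\<close>

locale invariant_form = pd_rep G k
  for G :: "('g, 'm) monoid_scheme" (structure) and k :: "'g \<times> nat \<Rightarrow> 'g \<times> nat \<Rightarrow> complex" +
  fixes K :: "('g \<times> nat \<Rightarrow> complex) \<Rightarrow> ('g \<times> nat \<Rightarrow> complex) \<Rightarrow> complex" and C :: real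
  assumes countable_carrier: "countable (carrier G)"
    and K_form: "bounded_form K C"
    and K_cnj: "\<lbrakk>u \<in> H; v \<in> H\<rbrakk> \<Longrightarrow> K v u = cnj (K u v)"
    and K_shift: "\<lbrakk>b \<in> carrier G; u \<in> H; v \<in> H\<rbrakk> \<Longrightarrow> K (shift b u) (shift b v) = K u v"
    and K_trace: "orthonormal B \<Longrightarrow> (\<Sum>e\<in>B. Re (K e e)) \<le> C"
    and K_weakly_continuous: "\<lbrakk>\<And>n. f n \<in> H; \<And>n. nrm (f n) \<le> 1; g \<in> H;
      \<And>w. w \<in> H \<Longrightarrow> (\<lambda>n. hip (f n) w) \<longlonglongrightarrow> hip g w\<rbrakk> \<Longrightarrow> (\<lambda>n. Re (K (f n) (f n))) \<longlonglongrightarrow> Re (K g g)"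
begin

lemma K_scale_diag: "u \<in> H \<Longrightarrow> K (cscale t u) (cscale t u) = of_real ((cmod t)\<^sup>2) * K u u"
  unfolding complex_norm_square by (simp add: bounded_form_scale[OF K_form] mult_ac)

lemma K_add_diag:
  "\<lbrakk>u \<in> H; v \<in> H\<rbrakk> \<Longrightarrow> Re (K (u + cscale (cnj t) v) (u + cscale (cnj t) v))
    = Re (K u u) + 2 * Re (t * K u v) + (cmod t)\<^sup>2 * Re (K v v)"
  using K_cnj[of u v]
  by (simp add: bounded_form_scale[OF K_form] bounded_form_add[OF K_form] cmod_power2 algebra_simps
      power2_eq_square[of "Re t"] power2_eq_square[of "Im t"])

text \<open>The supremum s of \<open>K\<close> over the unit ball of \<open>M\<close> is attained at
  a weak limit of a maximising sequence, and the first-order condition there is the eigenvalue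
  equation, tested against \<open>M\<close> only. The vector \<open>w0\<close> serves to push s
  above \<kappa>.\<close>

lemma top_eigenspace:
  assumes B: "orthonormal B" and inv: "R.invariant (cfun.span B)"
  defines "M \<equiv> orth B"
  assumes \<kappa>: "\<kappa> > 0" and w0: "w0 \<in> M" "Re (K w0 w0) > \<kappa> * (nrm w0)\<^sup>2"
  obtains s W where "s > \<kappa>" "R.invariant W" "W \<subseteq> M" "W \<noteq> {0}"
    "\<And>w v. w \<in> W \<Longrightarrow> v \<in> M \<Longrightarrow> K w v = of_real s * hip w v"
proof -
  have M: "R.invariant M" unfolding M_def by (rule R.invariant_orth[OF B inv])
  have MH: "v \<in> H" if "v \<in> M" for v using that by (simp add: M_def)
  have Msub: "cfun.subspace M" using M by (simp add: R.invariant_def)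
  define S where "S = {Re (K w w) | w. w \<in> M \<and> nrm w \<le> 1}"
  define s where "s = Sup S"
  have C: "C \<ge> 0" using K_trace[of "{}"] by simp
  have bdd: "bdd_above S"
  proof (rule bdd_aboveI[of _ C])
    fix x assume "x \<in> S"
    then obtain w where w: "x = Re (K w w)" "w \<in> M" "nrm w \<le> 1" by (auto simp: S_def)
    have "x \<le> cmod (K w w)" using w complex_Re_le_cmod by simp
    also have "\<dots> \<le> C * nrm w * nrm w" using w MH by (intro bounded_form_le[OF K_form])
    also have "\<dots> \<le> C * 1 * 1" using w MH C by (intro mult_mono) auto
    finally show "x \<le> C" by simp
  qed
  have le_s: "Re (K v v) \<le> s * (nrm v)\<^sup>2" if v: "v \<in> M" for v
  proof (cases "v = 0")
    case True
    then show ?thesis using bounded_form_zero[OF K_form, of 0] by simp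
  next
    case False
    then have n: "nrm v > 0" using nrm_eq_0_iff[OF MH[OF v]] nrm_nonneg[OF MH[OF v]] by linarith
    let ?u = "cscale (of_real (1 / nrm v)) v"
    have "?u \<in> M" "nrm ?u = 1"
      using v n MH Msub by (simp_all add: nrm_scale norm_divide cfun.subspace_scale)
    then have "Re (K ?u ?u) \<le> s" unfolding s_def by (intro cSup_upper[OF _ bdd]) (auto simp: S_def)
    then show ?thesis using v n MH
      by (simp add: K_scale_diag norm_divide power_divide field_simps del: of_real_divide of_real_power)
  qed
  have "w0 \<noteq> 0" using w0 bounded_form_zero[OF K_form, of 0] by auto
  then have "nrm w0 > 0" using nrm_eq_0_iff[OF MH[OF w0(1)]] nrm_nonneg[OF MH[OF w0(1)]] by linarith
  then have s: "s > \<kappa>"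
    using order_less_le_trans[OF w0(2) le_s[OF w0(1)]] by simp
  have ne: "S \<noteq> {}" using cfun.subspace_0[OF Msub] by (auto simp: S_def intro!: exI[of _ 0])
  have "\<exists>w. w \<in> M \<and> nrm w \<le> 1 \<and> s - 1 / real (Suc n) < Re (K w w)" for n
    using less_cSup_iff[OF ne bdd, of "s - 1 / real (Suc n)"] by (auto simp: s_def S_def)
  then obtain f where f: "\<And>n. f n \<in> M" "\<And>n. nrm (f n) \<le> 1"
    "\<And>n. s - 1 / real (Suc n) < Re (K (f n) (f n))" by metis
  have cX: "countable (carrier G \<times> (UNIV :: nat set))" using countable_carrier by simp
  obtain r w where r: "strict_mono r" and w: "w \<in> H" "nrm w \<le> 1"
    and lim: "\<And>v. v \<in> H \<Longrightarrow> (\<lambda>n. hip (f (r n)) v) \<longlonglongrightarrow> hip w v"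
    using weak_subsequence[OF cX, of f 1] f MH by metis
  have wM: "w \<in> M"
  proof -
    have "hip w e = 0" if e: "e \<in> B" for e
    proof (rule LIMSEQ_unique)
      show "(\<lambda>n. hip (f (r n)) e) \<longlonglongrightarrow> hip w e" using orthonormal_in[OF B e] by (rule lim)
      show "(\<lambda>n. hip (f (r n)) e) \<longlonglongrightarrow> 0" using f(1) e by (simp add: M_def)
    qed
    then show ?thesis using w by (simp add: M_def)
  qed
  have ws: "s \<le> Re (K w w)"
  proof (rule LIMSEQ_le)
    show "(\<lambda>n. Re (K (f (r n)) (f (r n)))) \<longlonglongrightarrow> Re (K w w)"
      using f MH w lim by (intro K_weakly_continuous) auto
    have "(\<lambda>n. s - 1 / real (Suc n)) \<longlonglongrightarrow> s - 0"
      by (intro tendsto_intros LIMSEQ_Suc lim_1_over_n)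
    then show "(\<lambda>n. s - 1 / real (Suc n)) \<longlonglongrightarrow> s" by simp
    have "s - 1 / real (Suc n) \<le> Re (K (f (r n)) (f (r n)))" for n
    proof -
      have "1 / real (Suc (r n)) \<le> 1 / real (Suc n)"
        using seq_suble[OF r, of n] by (intro divide_left_mono) auto
      then show ?thesis using f(3)[of "r n"] by linarith
    qed
    then show "\<exists>N. \<forall>n\<ge>N. s - 1 / real (Suc n) \<le> Re (K (f (r n)) (f (r n)))" by blast
  qed
  have "(nrm w)\<^sup>2 \<le> 1" using w power_mono[of "nrm w" 1 2] by simp
  then have sw: "s * (nrm w)\<^sup>2 \<le> s" using s \<kappa> by simp
  have eig: "K w v = of_real s * hip w v" if v: "v \<in> M" for v
  proof -
    \<comment> \<open>The form s times the inner product minus \<open>K\<close> is nonnegative on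
      \<open>M\<close> and, as \<open>nrm w \<le> 1\<close> and s is positive, at most 0 at
      \<open>w\<close>. Hence its mixed term with any \<open>v\<close> in \<open>M\<close>
      vanishes.\<close>
    have "(cmod (of_real s * hip w v - K w v))\<^sup>2 \<le> 0 * (s * (nrm v)\<^sup>2 - Re (K v v))"
    proof (rule discriminant_bound)
      fix t
      have "w + cscale (cnj t) v \<in> M"
        using v wM Msub by (intro cfun.subspace_add cfun.subspace_scale)
      then have "Re (K (w + cscale (cnj t) v) (w + cscale (cnj t) v)) \<le> s * (nrm (w + cscale (cnj t) v))\<^sup>2"
        by (rule le_s)
      also have "\<dots> = s * (nrm w)\<^sup>2 + 2 * Re (t * (of_real s * hip w v)) + (cmod t)\<^sup>2 * (s * (nrm v)\<^sup>2)"
        using MH[OF v] w by (simp add: nrm_add_sq ip_scale_right nrm_scale power_mult_distrib algebra_simps)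
      finally have "Re (K w w) + 2 * Re (t * K w v) + (cmod t)\<^sup>2 * Re (K v v)
          \<le> s * (nrm w)\<^sup>2 + 2 * Re (t * (of_real s * hip w v)) + (cmod t)\<^sup>2 * (s * (nrm v)\<^sup>2)"
        using MH[OF v] w by (simp only: K_add_diag)
      moreover have "Re (t * (of_real s * hip w v - K w v)) = Re (t * (of_real s * hip w v)) - Re (t * K w v)"
        by (simp only: right_diff_distrib minus_complex.sel)
      ultimately show "0 \<le> 0 + 2 * Re (t * (of_real s * hip w v - K w v)) + (cmod t)\<^sup>2 * (s * (nrm v)\<^sup>2 - Re (K v v))"
        using ws sw by (simp only: right_diff_distrib)
    next
      show "0 \<le> s * (nrm v)\<^sup>2 - Re (K v v)" using le_s[OF v] by simp
    qed
    then show ?thesis by simp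
  qed
  define W where "W = {w \<in> M. \<forall>v\<in>M. K w v = of_real s * hip w v}"
  have "R.invariant W"
    unfolding R.invariant_def
  proof (intro conjI ballI)
    show "cfun.subspace W"
      using Msub MH unfolding W_def
      by (auto simp: cfun.subspace_def bounded_form_zero[OF K_form] bounded_form_add[OF K_form]
          bounded_form_scale[OF K_form] ip_add ip_scale algebra_simps)
    show "W \<subseteq> H" using MH by (auto simp: W_def)
    fix g u assume g: "g \<in> carrier G" and u: "u \<in> W"
    have uM: "u \<in> M" using u by (simp add: W_def)
    have act_M: "shift b v \<in> M" if "b \<in> carrier G" "v \<in> M" for b v
      using M that by (simp add: R.invariant_def)
    have "K (shift g u) v = of_real s * hip (shift g u) v" if v: "v \<in> M" for v
    proof -
      have e: "v = shift g (shift (inv g) v)" using g MH[OF v] by simp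
      have iv: "shift (inv g) v \<in> M" using act_M g v by simp
      have "K (shift g u) (shift g (shift (inv g) v)) = K u (shift (inv g) v)"
        using g MH uM iv by (intro K_shift) auto
      also have "\<dots> = of_real s * hip u (shift (inv g) v)" using u iv by (simp add: W_def)
      also have "hip u (shift (inv g) v) = hip (shift g u) v"
        using g MH[OF uM] MH[OF v] by (simp add: R.ip_act_left)
      finally show ?thesis using e by simp
    qed
    then show "shift g u \<in> W" using act_M[OF g uM] by (simp add: W_def)
  qed
  moreover have "W \<subseteq> M" by (auto simp: W_def)
  moreover have "w \<in> W" using wM eig by (simp add: W_def)
  moreover have "w \<noteq> 0" using ws s \<kappa> bounded_form_zero[OF K_form, of 0] by auto
  ultimately show ?thesis using that[OF s, of W] unfolding W_def by blast
qed

text \<open>The invariant kept while \<open>spectral_subspace\<close> collects irreducible pieces: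
  \<open>\<R>\<close> holds the non-trivial ones. The dimension condition is an inequality because
  trivial pieces enlarge \<open>B\<close> only. The last condition converts membership in a Bohr set
  into a bound on displacements.\<close>

definition controlled :: "('g \<times> nat \<Rightarrow> complex) set \<Rightarrow> 'g rep set \<Rightarrow> bool"
  where "controlled B \<R> \<longleftrightarrow> orthonormal B \<and> R.invariant (cfun.span B) \<and> finite \<R> \<and>
    (\<forall>\<rho>\<in>\<R>. fd_irrep G \<rho> \<and> \<not> acts_trivially G \<rho>) \<and> (\<Sum>\<rho>\<in>\<R>. rep_dim \<rho>) \<le> card B \<and>
    (\<forall>g\<in>carrier G. \<forall>r\<ge>0. \<forall>v\<in>cfun.span B. (\<forall>\<rho>\<in>\<R>. rep_seminorm \<rho> g \<le> r)
      \<longrightarrow> nrm (shift g v - v) \<le> r * nrm v)"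

lemma controlledD:
  "\<lbrakk>controlled B \<R>; g \<in> carrier G; 0 \<le> r; \<forall>\<rho>\<in>\<R>. rep_seminorm \<rho> g \<le> r; v \<in> cfun.span B\<rbrakk>
    \<Longrightarrow> nrm (shift g v - v) \<le> r * nrm v"
  unfolding controlled_def by blast

lemma controlled_empty: "controlled {} {}"
proof -
  have "shift g 0 = 0" for g by (auto simp: shift_def fun_eq_iff)
  then show ?thesis by (simp add: controlled_def R.invariant_def cfun.subspace_0)
qed

text \<open>Irreducible pieces of eigenspaces are collected greedily. The collected basis
  contributes on average at least \<kappa> per vector to the trace, so a collection of greatest size
  exists; if \<open>K\<close> exceeded \<kappa> on its complement, \<open>top_eigenspace\<close>
  would supply a further piece.\<close>

lemma spectral_subspace:
  assumes \<kappa>: "\<kappa> > 0"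
  obtains B \<R> where "controlled B \<R>" "\<kappa> * real (card B) \<le> C"
    "\<And>w. \<lbrakk>w \<in> H; \<forall>e\<in>B. hip w e = 0\<rbrakk> \<Longrightarrow> Re (K w w) \<le> \<kappa> * (nrm w)\<^sup>2"
proof -
  define good where "good = (\<lambda>(B, \<R>). controlled B \<R> \<and> \<kappa> * real (card B) \<le> (\<Sum>e\<in>B. Re (K e e)))"
  have "good ({}, {})" by (simp add: good_def controlled_empty)
  moreover have bound: "card (fst p) < Suc (nat \<lfloor>C / \<kappa>\<rfloor>)" if "good p" for p
  proof -
    obtain B \<R> where p: "p = (B, \<R>)" by (cases p)
    have "\<kappa> * real (card B) \<le> C" using that K_trace[of B] by (auto simp: good_def controlled_def p)
    then have "real (card B) \<le> C / \<kappa>" using \<kappa> by (simp add: field_simps)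
    then show ?thesis by (simp add: p le_nat_floor less_Suc_eq_le)
  qed
  ultimately have "\<exists>p. good p \<and> (\<forall>q. good q \<longrightarrow> card (fst q) \<le> card (fst p))"
    by (intro ex_has_greatest_nat[where b = "Suc (nat \<lfloor>C / \<kappa>\<rfloor>)"]) auto
  then obtain p where "good p" "\<And>q. good q \<Longrightarrow> card (fst q) \<le> card (fst p)" by blast
  then obtain B \<R> where g: "good (B, \<R>)" and max: "\<And>q. good q \<Longrightarrow> card (fst q) \<le> card B"
    by (cases p) auto
  have c: "controlled B \<R>" using g by (simp add: good_def)
  have B: "orthonormal B" "R.invariant (cfun.span B)" "\<kappa> * real (card B) \<le> (\<Sum>e\<in>B. Re (K e e))"
    and \<R>: "finite \<R>" "\<And>\<rho>. \<rho> \<in> \<R> \<Longrightarrow> fd_irrep G \<rho> \<and> \<not> acts_trivially G \<rho>" "(\<Sum>\<rho>\<in>\<R>. rep_dim \<rho>) \<le> card B"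
    using g unfolding good_def controlled_def by auto
  have "Re (K w w) \<le> \<kappa> * (nrm w)\<^sup>2" if w: "w \<in> H" "\<forall>e\<in>B. hip w e = 0" for w
  proof (rule ccontr)
    assume "\<not> ?thesis"
    then obtain s W where s: "s > \<kappa>" and W: "R.invariant W" "W \<subseteq> orth B" "W \<noteq> {0}"
      and eig: "\<And>w v. w \<in> W \<Longrightarrow> v \<in> orth B \<Longrightarrow> K w v = of_real s * hip w v"
      using top_eigenspace[OF B(1,2) \<kappa>, of w] w by (auto simp: not_le)
    have Kee: "Re (K e e) = s" if "orthonormal D" "D \<subseteq> W" "e \<in> D" for D e
      using eig[of e e] that W orthonormal_ip[OF that(1), of e e] by (simp add: subset_eq)
    obtain D where D: "orthonormal D" "D \<noteq> {}" "cfun.span D \<subseteq> W" "R.invariant (cfun.span D)"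
      "fd_irrep G (rep\<lparr>vecs := cfun.span D\<rparr>)"
    \<comment> \<open>On \<open>W\<close> the form is s times the inner product, so the trace bound
      allows at most \<open>C / s\<close> orthonormal vectors: the eigenspace is
      finite-dimensional.\<close>
    proof (rule R.irreducible_subrep_exists[OF W(1,3)])
      fix D assume D: "orthonormal D" "D \<subseteq> W"
      have "s * real (card D) \<le> C" using K_trace[OF D(1)] Kee[OF D] by (simp add: mult.commute)
      then have "real (card D) \<le> C / s" using s \<kappa> by (simp add: field_simps)
      then show "card D \<le> nat \<lfloor>C / s\<rfloor>" by (rule le_nat_floor)
    qed
    let ?\<rho> = "rep\<lparr>vecs := cfun.span D\<rparr>"
    have DW: "D \<subseteq> W" using D cfun.span_superset by blast
    have orth: "hip y x = 0" if "x \<in> cfun.span B" "y \<in> cfun.span D" for x y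
      by (rule orth_span[OF B(1) _ _ that(1)]) (use that D W in auto)
    have U: "orthonormal (B \<union> D)" "D \<inter> B = {}"
      using orthonormal_Un[OF D(1) B(1) orth[OF cfun.span_base cfun.span_base]]
      by (simp_all add: Un_commute)
    have sp: "cfun.span (B \<union> D) = {x + y | x y. x \<in> cfun.span B \<and> y \<in> cfun.span D}"
      by (rule cfun.span_Un)
    have inB: "x \<in> H" "shift g x \<in> cfun.span B" if "x \<in> cfun.span B" "g \<in> carrier G" for g x
      using B that unfolding R.invariant_def by auto
    have inD: "x \<in> H" "shift g x \<in> cfun.span D" if "x \<in> cfun.span D" "g \<in> carrier G" for g x
      using D that unfolding R.invariant_def by auto
    \<comment> \<open>A piece with trivial action is not moved at all, so it satisfies every
      displacement bound without a member of \<open>\<R>'\<close> to control it.\<close>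
    define \<R>' where "\<R>' = (if acts_trivially G ?\<rho> then \<R> else insert ?\<rho> \<R>)"
    have "good (B \<union> D, \<R>')"
      unfolding good_def controlled_def prod.case
    proof (intro conjI allI impI ballI)
      show "orthonormal (B \<union> D)" by (rule U)
      show "R.invariant (cfun.span (B \<union> D))"
        unfolding R.invariant_def
      proof (intro conjI ballI)
        show "cfun.span (B \<union> D) \<subseteq> H" by (rule orthonormal_span[OF U(1)])
        fix g w assume g: "g \<in> carrier G" and "w \<in> cfun.span (B \<union> D)"
        then obtain x y where xy: "w = x + y" "x \<in> cfun.span B" "y \<in> cfun.span D" using sp by auto
        show "shift g w \<in> cfun.span (B \<union> D)"
          unfolding sp xy(1) shift_add using inB(2)[OF xy(2) g] inD(2)[OF xy(3) g] by blast
      qed simp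
      have "(\<Sum>e\<in>B \<union> D. Re (K e e)) = (\<Sum>e\<in>B. Re (K e e)) + s * real (card D)"
        using U B D Kee[OF D(1) DW] by (subst sum.union_disjoint) auto
      moreover have "\<kappa> * real (card D) \<le> s * real (card D)" using s by (intro mult_right_mono) auto
      ultimately show "\<kappa> * real (card (B \<union> D)) \<le> (\<Sum>e\<in>B \<union> D. Re (K e e))"
        using B(3) U B(1) D(1) by (subst card_Un_disjoint) (auto simp: algebra_simps)
      show "finite \<R>'" using \<R> by (simp add: \<R>'_def)
      show "fd_irrep G \<rho>" "\<not> acts_trivially G \<rho>" if "\<rho> \<in> \<R>'" for \<rho>
        using that \<R>(2) D(5) by (auto simp: \<R>'_def split: if_splits)
      have "(\<Sum>\<rho>\<in>\<R>'. rep_dim \<rho>) \<le> (\<Sum>\<rho>\<in>\<R>. rep_dim \<rho>) + rep_dim ?\<rho>"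
        using \<R>(1) by (auto simp: \<R>'_def sum.insert_if)
      also have "\<dots> \<le> card B + card D" using \<R>(3) R.subrep(3)[OF D(1,4)] by simp
      finally show "(\<Sum>\<rho>\<in>\<R>'. rep_dim \<rho>) \<le> card (B \<union> D)"
        using U B(1) D(1) by (subst card_Un_disjoint) auto
      fix g r v assume g: "g \<in> carrier G" and r: "0 \<le> r" and v: "v \<in> cfun.span (B \<union> D)"
        and le: "\<forall>\<rho>\<in>\<R>'. rep_seminorm \<rho> g \<le> r"
      obtain x y where xy: "v = x + y" "x \<in> cfun.span B" "y \<in> cfun.span D" using v sp by auto
      have xyH: "x \<in> H" "y \<in> H" "shift g x \<in> H" "shift g y \<in> H"
        using xy inB(1) inD(1) g by (auto simp: shift_in_H)
      have nx: "nrm (shift g x - x) \<le> r * nrm x"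
        using le by (intro controlledD[OF c g r _ xy(2)]) (auto simp: \<R>'_def split: if_splits)
      have ny: "nrm (shift g y - y) \<le> r * nrm y"
      proof (cases "acts_trivially G ?\<rho>")
        case True
        then have "shift g y = y" using g xy by (simp add: acts_trivially_def)
        then show ?thesis using r xyH by simp
      next
        case False
        then have "rep_seminorm ?\<rho> g \<le> r" using le by (simp add: \<R>'_def)
        then have "rep_seminorm ?\<rho> g * nrm y \<le> r * nrm y" using xyH by (intro mult_right_mono) auto
        moreover have "nrm (shift g y - y) \<le> rep_seminorm ?\<rho> g * nrm y"
          using D(4) g xy unfolding R.invariant_def by (intro R.nrm_act_diff_le_seminorm) auto
        ultimately show ?thesis by simp
      qed
      have dx: "shift g x - x \<in> cfun.span B" and dy: "shift g y - y \<in> cfun.span D"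
        using inB inD g xy by (auto intro: cfun.span_diff)
      have o: "hip x y = 0" "hip (shift g x - x) (shift g y - y) = 0"
        using orth[OF xy(2,3)] orth[OF dx dy] hip_cnj by (metis complex_cnj_zero)+
      \<comment> \<open>The displacements of the two components are orthogonal, so squares add and
        the constant r does not deteriorate with the number of pieces.\<close>
      have "(nrm (shift g v - v))\<^sup>2 = (nrm ((shift g x - x) + (shift g y - y)))\<^sup>2"
        by (simp add: xy shift_add algebra_simps)
      also have "\<dots> = (nrm (shift g x - x))\<^sup>2 + (nrm (shift g y - y))\<^sup>2"
        using xyH o by (simp add: nrm_add_sq)
      also have "\<dots> \<le> (r * nrm x)\<^sup>2 + (r * nrm y)\<^sup>2"
        using nx ny xyH by (intro add_mono power_mono) auto
      also have "\<dots> = r\<^sup>2 * (nrm v)\<^sup>2"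
        using xyH o xy by (simp add: nrm_add_sq power_mult_distrib algebra_simps)
      also have "\<dots> = (r * nrm v)\<^sup>2" by (simp add: power_mult_distrib)
      finally show "nrm (shift g v - v) \<le> r * nrm v"
        by (rule power2_le_imp_le) (use r xyH xy in simp)
    qed
    then have "card (B \<union> D) \<le> card B" using max by fastforce
    then show False using U B(1) D(1,2) by (subst (asm) card_Un_disjoint) (auto simp: card_eq_0_iff)
  qed
  moreover have "\<kappa> * real (card B) \<le> C" using B(3) K_trace[OF B(1)] by simp
  ultimately show ?thesis using that[OF c] by blast
qed

end

section \<open>Kernels from averages, and ergodicity\<close>

definition avg :: "'s set \<Rightarrow> ('s \<Rightarrow> 'b) \<Rightarrow> 'b :: real_vector"
  where "avg F f = (1 / real (card F)) *\<^sub>R sum f F"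

lemma avg_of_real: "avg F (\<lambda>s. of_real (f s)) = (of_real (avg F f) :: complex)"
  by (simp add: avg_def scaleR_conv_of_real)

lemma avg_const: "finite F \<Longrightarrow> F \<noteq> {} \<Longrightarrow> avg F (\<lambda>s. c) = c"
  by (simp add: avg_def sum_constant_scaleR)

lemma avg_mono: "(\<And>s. s \<in> F \<Longrightarrow> f s \<le> g s) \<Longrightarrow> avg F f \<le> (avg F g :: real)"
  by (auto simp: avg_def intro!: divide_right_mono sum_mono)

lemma norm_avg_le: "norm (avg F f) \<le> avg F (\<lambda>s. norm (f s))"
  for f :: "'s \<Rightarrow> 'b :: real_normed_vector"
  by (auto simp: avg_def intro!: divide_right_mono norm_sum)

lemma avg_cong: "(\<And>s. s \<in> F \<Longrightarrow> f s = g s) \<Longrightarrow> avg F f = avg F g"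
  by (auto simp: avg_def intro!: arg_cong2[of _ _ _ _ scaleR] sum.cong)

lemma avg_add: "avg F (\<lambda>s. f s + g s) = avg F f + avg F g"
  by (simp add: avg_def sum.distrib scaleR_add_right)

lemma avg_mult_left: "avg F (\<lambda>s. c * f s) = c * avg F f" for c :: "'b :: real_algebra"
  by (simp add: avg_def sum_distrib_left)

lemma avg_sum: "avg F (\<lambda>s. \<Sum>i\<in>I. f i s) = (\<Sum>i\<in>I. avg F (f i))"
  by (simp add: avg_def scaleR_sum_right sum.swap[of _ I])

lemma Re_avg: "Re (avg F f) = avg F (\<lambda>s. Re (f s))"
  by (simp add: avg_def)

lemma cnj_avg: "cnj (avg F f) = avg F (\<lambda>s. cnj (f s))"
  by (simp add: avg_def scaleR_conv_of_real)

lemma avg_Times: "avg (F \<times> F') (\<lambda>(s, t). f s * g t) = avg F f * avg F' g" for f :: "'s \<Rightarrow> real"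
  by (simp add: avg_def sum_product sum.cartesian_product card_cartesian_product)

lemma pairing_avg: "pairing (\<lambda>x. avg F (f x)) c = avg F (\<lambda>s. pairing (\<lambda>x. f x s) c)"
  by (induction c) (auto simp: avg_add avg_mult_left, simp add: avg_def)

lemma pairing_mult_right: "pairing (\<lambda>x. f x * z) c = pairing f c * z"
  by (induction c) (auto simp: algebra_simps)

lemma pairing_mult_left: "pairing (\<lambda>x. z * f x) c = z * pairing f c"
  by (induction c) (auto simp: algebra_simps)

text \<open>At each stage the quadratic form is an average of \<open>(cmod (z s))\<^sup>2\<close>,
  where \<open>z s\<close> combines the values \<open>\<theta> x s\<close>; nonnegativity survives
  the limit.\<close>

lemma pd_kernel_of_averages:
  fixes \<kappa> :: "'i \<Rightarrow> 'i \<Rightarrow> real"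
  assumes lim: "\<And>x y. \<lbrakk>x \<in> X; y \<in> X\<rbrakk> \<Longrightarrow> (\<lambda>n. avg (\<Omega> n) (\<lambda>s. \<theta> x s * \<theta> y s)) \<longlonglongrightarrow> \<kappa> x y"
  shows "pd_kernel X (\<lambda>x y. of_real (\<kappa> x y))"
proof
  fix x y assume "x \<in> X" "y \<in> X"
  then have "\<kappa> y x = \<kappa> x y"
    using lim[of x y] lim[of y x] by (auto simp: mult.commute intro: LIMSEQ_unique)
  then show "of_real (\<kappa> y x) = cnj (of_real (\<kappa> x y))" by simp
next
  fix c :: "('i \<times> complex) list"
  assume c: "fst ` set c \<subseteq> X"
  let ?k = "\<lambda>n y x. of_real (avg (\<Omega> n) (\<lambda>s. \<theta> y s * \<theta> x s)) :: complex"
  have "(\<lambda>n. Re (pairing (\<lambda>y. cnj (pairing (?k n y) c)) c))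
      \<longlonglongrightarrow> Re (pairing (\<lambda>y. cnj (pairing (\<lambda>x. of_real (\<kappa> y x)) c)) c)"
    by (intro tendsto_intros pairing_tendsto lim) (use c in auto)
  moreover have "0 \<le> Re (pairing (\<lambda>y. cnj (pairing (?k n y) c)) c)" for n
  proof -
    define z where "z s = pairing (\<lambda>x. of_real (\<theta> x s)) c" for s
    have "pairing (?k n y) c = avg (\<Omega> n) (\<lambda>s. of_real (\<theta> y s) * z s)" for y
      unfolding avg_of_real[symmetric] pairing_avg z_def
      by (intro avg_cong) (simp add: mult.commute[of "of_real (\<theta> y _)"] pairing_mult_right[symmetric])
    then have "pairing (\<lambda>y. cnj (pairing (?k n y) c)) c = avg (\<Omega> n) (\<lambda>s. z s * cnj (z s))"
      by (simp add: cnj_avg pairing_avg pairing_mult_right z_def)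
    also have "\<dots> = avg (\<Omega> n) (\<lambda>s. of_real ((cmod (z s))\<^sup>2))"
      by (simp only: complex_norm_square)
    also have "\<dots> = of_real (avg (\<Omega> n) (\<lambda>s. (cmod (z s))\<^sup>2))" by (rule avg_of_real)
    finally show ?thesis by (simp add: avg_def sum_nonneg)
  qed
  ultimately show "0 \<le> Re (pairing (\<lambda>y. cnj (pairing (\<lambda>x. of_real (\<kappa> y x)) c)) c)"
    by (intro LIMSEQ_le_const) auto
qed

context pd_rep
begin

text \<open>\<open>rep\<close> has the type over which \<open>ergodic_seq\<close> quantifies, so
  ergodicity applies to it. Much of the proof shows that the fixed vectors are closed and hence have
  a projection, which gives meaning to the definite description in \<open>orth_proj\<close>.\<close>

lemma ergodic_limit:
  assumes T: "ergodic_seq G T" and g: "g \<in> carrier G"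
  obtains p where "p \<in> H" "\<And>b. b \<in> carrier G \<Longrightarrow> shift b p = p"
    "\<And>w. w \<in> H \<Longrightarrow> (\<lambda>n. avg (T n) (\<lambda>a. hip (kvec (a \<otimes> g, m)) w)) \<longlonglongrightarrow> hip p w"
proof -
  let ?M = "fixed_vecs G rep" and ?u = "kvec (g, m)"
  have u: "?u \<in> H" using g by simp
  have M: "cfun.subspace ?M" "?M \<subseteq> H"
    using R.act_closed by (auto simp: cfun.subspace_def fixed_vecs_def shift_add shift_cscale)
      (auto simp: shift_def fun_eq_iff)
  obtain p where p: "p \<in> ?M" "\<And>w. w \<in> ?M \<Longrightarrow> hip (?u - p) w = 0"
  proof (rule projection_exists[OF M u])
    fix x l assume x: "\<And>n. x n \<in> ?M" and l: "l \<in> H" and lim: "(\<lambda>n. nrm (x n - l)) \<longlonglongrightarrow> 0"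
    have "shift b l = l" if b: "b \<in> carrier G" for b
    proof -
      have xH: "x n \<in> H" for n using x M by blast
      have "nrm (shift b l - l) \<le> 2 * nrm (x n - l)" for n
      proof -
        have "nrm (shift b l - l) \<le> nrm (shift b l - x n) + nrm (x n - l)"
          using xH l b by (intro nrm_diff_triangle) (auto simp: shift_in_H)
        moreover have "shift b l - x n = shift b (l - x n)"
          using x[of n] b l xH by (simp add: R.act_diff fixed_vecs_def)
        moreover have "nrm (shift b (l - x n)) = nrm (x n - l)"
          using xH l b by (simp add: nrm_shift nrm_minus_commute)
        ultimately show ?thesis by simp
      qed
      then have "nrm (shift b l - l) \<le> 2 * 0"
        by (intro LIMSEQ_le_const[OF tendsto_mult_left[OF lim]]) auto
      then have "nrm (shift b l - l) = 0" using l b by (simp add: shift_in_H order_antisym)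
      then show ?thesis using l b by (simp add: nrm_eq_0_iff shift_in_H)
    qed
    with l show "l \<in> ?M" by (simp add: fixed_vecs_def)
  qed blast
  have proj: "orth_proj hip ?M ?u = p" using p by (intro orth_proj_eqI M u)
  have "weakly_converges H hip (\<lambda>n. cscale (1 / of_nat (card (T n))) (\<Sum>a\<in>T n. shift a ?u)) p"
    using T u unitary_rep_rep unfolding ergodic_seq_def proj[symmetric] by force
  moreover have "hip (cscale (1 / of_nat (card (T n))) (\<Sum>a\<in>T n. shift a ?u)) w
      = avg (T n) (\<lambda>a. hip (kvec (a \<otimes> g, m)) w)" if w: "w \<in> H" for w n
  proof -
    have Tn: "a \<in> carrier G" if "a \<in> T n" for a
      using T that by (auto simp: ergodic_seq_def finite_subset_seq_def)
    have "hip (\<Sum>a\<in>T n. shift a ?u) w = (\<Sum>a\<in>T n. hip (shift a ?u) w)"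
      using Tn u w by (intro ip_sum_left) (auto simp: shift_in_H)
    moreover have "(\<Sum>a\<in>T n. shift a ?u) \<in> H"
      using Tn u by (intro V_sum) (auto simp: shift_in_H)
    moreover have "shift a ?u = kvec (a \<otimes> g, m)" if "a \<in> T n" for a
      using Tn[OF that] g by (rule shift_kvec)
    ultimately show ?thesis
      using w by (simp add: ip_scale avg_def scaleR_conv_of_real)
  qed
  ultimately have "\<And>w. w \<in> H \<Longrightarrow> (\<lambda>n. avg (T n) (\<lambda>a. hip (kvec (a \<otimes> g, m)) w)) \<longlonglongrightarrow> hip p w"
    by (simp add: weakly_converges_def)
  then show ?thesis using that[of p] p(1) by (auto simp: fixed_vecs_def)
qed

end

text \<open>The sample sets \<Omega> have an arbitrary element type so that the tensor square,
  sampled over \<open>\<Omega> n \<times> \<Omega> n\<close>, is an instance of the same locale and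
  ergodicity applies to it too.\<close>

locale average_kernel = group G
  for G :: "('g, 'm) monoid_scheme" (structure) +
  fixes \<Omega> :: "nat \<Rightarrow> 's set" and \<theta> :: "'g \<times> nat \<Rightarrow> 's \<Rightarrow> real" and \<kappa> :: "'g \<times> nat \<Rightarrow> 'g \<times> nat \<Rightarrow> real"
  assumes countable_G: "countable (carrier G)"
    and \<kappa>_limit: "\<lbrakk>x \<in> carrier G \<times> UNIV; y \<in> carrier G \<times> UNIV\<rbrakk>
      \<Longrightarrow> (\<lambda>n. avg (\<Omega> n) (\<lambda>s. \<theta> x s * \<theta> y s)) \<longlonglongrightarrow> \<kappa> x y"
    and \<kappa>_invariant: "\<lbrakk>b \<in> carrier G; g \<in> carrier G; h \<in> carrier G\<rbrakk>
      \<Longrightarrow> \<kappa> (b \<otimes> g, m) (b \<otimes> h, n) = \<kappa> (g, m) (h, n)"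
begin

abbreviation k :: "'g \<times> nat \<Rightarrow> 'g \<times> nat \<Rightarrow> complex" where "k x y \<equiv> of_real (\<kappa> x y)"

sublocale pd_rep G k
proof -
  interpret pd_kernel "carrier G \<times> UNIV" k
    by (rule pd_kernel_of_averages[where \<Omega> = \<Omega> and \<theta> = \<theta>]) (rule \<kappa>_limit)
  show "pd_rep G k" by unfold_locales (simp add: \<kappa>_invariant)
qed

lemma \<kappa>_commute: "x \<in> carrier G \<times> UNIV \<Longrightarrow> y \<in> carrier G \<times> UNIV \<Longrightarrow> \<kappa> x y = \<kappa> y x"
  using k_cnj[of x y] by simp

text \<open>
  The diagonal action on pairs of indices is free, so pairs of indices can be coded as indices:
  \<open>((g, m), (g c\<^sub>i, m'))\<close> corresponds to \<open>g\<close> together with a code for \<open>(m, i, m')\<close>, where \<open>c\<close>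
  enumerates the group.
\<close>

definition dec1 :: "'g \<times> nat \<Rightarrow> 'g \<times> nat"
  where "dec1 = (\<lambda>(g, n). (g, fst (prod_decode n)))"

definition dec2 :: "'g \<times> nat \<Rightarrow> 'g \<times> nat"
  where "dec2 = (\<lambda>(g, n). let (i, m) = prod_decode (snd (prod_decode n))
    in (g \<otimes> from_nat_into (carrier G) i, m))"

definition enc :: "'g \<times> nat \<Rightarrow> 'g \<times> nat \<Rightarrow> 'g \<times> nat"
  where "enc x y = (fst x, prod_encode (snd x, prod_encode (to_nat_on (carrier G) (inv (fst x) \<otimes> fst y), snd y)))"

lemma dec_enc:
  assumes "x \<in> carrier G \<times> UNIV" "y \<in> carrier G \<times> UNIV"
  shows "dec1 (enc x y) = x" "dec2 (enc x y) = y" "enc x y \<in> carrier G \<times> UNIV"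
  using assms countable_G by (auto simp: dec1_def dec2_def enc_def m_assoc[symmetric])

lemma dec_in: "z \<in> carrier G \<times> UNIV \<Longrightarrow> dec1 z \<in> carrier G \<times> UNIV"
    "z \<in> carrier G \<times> UNIV \<Longrightarrow> dec2 z \<in> carrier G \<times> UNIV"
  using from_nat_into[of "carrier G"] by (auto simp: dec1_def dec2_def split: prod.splits)

lemma enc_shift: "\<lbrakk>b \<in> carrier G; g \<in> carrier G; h \<in> carrier G\<rbrakk>
  \<Longrightarrow> enc (b \<otimes> g, m) (b \<otimes> h, n) = (b \<otimes> g, snd (enc (g, m) (h, n)))"
  by (simp add: enc_def inv_mult_group m_assoc) (simp add: m_assoc[symmetric])

lemma dec_shift: "\<lbrakk>b \<in> carrier G; g \<in> carrier G\<rbrakk>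
    \<Longrightarrow> dec1 (b \<otimes> g, n) = (b \<otimes> fst (dec1 (g, n)), snd (dec1 (g, n)))"
  "\<lbrakk>b \<in> carrier G; g \<in> carrier G\<rbrakk>
    \<Longrightarrow> dec2 (b \<otimes> g, n) = (b \<otimes> fst (dec2 (g, n)), snd (dec2 (g, n)))"
  using from_nat_into[of "carrier G"] by (fastforce simp: dec1_def dec2_def m_assoc split: prod.splits)+

text \<open>The kernel of the tensor square: the kernel vector at \<open>z\<close> plays the part of
  the tensor of those at \<open>dec1 z\<close> and \<open>dec2 z\<close>.\<close>

definition \<kappa>2 :: "'g \<times> nat \<Rightarrow> 'g \<times> nat \<Rightarrow> real"
  where "\<kappa>2 z w = \<kappa> (dec1 z) (dec1 w) * \<kappa> (dec2 z) (dec2 w)"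

lemma average_kernel_square:
  "average_kernel G (\<lambda>n. \<Omega> n \<times> \<Omega> n) (\<lambda>z (s, t). \<theta> (dec1 z) s * \<theta> (dec2 z) t) \<kappa>2"
proof
  show "countable (carrier G)" by (rule countable_G)
  fix x y :: "'g \<times> nat"
  assume xy: "x \<in> carrier G \<times> UNIV" "y \<in> carrier G \<times> UNIV"
  have "avg (\<Omega> n \<times> \<Omega> n) (\<lambda>s. (case s of (s, t) \<Rightarrow> \<theta> (dec1 x) s * \<theta> (dec2 x) t) *
      (case s of (s, t) \<Rightarrow> \<theta> (dec1 y) s * \<theta> (dec2 y) t))
    = avg (\<Omega> n) (\<lambda>s. \<theta> (dec1 x) s * \<theta> (dec1 y) s) * avg (\<Omega> n) (\<lambda>s. \<theta> (dec2 x) s * \<theta> (dec2 y) s)" for n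
    unfolding avg_Times[symmetric] by (rule avg_cong) auto
  then show "(\<lambda>n. avg (\<Omega> n \<times> \<Omega> n) (\<lambda>s. (case s of (s, t) \<Rightarrow> \<theta> (dec1 x) s * \<theta> (dec2 x) t) *
      (case s of (s, t) \<Rightarrow> \<theta> (dec1 y) s * \<theta> (dec2 y) t))) \<longlonglongrightarrow> \<kappa>2 x y"
    using xy dec_in by (simp add: \<kappa>2_def tendsto_mult \<kappa>_limit)
next
  fix b g h m n assume "b \<in> carrier G" "g \<in> carrier G" "h \<in> carrier G"
  moreover have "fst (dec1 (g, m)) \<in> carrier G" "fst (dec2 (g, m)) \<in> carrier G" if "g \<in> carrier G" for g m
    using dec_in[of "(g, m)"] that by auto
  ultimately show "\<kappa>2 (b \<otimes> g, m) (b \<otimes> h, n) = \<kappa>2 (g, m) (h, n)"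
    by (simp add: \<kappa>2_def dec_shift \<kappa>_invariant)
qed

text \<open>Stands for the tensor of the conjugate of \<open>comb c\<close> with
  \<open>comb d\<close>. The conjugate on \<open>a\<close> makes pairing a function of the tensor
  square with it sesquilinear in \<open>comb c\<close> and \<open>comb d\<close>, as needed to
  compare vectors of the tensor square with forms.\<close>

definition tensor :: "(('g \<times> nat) \<times> complex) list \<Rightarrow> (('g \<times> nat) \<times> complex) list \<Rightarrow> (('g \<times> nat) \<times> complex) list"
  where "tensor c d = concat (map (\<lambda>(x, a). map (\<lambda>(y, b). (enc x y, cnj a * b)) d) c)"

lemma pairing_tensor: "pairing f (tensor c d) = cnj (pairing (\<lambda>x. cnj (pairing (\<lambda>y. f (enc x y)) d)) c)"
proof (induction c)
  case (Cons p c)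
  have "pairing f (map (\<lambda>(y, b). (enc x y, a * b)) d) = a * pairing (\<lambda>y. f (enc x y)) d" for x a
    by (induction d) (auto simp: algebra_simps)
  then show ?case using Cons by (simp add: tensor_def case_prod_beta)
qed (simp add: tensor_def)

lemma pairing_tensor_eq:
  assumes "L c" "L d"
    and "\<And>x y. \<lbrakk>x \<in> carrier G \<times> UNIV; y \<in> carrier G \<times> UNIV\<rbrakk> \<Longrightarrow> f (enc x y) = g x y"
  shows "pairing f (tensor c d) = cnj (pairing (\<lambda>x. cnj (pairing (g x) d)) c)"
  unfolding pairing_tensor
proof (rule arg_cong[of _ _ cnj], rule pairing_cong, rule arg_cong[of _ _ cnj], rule pairing_cong)
  fix x y assume "x \<in> fst ` set c" "y \<in> fst ` set d"
  then show "f (enc x y) = g x y" using assms(1,2) by (intro assms(3)) blast+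
qed

lemma L_tensor: "L c \<Longrightarrow> L d \<Longrightarrow> L (tensor c d)"
proof
  fix z assume c: "L c" and d: "L d" and "z \<in> fst ` set (tensor c d)"
  then obtain p q where pq: "p \<in> set c" "q \<in> set d" "z = enc (fst p) (fst q)"
    by (auto simp: tensor_def)
  then have "fst p \<in> carrier G \<times> UNIV" "fst q \<in> carrier G \<times> UNIV" using c d by blast+
  then show "z \<in> carrier G \<times> UNIV" unfolding pq by (rule dec_enc)
qed

interpretation S: average_kernel G "\<lambda>n. \<Omega> n \<times> \<Omega> n" "\<lambda>z (s, t). \<theta> (dec1 z) s * \<theta> (dec2 z) t" \<kappa>2
  by (rule average_kernel_square)

lemma qnorm_tensor: "L c \<Longrightarrow> L d \<Longrightarrow> S.qnorm (tensor c d) = qnorm c * qnorm d"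
proof -
  assume c: "L c" and d: "L d"
  have comb2: "S.comb (tensor c d) (enc x y) = cnj (comb c x) * comb d y"
    if "x \<in> carrier G \<times> UNIV" "y \<in> carrier G \<times> UNIV" for x y
  proof -
    have "pairing (\<lambda>z. of_real (\<kappa>2 (enc x y) z)) (tensor c d)
        = cnj (pairing (\<lambda>u. cnj (pairing (\<lambda>v. k x u * k y v) d)) c)"
      by (rule pairing_tensor_eq[OF c d]) (simp add: \<kappa>2_def dec_enc that)
    also have "\<dots> = cnj (pairing (k x) c) * pairing (k y) d"
      by (simp add: pairing_mult_left pairing_mult_right)
    finally show ?thesis using that dec_enc(3)[OF that] by (simp add: S.comb_def comb_def)
  qed
  have "S.gram (tensor c d) (tensor c d)
      = cnj (pairing (\<lambda>x. cnj (pairing (\<lambda>y. cnj (comb c x) * comb d y) d)) c)"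
    unfolding S.gram_def by (rule pairing_tensor_eq[OF c d]) (rule comb2)
  also have "\<dots> = cnj (gram c c) * gram d d"
    by (simp add: pairing_mult_left pairing_mult_right gram_def)
  finally have e: "S.gram (tensor c d) (tensor c d) = cnj (gram c c) * gram d d" .
  have "Im (gram c c) = 0" using arg_cong[OF gram_cnj[OF c c], of Im] by simp
  then show ?thesis by (simp add: qnorm_def S.qnorm_def e)
qed

end

section \<open>Averages of rank one forms\<close>

context inner_space
begin

lemma bounded_form_rank_one:
  assumes "x \<in> V" "y \<in> V"
  shows "bounded_form (\<lambda>u v. ip u x * ip y v) (nrm x * nrm y)"
  unfolding bounded_form_def
proof (intro conjI ballI allI)
  fix u v assume uv: "u \<in> V" "v \<in> V"
  have "cmod (ip u x * ip y v) \<le> (nrm u * nrm x) * (nrm y * nrm v)"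
    unfolding norm_mult using assms uv by (intro mult_mono cauchy_schwarz) auto
  then show "cmod (ip u x * ip y v) \<le> nrm x * nrm y * nrm u * nrm v" by (simp add: mult_ac)
qed (use assms in \<open>simp_all add: ip_add ip_add_right ip_scale ip_scale_right algebra_simps\<close>)

lemma bounded_form_avg:
  assumes F: "finite F" "F \<noteq> {}" and f: "\<And>a. a \<in> F \<Longrightarrow> bounded_form (f a) C"
  shows "bounded_form (\<lambda>u v. avg F (\<lambda>a. f a u v)) C"
  unfolding bounded_form_def
proof (intro conjI ballI allI)
  fix u v w assume uv: "u \<in> V" "v \<in> V" "w \<in> V"
  show "avg F (\<lambda>a. f a (u + v) w) = avg F (\<lambda>a. f a u w) + avg F (\<lambda>a. f a v w)"
    "avg F (\<lambda>a. f a w (u + v)) = avg F (\<lambda>a. f a w u) + avg F (\<lambda>a. f a w v)"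
    unfolding avg_add[symmetric] using uv by (auto intro!: avg_cong bounded_form_add[OF f])
next
  fix t u v assume uv: "u \<in> V" "v \<in> V"
  show "avg F (\<lambda>a. f a (cscale t u) v) = t * avg F (\<lambda>a. f a u v)"
    "avg F (\<lambda>a. f a u (cscale t v)) = cnj t * avg F (\<lambda>a. f a u v)"
    unfolding avg_mult_left[symmetric] using uv by (auto intro!: avg_cong bounded_form_scale[OF f])
next
  fix u v assume uv: "u \<in> V" "v \<in> V"
  have "cmod (avg F (\<lambda>a. f a u v)) \<le> avg F (\<lambda>a. cmod (f a u v))" by (rule norm_avg_le)
  also have "\<dots> \<le> avg F (\<lambda>a. C * nrm u * nrm v)" using f uv by (intro avg_mono bounded_form_le) auto
  finally show "cmod (avg F (\<lambda>a. f a u v)) \<le> C * nrm u * nrm v" using F by (simp add: avg_const)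
qed

end

context average_kernel
begin

interpretation S: average_kernel G "\<lambda>n. \<Omega> n \<times> \<Omega> n" "\<lambda>z (s, t). \<theta> (dec1 z) s * \<theta> (dec2 z) t" \<kappa>2
  by (rule average_kernel_square)

abbreviation \<xi> :: "'g \<times> nat \<Rightarrow> complex" where "\<xi> \<equiv> kvec (\<one>, 0)"

lemma nrm_kvec: "a \<in> carrier G \<Longrightarrow> nrm (kvec (a, 0)) = nrm \<xi>"
  using nrm_shift[of \<xi> a] by (simp add: shift_kvec)

text \<open>The form that corresponds to the vector \<open>S.comb c\<close> of the tensor square
  (\<open>finite_rank_kvec\<close>).\<close>

definition finite_rank :: "(('g \<times> nat) \<times> complex) list \<Rightarrow> ('g \<times> nat \<Rightarrow> complex) \<Rightarrow> ('g \<times> nat \<Rightarrow> complex) \<Rightarrow> complex"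
  where "finite_rank c u v = cnj (pairing (\<lambda>z. cnj (hip u (kvec (dec1 z)) * hip (kvec (dec2 z)) v)) c)"

lemma bounded_form_finite_rank: "L c \<Longrightarrow> \<exists>D\<ge>0. bounded_form (finite_rank c) D"
proof (induction c)
  case Nil
  have "bounded_form (finite_rank []) 0" by (simp add: bounded_form_def finite_rank_def)
  then show ?case by auto
next
  case (Cons p c)
  then obtain D where D: "D \<ge> 0" "bounded_form (finite_rank c) D" by auto
  let ?x = "kvec (dec1 (fst p))" and ?y = "kvec (dec2 (fst p))"
  have xy: "?x \<in> H" "?y \<in> H" using Cons dec_in by auto
  have "finite_rank (p # c) = (\<lambda>u v. cnj (snd p) * (hip u ?x * hip ?y v) + finite_rank c u v)"
    by (simp add: finite_rank_def fun_eq_iff)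
  then show ?case
    using bounded_form_add_scaled[OF bounded_form_rank_one[OF xy] D(2), of "cnj (snd p)"] D(1) xy
    by (intro exI[of _ "cmod (cnj (snd p)) * (nrm ?x * nrm ?y) + D"]) auto
qed

lemma finite_rank_kvec:
  assumes c: "L c" and xy: "x \<in> carrier G \<times> UNIV" "y \<in> carrier G \<times> UNIV"
  shows "finite_rank c (kvec x) (kvec y) = S.comb c (enc x y)"
proof -
  have "pairing (\<lambda>z. cnj (hip (kvec x) (kvec (dec1 z)) * hip (kvec (dec2 z)) (kvec y))) c
      = pairing (\<lambda>z. of_real (\<kappa>2 (enc x y) z)) c"
  proof (rule pairing_cong)
    fix z assume "z \<in> fst ` set c"
    then have z: "z \<in> carrier G \<times> UNIV" using c by blast
    show "cnj (hip (kvec x) (kvec (dec1 z)) * hip (kvec (dec2 z)) (kvec y)) = of_real (\<kappa>2 (enc x y) z)"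
      using xy dec_in[OF z] dec_enc[OF xy] \<kappa>_commute[OF xy(2) dec_in(2)[OF z]]
      by (simp add: hip_kvec \<kappa>2_def)
  qed
  then show ?thesis using dec_enc(3)[OF xy] by (simp add: finite_rank_def S.comb_def)
qed

text \<open>In the tensor square the rank one forms of the vectors \<open>kvec (a, 0)\<close> become
  the translates of one kernel vector. Ergodicity makes their averages converge to an invariant
  vector \<open>P\<close>, whose values are those of \<open>K\<close> on kernel vectors. Invariance
  of \<open>K\<close> is inherited from \<open>P\<close>.\<close>

lemma ergodic_form:
  assumes T: "ergodic_seq G T"
  obtains K where "invariant_form G k K ((nrm \<xi>)\<^sup>2)"
    "\<And>u v. \<lbrakk>u \<in> H; v \<in> H\<rbrakk>
      \<Longrightarrow> (\<lambda>n. avg (T n) (\<lambda>a. hip u (kvec (a, 0)) * hip (kvec (a, 0)) v)) \<longlonglongrightarrow> K u v"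
proof -
  let ?X = "carrier G \<times> (UNIV :: nat set)"
  have Tn: "finite (T n)" "T n \<noteq> {}" "\<And>a. a \<in> T n \<Longrightarrow> a \<in> carrier G" for n
    using T by (auto simp: ergodic_seq_def finite_subset_seq_def)
  define b where "b n u v = avg (T n) (\<lambda>a. hip u (kvec (a, 0)) * hip (kvec (a, 0)) v)" for n u v
  have b_form: "bounded_form (b n) ((nrm \<xi>)\<^sup>2)" for n
    unfolding b_def
  proof (rule bounded_form_avg[OF Tn(1,2)])
    fix a assume "a \<in> T n"
    then have a: "a \<in> carrier G" by (rule Tn)
    show "bounded_form (\<lambda>u v. hip u (kvec (a, 0)) * hip (kvec (a, 0)) v) ((nrm \<xi>)\<^sup>2)"
      using bounded_form_rank_one[of "kvec (a, 0)" "kvec (a, 0)"] a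
      by (simp add: nrm_kvec[OF a] power2_eq_square)
  qed
  \<comment> \<open>By \<open>enc_shift\<close> the index \<open>(a, n0)\<close> encodes the pair of
    \<open>(a, 0)\<close> with itself, so \<open>S.kvec (a, n0)\<close> represents the rank one form
    of \<open>kvec (a, 0)\<close>.\<close>
  define n0 where "n0 = snd (enc (\<one>, 0) (\<one>, 0))"
  obtain P where P: "P \<in> S.H" "\<And>b. b \<in> carrier G \<Longrightarrow> shift b P = P"
    and limP: "\<And>w. w \<in> S.H \<Longrightarrow> (\<lambda>n. avg (T n) (\<lambda>a. S.hip (S.kvec (a \<otimes> \<one>, n0)) w)) \<longlonglongrightarrow> S.hip P w"
    using S.ergodic_limit[OF T, of \<one> n0] by auto
  have P_shift: "P (b \<otimes> g, n) = P (g, n)" if "b \<in> carrier G" "g \<in> carrier G" for b g n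
    using fun_cong[OF P(2)[OF that(1)], of "(b \<otimes> g, n)"] that by (simp add: shift_def m_assoc[symmetric])
  have b_lim: "(\<lambda>n. b n (kvec x) (kvec y)) \<longlonglongrightarrow> P (enc x y)" if xy: "x \<in> ?X" "y \<in> ?X" for x y
  proof -
    have z: "enc x y \<in> ?X" by (rule dec_enc(3)[OF xy])
    have "S.hip (S.kvec (a \<otimes> \<one>, n0)) (S.kvec (enc x y)) = hip (kvec x) (kvec (a, 0)) * hip (kvec (a, 0)) (kvec y)"
      if a: "a \<in> carrier G" for a
    proof -
      have aX: "(a, 0) \<in> ?X" using a by simp
      have e: "enc (a, 0) (a, 0) = (a \<otimes> \<one>, n0)" using enc_shift[OF a, of \<one> \<one> 0 0] a by (simp add: n0_def)
      have "\<kappa>2 (enc (a, 0) (a, 0)) (enc x y) = \<kappa> (a, 0) x * \<kappa> (a, 0) y"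
        by (simp only: \<kappa>2_def dec_enc[OF aX aX] dec_enc[OF xy])
      then show ?thesis
        using a xy z \<kappa>_commute[OF aX xy(1)] by (simp add: e S.hip_kvec hip_kvec)
    qed
    then have "avg (T n) (\<lambda>a. S.hip (S.kvec (a \<otimes> \<one>, n0)) (S.kvec (enc x y))) = b n (kvec x) (kvec y)" for n
      unfolding b_def using Tn(3) by (intro avg_cong) blast
    then show ?thesis using limP[OF S.kvec_in_H[OF z]] z P(1) by (simp add: S.reproducing)
  qed
  obtain K where K: "bounded_form K ((nrm \<xi>)\<^sup>2)"
    and lim: "\<And>u v. \<lbrakk>u \<in> H; v \<in> H\<rbrakk> \<Longrightarrow> (\<lambda>n. b n u v) \<longlonglongrightarrow> K u v"
  proof (rule bounded_form_limit[of b "(nrm \<xi>)\<^sup>2"])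
    show "convergent (\<lambda>n. b n (kvec x) (kvec y))" if "x \<in> ?X" "y \<in> ?X" for x y
      using b_lim[OF that] by (rule convergentI)
  qed (use b_form in auto)
  have K_kvec: "K (kvec x) (kvec y) = P (enc x y)" if "x \<in> ?X" "y \<in> ?X" for x y
    using b_lim[OF that] lim[of "kvec x" "kvec y"] that by (auto intro: LIMSEQ_unique)
  have b_diag: "Re (b n u u) = avg (T n) (\<lambda>a. (cmod (hip (kvec (a, 0)) u))\<^sup>2)" for n u
  proof -
    have "b n u u = avg (T n) (\<lambda>a. of_real ((cmod (hip (kvec (a, 0)) u))\<^sup>2))"
      unfolding b_def complex_norm_square using hip_cnj[of u] by (intro avg_cong) (simp add: mult.commute)
    then show ?thesis by (simp only: avg_of_real Re_complex_of_real)
  qed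
  \<comment> \<open>Finite combinations approximate \<open>P\<close> in norm, and elementary tensors
    have product norms (\<open>qnorm_tensor\<close>). So the forms are approximated uniformly on
    unit vectors, which is where compactness comes from.\<close>
  have approx: "\<exists>c. L c \<and> (\<forall>u\<in>H. \<forall>v\<in>H. cmod (K u v - finite_rank c u v) \<le> \<epsilon> * nrm u * nrm v)"
    if \<epsilon>: "\<epsilon> > 0" for \<epsilon>
  proof -
    obtain c where c: "L c" "S.nrm (P - S.comb c) < \<epsilon>" using S.approx_exists[OF P(1) \<epsilon>] by blast
    obtain D where D: "D \<ge> 0" "bounded_form (finite_rank c) D" using bounded_form_finite_rank[OF c(1)] by blast
    have PH: "P - S.comb c \<in> S.H" using P(1) c(1) by simp
    have "cmod (K u v - finite_rank c u v) \<le> \<epsilon> * nrm u * nrm v" if uv: "u \<in> H" "v \<in> H" for u v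
    proof (rule bounded_form_bound_by_density[OF bounded_form_minus[OF K D(2)] _ _ uv])
      fix c1 d1 assume c1: "L c1" and d1: "L d1"
      have t: "L (tensor c1 d1)" using c1 d1 by (rule L_tensor)
      have "pairing (P - S.comb c) (tensor c1 d1)
          = cnj (pairing (\<lambda>x. cnj (pairing (\<lambda>y. K (kvec x) (kvec y) - finite_rank c (kvec x) (kvec y)) d1)) c1)"
        by (rule pairing_tensor_eq[OF c1 d1]) (simp add: K_kvec finite_rank_kvec[OF c(1)])
      also have "\<dots> = K (comb c1) (comb d1) - finite_rank c (comb c1) (comb d1)"
        by (rule bounded_form_comb[OF bounded_form_minus[OF K D(2)] c1 d1, symmetric])
      finally have "cmod (K (comb c1) (comb d1) - finite_rank c (comb c1) (comb d1))
          \<le> S.nrm (P - S.comb c) * S.nrm (S.comb (tensor c1 d1))"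
        using S.norm_pairing_le[OF PH t] by simp
      also have "\<dots> \<le> \<epsilon> * S.nrm (S.comb (tensor c1 d1))"
        using c t by (intro mult_right_mono) auto
      also have "S.nrm (S.comb (tensor c1 d1)) = nrm (comb c1) * nrm (comb d1)"
      proof -
        have "(S.nrm (S.comb (tensor c1 d1)))\<^sup>2 = (nrm (comb c1) * nrm (comb d1))\<^sup>2"
          using t c1 d1 by (simp add: S.nrm_comb_sq nrm_comb_sq power_mult_distrib qnorm_tensor)
        then show ?thesis using t c1 d1 by (simp add: power2_eq_iff_nonneg)
      qed
      finally show "cmod (K (comb c1) (comb d1) - finite_rank c (comb c1) (comb d1))
          \<le> \<epsilon> * nrm (comb c1) * nrm (comb d1)" by (simp add: mult.assoc)
    qed (use \<epsilon> in simp)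
    with c(1) show ?thesis by blast
  qed
  have "invariant_form G k K ((nrm \<xi>)\<^sup>2)"
  proof
    show "countable (carrier G)" by (rule countable_G)
    show "bounded_form K ((nrm \<xi>)\<^sup>2)" by (rule K)
    show "K v u = cnj (K u v)" if uv: "u \<in> H" "v \<in> H" for u v
    proof (rule LIMSEQ_unique)
      show "(\<lambda>n. b n v u) \<longlonglongrightarrow> K v u" using uv by (intro lim)
      have "b n v u = cnj (b n u v)" for n
        unfolding b_def cnj_avg
        by (intro avg_cong) (simp add: hip_cnj[of u] hip_cnj[of _ v] mult.commute)
      then show "(\<lambda>n. b n v u) \<longlonglongrightarrow> cnj (K u v)" using tendsto_cnj[OF lim[OF uv]] by simp
    qed
    show "K (shift g u) (shift g v) = K u v" if g: "g \<in> carrier G" and uv: "u \<in> H" "v \<in> H" for g u v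
    proof (rule bounded_form_eq_by_density[OF _ K _ uv])
      show "bounded_form (\<lambda>u v. K (shift g u) (shift g v)) ((nrm \<xi>)\<^sup>2)"
        unfolding bounded_form_def shift_add shift_cscale
      proof (intro conjI ballI allI)
        fix u v assume uv: "u \<in> H" "v \<in> H"
        show "cmod (K (shift g u) (shift g v)) \<le> (nrm \<xi>)\<^sup>2 * nrm u * nrm v"
          using bounded_form_le[OF K, of "shift g u" "shift g v"] uv g by (simp add: shift_in_H nrm_shift)
      qed (use g in \<open>simp_all add: shift_in_H bounded_form_add[OF K] bounded_form_scale[OF K]\<close>)
      fix x y assume xy: "x \<in> ?X" "y \<in> ?X"
      obtain h m h' m' where e: "x = (h, m)" "y = (h', m')" by (metis surj_pair)
      have "enc x y = (h, snd (enc x y))" by (simp add: enc_def e)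
      then show "K (shift g (kvec x)) (shift g (kvec y)) = K (kvec x) (kvec y)"
        using g xy e P_shift[OF g, of h "snd (enc x y)"]
        by (simp add: shift_kvec K_kvec enc_shift)
    qed
    \<comment> \<open>Every average satisfies this by Bessel's inequality, as all vectors
      \<open>kvec (a, 0)\<close> have the norm of \<xi>.\<close>
    show "(\<Sum>e\<in>B. Re (K e e)) \<le> (nrm \<xi>)\<^sup>2" if B: "orthonormal B" for B
    proof (rule LIMSEQ_le_const2)
      show "(\<lambda>n. \<Sum>e\<in>B. Re (b n e e)) \<longlonglongrightarrow> (\<Sum>e\<in>B. Re (K e e))"
        using orthonormal_in[OF B] by (intro tendsto_intros lim)
      have "(\<Sum>e\<in>B. Re (b n e e)) \<le> (nrm \<xi>)\<^sup>2" for n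
      proof -
        have "(\<Sum>e\<in>B. Re (b n e e)) = avg (T n) (\<lambda>a. \<Sum>e\<in>B. (cmod (hip (kvec (a, 0)) e))\<^sup>2)"
          by (simp add: b_diag avg_sum)
        also have "\<dots> \<le> avg (T n) (\<lambda>a. (nrm \<xi>)\<^sup>2)"
        proof (rule avg_mono)
          fix a assume "a \<in> T n"
          then have a: "a \<in> carrier G" by (rule Tn)
          then show "(\<Sum>e\<in>B. (cmod (hip (kvec (a, 0)) e))\<^sup>2) \<le> (nrm \<xi>)\<^sup>2"
            using bessel[OF B, of "kvec (a, 0)"] by (simp add: nrm_kvec[OF a])
        qed
        finally show ?thesis using Tn by (simp add: avg_const)
      qed
      then show "\<exists>N. \<forall>n\<ge>N. (\<Sum>e\<in>B. Re (b n e e)) \<le> (nrm \<xi>)\<^sup>2" by blast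
    qed
    fix f :: "nat \<Rightarrow> 'g \<times> nat \<Rightarrow> complex" and g
    assume f: "\<And>n. f n \<in> H" "\<And>n. nrm (f n) \<le> 1" and g: "g \<in> H"
      and weak: "\<And>w. w \<in> H \<Longrightarrow> (\<lambda>n. hip (f n) w) \<longlonglongrightarrow> hip g w"
    have weak': "(\<lambda>n. hip w (f n)) \<longlonglongrightarrow> hip w g" if "w \<in> H" for w
      using tendsto_cnj[OF weak[OF that]] hip_cnj[of w] by simp
    have "(\<lambda>n. K (f n) (f n)) \<longlonglongrightarrow> K g g"
    proof (rule LIMSEQ_I)
      fix r :: real assume r: "r > 0"
      define q where "q = 1 + (nrm g)\<^sup>2"
      \<comment> \<open>The approximation errors at \<open>f n\<close> and at \<open>g\<close> are
        at most \<epsilon> and \<open>\<epsilon> * (nrm g)\<^sup>2\<close>; together they make up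
        one third of \<open>r\<close>.\<close>
      define \<epsilon> where "\<epsilon> = r / (3 * q)"
      have pos: "q > 0" by (simp add: q_def add_pos_nonneg)
      then have \<epsilon>: "\<epsilon> > 0" using r by (simp add: \<epsilon>_def)
      obtain c where c: "L c" "\<And>u v. \<lbrakk>u \<in> H; v \<in> H\<rbrakk> \<Longrightarrow> cmod (K u v - finite_rank c u v) \<le> \<epsilon> * nrm u * nrm v"
        using approx[OF \<epsilon>] by blast
      have "(\<lambda>n. finite_rank c (f n) (f n)) \<longlonglongrightarrow> finite_rank c g g"
        unfolding finite_rank_def
      proof (intro tendsto_cnj pairing_tendsto tendsto_mult weak weak')
        fix z assume "z \<in> fst ` set c"
        then have "z \<in> ?X" using c by blast
        then show "kvec (dec1 z) \<in> H" "kvec (dec2 z) \<in> H" using dec_in by simp_all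
      qed
      then obtain N where N: "\<forall>n\<ge>N. cmod (finite_rank c (f n) (f n) - finite_rank c g g) < r / 3"
        using LIMSEQ_D[of _ "finite_rank c g g" "r / 3"] r by auto
      have "cmod (K (f n) (f n) - K g g) < r" if "n \<ge> N" for n
      proof -
        have 1: "cmod (K (f n) (f n) - finite_rank c (f n) (f n)) \<le> \<epsilon>"
        proof -
          have "\<epsilon> * nrm (f n) * nrm (f n) \<le> \<epsilon> * 1 * 1"
            using f \<epsilon> by (intro mult_mono) auto
          then show ?thesis using c(2)[OF f(1) f(1), of n n] by simp
        qed
        have 2: "cmod (K g g - finite_rank c g g) \<le> \<epsilon> * (nrm g)\<^sup>2"
          using c(2)[OF g g] by (simp add: power2_eq_square mult.assoc)
        have eq: "K (f n) (f n) - K g g = (K (f n) (f n) - finite_rank c (f n) (f n))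
            + (finite_rank c (f n) (f n) - finite_rank c g g) - (K g g - finite_rank c g g)" by simp
        have "cmod (K (f n) (f n) - K g g) \<le> cmod (K (f n) (f n) - finite_rank c (f n) (f n))
            + cmod (finite_rank c (f n) (f n) - finite_rank c g g) + cmod (K g g - finite_rank c g g)"
          unfolding eq by (rule norm_add_diff_le)
        also have "\<dots> < \<epsilon> * q + r / 3"
          using 1 2 N[rule_format, OF that] by (simp add: q_def distrib_left)
        also have "\<epsilon> * q = r / 3" using pos by (simp add: \<epsilon>_def)
        finally show ?thesis using r by simp
      qed
      then show "\<exists>N. \<forall>n\<ge>N. norm (K (f n) (f n) - K g g) < r" by blast
    qed
    then show "(\<lambda>n. Re (K (f n) (f n))) \<longlonglongrightarrow> Re (K g g)" by (rule tendsto_Re)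
  qed
  then show ?thesis using that lim unfolding b_def by blast
qed

end

section \<open>Bohr sets from almost periodic parts\<close>

lemma upper_density_subsequence:
  assumes "upper_density T A = ereal \<alpha>"
  obtains r where "strict_mono r" "(\<lambda>n. avg (T (r n)) (\<lambda>a. of_bool (a \<in> A))) \<longlonglongrightarrow> \<alpha>"
proof -
  define u where "u n = ereal (real (card (A \<inter> T n)) / real (card (T n)))" for n
  obtain r where r: "strict_mono r" "(u \<circ> r) \<longlonglongrightarrow> limsup u"
    using limsup_subseq_lim by blast
  have "avg (T n) (\<lambda>a. of_bool (a \<in> A)) = real (card (A \<inter> T n)) / real (card (T n))" for n
    by (cases "finite (T n)") (simp_all add: avg_def of_bool_def sum.If_cases Int_commute)
  then have "(u \<circ> r) n = ereal (avg (T (r n)) (\<lambda>a. of_bool (a \<in> A)))" for n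
    by (simp add: u_def)
  moreover have "limsup u = ereal \<alpha>" using assms by (simp add: upper_density_def u_def[abs_def])
  ultimately have "(\<lambda>n. ereal (avg (T (r n)) (\<lambda>a. of_bool (a \<in> A)))) \<longlonglongrightarrow> ereal \<alpha>"
    using r(2) by (simp add: o_def)
  then show ?thesis using that[OF r(1)] by simp
qed

lemma avg_cauchy_schwarz:
  fixes f :: "'s \<Rightarrow> real" and h :: "'s \<Rightarrow> complex"
  shows "(cmod (avg F (\<lambda>s. of_real (f s) * h s)))\<^sup>2 \<le> avg F (\<lambda>s. (f s)\<^sup>2) * avg F (\<lambda>s. (cmod (h s))\<^sup>2)"
proof -
  have "(cmod (\<Sum>s\<in>F. of_real (f s) * h s))\<^sup>2 \<le> (\<Sum>s\<in>F. \<bar>f s\<bar> * cmod (h s))\<^sup>2"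
    by (intro power_mono order_trans[OF norm_sum]) (auto simp: norm_mult)
  also have "\<dots> \<le> (\<Sum>s\<in>F. \<bar>f s\<bar>\<^sup>2) * (\<Sum>s\<in>F. (cmod (h s))\<^sup>2)"
    by (rule Cauchy_Schwarz_ineq_sum)
  finally have "(cmod (\<Sum>s\<in>F. of_real (f s) * h s))\<^sup>2 / (real (card F))\<^sup>2
      \<le> (\<Sum>s\<in>F. (f s)\<^sup>2) * (\<Sum>s\<in>F. (cmod (h s))\<^sup>2) / (real (card F))\<^sup>2"
    by (intro divide_right_mono) auto
  then show ?thesis
    by (simp add: avg_def power_mult_distrib power_divide power2_eq_square[of "real (card F)"])
qed

section \<open>Correlations weighted by a set of positive density\<close>

context average_kernel
begin

lemma hip_weighted_sum:
  fixes f :: "'g \<Rightarrow> real"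
  assumes F: "\<And>a. a \<in> F \<Longrightarrow> a \<in> carrier G" and w: "w \<in> H"
  defines "\<eta> \<equiv> (\<Sum>a\<in>F. cscale (of_real (f a / real (card F))) (kvec (a, 0)))"
  shows "\<eta> \<in> H" "hip \<eta> w = avg F (\<lambda>a. of_real (f a) * hip (kvec (a, 0)) w)"
proof -
  show "\<eta> \<in> H" unfolding \<eta>_def using F by (intro V_sum V_scale kvec_in_H) auto
  have "hip \<eta> w = (\<Sum>a\<in>F. hip (cscale (of_real (f a / real (card F))) (kvec (a, 0))) w)"
    unfolding \<eta>_def using F w by (intro ip_sum_left V_scale kvec_in_H) auto
  also have "\<dots> = (\<Sum>a\<in>F. of_real (f a) * hip (kvec (a, 0)) w / of_nat (card F))"
    using F w by (intro sum.cong) (simp_all add: ip_scale)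
  finally show "hip \<eta> w = avg F (\<lambda>a. of_real (f a) * hip (kvec (a, 0)) w)"
    by (simp add: avg_def scaleR_conv_of_real sum_divide_distrib)
qed

lemma weighted_average_le:
  assumes F: "finite F" "F \<noteq> {}" "\<And>a. a \<in> F \<Longrightarrow> a \<in> carrier G" and w: "w \<in> H"
    and f: "\<And>a. a \<in> F \<Longrightarrow> 0 \<le> f a"
  shows "cmod (avg F (\<lambda>a. of_real (f a) * hip (kvec (a, 0)) w)) \<le> avg F f * (nrm \<xi> * nrm w)"
proof -
  have "cmod (avg F (\<lambda>a. of_real (f a) * hip (kvec (a, 0)) w))
      \<le> avg F (\<lambda>a. cmod (of_real (f a) * hip (kvec (a, 0)) w))" by (rule norm_avg_le)
  also have "\<dots> \<le> avg F (\<lambda>a. (nrm \<xi> * nrm w) * f a)"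
  proof (rule avg_mono)
    fix a assume a: "a \<in> F"
    have "cmod (hip (kvec (a, 0)) w) \<le> nrm \<xi> * nrm w"
      using cauchy_schwarz[of "kvec (a, 0)" w] F(3)[OF a] w nrm_kvec[OF F(3)[OF a]] by simp
    then show "cmod (of_real (f a) * hip (kvec (a, 0)) w) \<le> (nrm \<xi> * nrm w) * f a"
      using mult_left_mono[OF _ f[OF a]] f[OF a] by (simp add: norm_mult mult.commute[of _ "f a"])
  qed
  also have "\<dots> = avg F f * (nrm \<xi> * nrm w)" unfolding avg_mult_left by (rule mult.commute)
  finally show ?thesis .
qed

text \<open>The index \<open>(\<one>, 1)\<close> stands for the constant function 1: the assumptions
  on \<kappa> say that it is a unit vector against which every translate of \<xi> has mean \<beta>0.
  All that is concluded about translates by the Bohr set is a positive correlation, which will force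
  two translates of a set to meet.\<close>

lemma bohr_estimate:
  assumes T: "ergodic_seq G T" and A: "A \<subseteq> carrier G" "upper_density T A = ereal \<alpha>" "\<alpha> > 0"
    and \<beta>0: "\<kappa> (\<one>, 0) (\<one>, 0) = \<beta>0" "\<And>g. g \<in> carrier G \<Longrightarrow> \<kappa> (g, 0) (\<one>, 1) = \<beta>0" "\<kappa> (\<one>, 1) (\<one>, 1) = 1"
    and \<beta>: "0 < \<beta>" "\<beta>0 \<le> \<beta>" "99 / 100 * \<beta> \<le> \<beta>0"
  obtains a0 and \<R> :: "'g rep set" where "a0 \<in> A" "finite \<R>"
    "\<And>\<rho>. \<rho> \<in> \<R> \<Longrightarrow> fd_irrep G \<rho> \<and> \<not> acts_trivially G \<rho>"
    "real (\<Sum>\<rho>\<in>\<R>. rep_dim \<rho>) * (\<alpha>\<^sup>2 * \<beta>\<^sup>2) \<le> 25 / 2 * (1 - \<alpha>\<^sup>2)" "\<alpha> \<le> 1"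
    "\<And>\<gamma>. \<lbrakk>\<gamma> \<in> carrier G; \<forall>\<rho>\<in>\<R>. rep_seminorm \<rho> \<gamma> < \<beta> / 2\<rbrakk> \<Longrightarrow> \<exists>a\<in>A. 0 < \<kappa> (a, 0) (a0 \<otimes> \<gamma>, 0)"
proof -
  let ?X = "carrier G \<times> (UNIV :: nat set)"
  have Tn: "finite (T n)" "T n \<noteq> {}" "\<And>a. a \<in> T n \<Longrightarrow> a \<in> carrier G" for n
    using T by (auto simp: ergodic_seq_def finite_subset_seq_def)
  have \<beta>0_pos: "\<beta>0 > 0" using \<beta> by linarith
  have \<xi>: "\<xi> \<in> H" "(nrm \<xi>)\<^sup>2 = \<beta>0" by (simp_all add: nrm_sq hip_kvec \<beta>0)
  define ind :: "'g \<Rightarrow> real" where "ind = (\<lambda>a. of_bool (a \<in> A))"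
  have ind01: "0 \<le> ind a" "ind a \<le> 1" "(ind a)\<^sup>2 = ind a" for a by (auto simp: ind_def)
  obtain r0 where r0: "strict_mono r0" "(\<lambda>n. avg (T (r0 n)) ind) \<longlonglongrightarrow> \<alpha>"
    using upper_density_subsequence[OF A(2)] unfolding ind_def by blast
  have avg_ind_le: "avg (T n) ind \<le> 1" for n
    using avg_mono[of "T n" ind "\<lambda>_. 1"] ind01 Tn by (simp add: avg_const)
  have \<alpha>1: "\<alpha> \<le> 1" using avg_ind_le by (intro LIMSEQ_le_const2[OF r0(2)]) auto
  define eta where "eta n = (\<Sum>a\<in>T n. cscale (of_real (ind a / real (card (T n)))) (kvec (a, 0)))" for n
  have eta_H: "eta n \<in> H" for n
    unfolding eta_def by (rule hip_weighted_sum(1)[OF Tn(3) \<xi>(1)])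
  have hip_eta: "hip (eta n) w = avg (T n) (\<lambda>a. of_real (ind a) * hip (kvec (a, 0)) w)" if "w \<in> H" for n w
    unfolding eta_def by (rule hip_weighted_sum(2)[OF Tn(3) that])
  have hip_eta_le: "cmod (hip (eta n) w) \<le> avg (T n) ind * (nrm \<xi> * nrm w)" if "w \<in> H" for n w
    unfolding hip_eta[OF that] using Tn ind01 that by (intro weighted_average_le)
  have eta_le: "nrm (eta n) \<le> nrm \<xi>" for n
  proof -
    have "(nrm (eta n))\<^sup>2 \<le> avg (T n) ind * (nrm \<xi> * nrm (eta n))"
      using hip_eta_le[OF eta_H, of n n] eta_H by (simp add: ip_self norm_power)
    also have "\<dots> \<le> 1 * (nrm \<xi> * nrm (eta n))"
      using avg_ind_le \<xi> eta_H by (intro mult_right_mono) auto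
    finally have "nrm (eta n) * nrm (eta n) \<le> nrm \<xi> * nrm (eta n)" by (simp add: power2_eq_square)
    then show ?thesis using eta_H[of n] \<xi>(1) by (cases "nrm (eta n) = 0") (auto simp: less_le)
  qed
  have cX: "countable ?X" using countable_G by simp
  obtain r1 \<eta> where r1: "strict_mono r1" and \<eta>: "\<eta> \<in> H"
    and lim_eta: "\<And>w. w \<in> H \<Longrightarrow> (\<lambda>n. hip (eta (r0 (r1 n))) w) \<longlonglongrightarrow> hip \<eta> w"
    using weak_subsequence[OF cX, of "\<lambda>n. eta (r0 n)" "nrm \<xi>"] eta_H eta_le by metis
  define r where "r = r0 \<circ> r1"
  have r: "strict_mono r" unfolding r_def using r0(1) r1 by (rule strict_mono_o)
  have lim_ind: "(\<lambda>n. avg (T (r n)) ind) \<longlonglongrightarrow> \<alpha>"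
    using LIMSEQ_subseq_LIMSEQ[OF r0(2) r1] by (simp add: r_def o_def)
  have lim_\<eta>: "(\<lambda>n. avg (T (r n)) (\<lambda>a. of_real (ind a) * hip (kvec (a, 0)) w)) \<longlonglongrightarrow> hip \<eta> w"
    if "w \<in> H" for w
    using lim_eta[OF that] hip_eta[OF that] by (simp add: r_def)
  have \<eta>_le: "cmod (hip \<eta> w) \<le> \<alpha> * (nrm \<xi> * nrm w)" if w: "w \<in> H" for w
  proof (rule LIMSEQ_le)
    show "(\<lambda>n. cmod (hip (eta (r n)) w)) \<longlonglongrightarrow> cmod (hip \<eta> w)"
      using lim_eta[OF w] by (auto simp: r_def intro: tendsto_norm)
    show "(\<lambda>n. avg (T (r n)) ind * (nrm \<xi> * nrm w)) \<longlonglongrightarrow> \<alpha> * (nrm \<xi> * nrm w)"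
      by (intro tendsto_intros lim_ind)
  qed (use hip_eta_le[OF w] in blast)
  \<comment> \<open>The unit vector \<open>kvec (\<one>, 1)\<close> has inner product
    \<open>\<beta>0 * \<alpha>\<close> with \<eta>, whose norm is therefore at least that
    large.\<close>
  have \<eta>_ge: "(\<alpha> * \<beta>0)\<^sup>2 \<le> (nrm \<eta>)\<^sup>2"
  proof -
    have u: "kvec (\<one>, 1) \<in> H" by simp
    have "avg (T n) (\<lambda>a. of_real (ind a) * hip (kvec (a, 0)) (kvec (\<one>, 1)))
        = of_real (\<beta>0 * avg (T n) ind)" for n
      unfolding avg_mult_left[symmetric] avg_of_real[symmetric]
      using Tn(3) by (intro avg_cong) (simp add: hip_kvec \<beta>0(2)[unfolded One_nat_def] mult.commute)
    then have "(\<lambda>n. of_real (\<beta>0 * avg (T (r n)) ind)) \<longlonglongrightarrow> hip \<eta> (kvec (\<one>, 1))"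
      using lim_\<eta>[OF u] by simp
    moreover have "(\<lambda>n. of_real (\<beta>0 * avg (T (r n)) ind) :: complex) \<longlonglongrightarrow> of_real (\<beta>0 * \<alpha>)"
      by (intro tendsto_intros lim_ind)
    ultimately have e: "hip \<eta> (kvec (\<one>, 1)) = of_real (\<beta>0 * \<alpha>)" by (rule LIMSEQ_unique)
    have "nrm (kvec (\<one>, 1)) = 1"
      using \<beta>0(3) hip_kvec[of "(\<one>, 1)" "(\<one>, 1)"] by (simp add: ip_norm_def)
    then have "\<beta>0 * \<alpha> \<le> nrm \<eta>"
      using cauchy_schwarz[OF \<eta> u] A(3) \<beta>0_pos unfolding e by (simp add: norm_mult)
    then show ?thesis using A(3) \<beta>0_pos by (intro power_mono) (simp_all add: mult.commute)
  qed
  \<comment> \<open>\<open>(nrm \<eta>)\<^sup>2\<close> is a limit of averages, weighted by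
    \<open>ind\<close>, of \<open>Re (hip (kvec (a, 0)) \<eta>)\<close>. If all values on
    \<open>A\<close> stayed below the threshold, it could not reach
    \<open>(\<alpha> * \<beta>0)\<^sup>2\<close>.\<close>
  have "\<exists>a0\<in>A. 98 / 100 * (\<alpha> * \<beta>0\<^sup>2) < Re (hip (kvec (a0, 0)) \<eta>)"
  proof (rule ccontr)
    let ?c = "98 / 100 * (\<alpha> * \<beta>0\<^sup>2)"
    assume "\<not> ?thesis"
    then have le: "Re (hip (kvec (a, 0)) \<eta>) \<le> ?c" if "a \<in> A" for a
      using that by (auto simp: not_less)
    have "(nrm \<eta>)\<^sup>2 \<le> ?c * \<alpha>"
    proof (rule LIMSEQ_le)
      have "(\<lambda>n. Re (avg (T (r n)) (\<lambda>a. of_real (ind a) * hip (kvec (a, 0)) \<eta>))) \<longlonglongrightarrow> Re (hip \<eta> \<eta>)"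
        by (intro tendsto_intros lim_\<eta> \<eta>)
      then show "(\<lambda>n. avg (T (r n)) (\<lambda>a. ind a * Re (hip (kvec (a, 0)) \<eta>))) \<longlonglongrightarrow> (nrm \<eta>)\<^sup>2"
        by (simp add: Re_avg nrm_sq[OF \<eta>])
      show "(\<lambda>n. ?c * avg (T (r n)) ind) \<longlonglongrightarrow> ?c * \<alpha>" by (intro tendsto_intros lim_ind)
      have "avg (T n) (\<lambda>a. ind a * Re (hip (kvec (a, 0)) \<eta>)) \<le> ?c * avg (T n) ind" for n
        unfolding avg_mult_left[symmetric] by (rule avg_mono) (use le in \<open>auto simp: ind_def\<close>)
      then show "\<exists>N. \<forall>n\<ge>N. avg (T (r n)) (\<lambda>a. ind a * Re (hip (kvec (a, 0)) \<eta>)) \<le> ?c * avg (T (r n)) ind"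
        by blast
    qed
    with \<eta>_ge have "\<alpha>\<^sup>2 * \<beta>0\<^sup>2 \<le> 98 / 100 * (\<alpha>\<^sup>2 * \<beta>0\<^sup>2)"
      by (simp add: power_mult_distrib power2_eq_square mult_ac)
    moreover have "\<alpha>\<^sup>2 * \<beta>0\<^sup>2 > 0" using A(3) \<beta>0_pos by simp
    ultimately show False by linarith
  qed
  then obtain a0 where a0: "a0 \<in> A" "98 / 100 * (\<alpha> * \<beta>0\<^sup>2) < Re (hip (kvec (a0, 0)) \<eta>)"
    by blast
  have a0G: "a0 \<in> carrier G" using a0 A by blast
  obtain p where p: "p \<in> H" "\<And>b. b \<in> carrier G \<Longrightarrow> shift b p = p"
    and lim_p: "\<And>w. w \<in> H \<Longrightarrow> (\<lambda>n. avg (T n) (\<lambda>a. hip (kvec (a \<otimes> \<one>, 0)) w)) \<longlonglongrightarrow> hip p w"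
    using ergodic_limit[OF T, of \<one> 0] by auto
  obtain K where K: "invariant_form G k K ((nrm \<xi>)\<^sup>2)"
    and lim_K: "\<And>u v. \<lbrakk>u \<in> H; v \<in> H\<rbrakk>
      \<Longrightarrow> (\<lambda>n. avg (T n) (\<lambda>a. hip u (kvec (a, 0)) * hip (kvec (a, 0)) v)) \<longlonglongrightarrow> K u v"
    using ergodic_form[OF T] by blast
  interpret K: invariant_form G k K "(nrm \<xi>)\<^sup>2" by (rule K)
  \<comment> \<open>The left side is the limit of the averages of \<open>ind a - \<alpha>\<close>
    against \<open>hip (kvec (a, 0)) w\<close>, and the factor
    \<open>\<alpha> - \<alpha>\<^sup>2\<close> is the limiting variance of
    \<open>ind\<close>.\<close>
  have variance: "(cmod (hip \<eta> w - of_real \<alpha> * hip p w))\<^sup>2 \<le> (\<alpha> - \<alpha>\<^sup>2) * Re (K w w)" if w: "w \<in> H" for w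
  proof (rule LIMSEQ_le)
    have e: "avg (T n) (\<lambda>a. of_real (ind a - \<alpha>) * hip (kvec (a, 0)) w)
        = avg (T n) (\<lambda>a. of_real (ind a) * hip (kvec (a, 0)) w)
          + - of_real \<alpha> * avg (T n) (\<lambda>a. hip (kvec (a \<otimes> \<one>, 0)) w)" for n
      unfolding avg_mult_left[symmetric] avg_add[symmetric]
      using Tn(3) by (intro avg_cong) (simp add: algebra_simps)
    have "(\<lambda>n. avg (T (r n)) (\<lambda>a. of_real (ind a - \<alpha>) * hip (kvec (a, 0)) w))
        \<longlonglongrightarrow> hip \<eta> w + - of_real \<alpha> * hip p w"
      unfolding e using LIMSEQ_subseq_LIMSEQ[OF lim_p[OF w] r]
      by (intro tendsto_intros lim_\<eta> w) (simp add: o_def)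
    then show "(\<lambda>n. (cmod (avg (T (r n)) (\<lambda>a. of_real (ind a - \<alpha>) * hip (kvec (a, 0)) w)))\<^sup>2)
        \<longlonglongrightarrow> (cmod (hip \<eta> w - of_real \<alpha> * hip p w))\<^sup>2" by (auto intro!: tendsto_intros)
    have v: "avg (T n) (\<lambda>a. (ind a - \<alpha>)\<^sup>2) = (1 - 2 * \<alpha>) * avg (T n) ind + \<alpha>\<^sup>2" for n
    proof -
      have "avg (T n) (\<lambda>a. (ind a - \<alpha>)\<^sup>2) = avg (T n) (\<lambda>a. (1 - 2 * \<alpha>) * ind a + \<alpha>\<^sup>2)"
        by (intro avg_cong) (simp add: power2_diff ind01 algebra_simps)
      then show ?thesis using Tn by (simp add: avg_add avg_mult_left avg_const)
    qed
    have "(\<lambda>n. avg (T (r n)) (\<lambda>a. (ind a - \<alpha>)\<^sup>2)) \<longlonglongrightarrow> (1 - 2 * \<alpha>) * \<alpha> + \<alpha>\<^sup>2"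
      unfolding v by (intro tendsto_intros lim_ind)
    moreover have "(1 - 2 * \<alpha>) * \<alpha> + \<alpha>\<^sup>2 = \<alpha> - \<alpha>\<^sup>2" by (simp add: algebra_simps power2_eq_square)
    moreover have "avg (T n) (\<lambda>a. (cmod (hip (kvec (a, 0)) w))\<^sup>2)
        = Re (avg (T n) (\<lambda>a. hip w (kvec (a, 0)) * hip (kvec (a, 0)) w))" for n
    proof -
      have "hip w x * hip x w = of_real ((cmod (hip x w))\<^sup>2)" for x
        unfolding complex_norm_square hip_cnj[of w x] by (rule mult.commute)
      then show ?thesis by (simp add: Re_avg del: of_real_power)
    qed
    moreover have "(\<lambda>n. Re (avg (T (r n)) (\<lambda>a. hip w (kvec (a, 0)) * hip (kvec (a, 0)) w))) \<longlonglongrightarrow> Re (K w w)"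
      using LIMSEQ_subseq_LIMSEQ[OF lim_K[OF w w] r] by (intro tendsto_Re) (simp add: o_def)
    ultimately show "(\<lambda>n. avg (T (r n)) (\<lambda>a. (ind a - \<alpha>)\<^sup>2) * avg (T (r n)) (\<lambda>a. (cmod (hip (kvec (a, 0)) w))\<^sup>2))
        \<longlonglongrightarrow> (\<alpha> - \<alpha>\<^sup>2) * Re (K w w)" by (simp add: tendsto_mult)
  qed (intro exI allI impI avg_cauchy_schwarz)
  obtain B \<R> where c: "K.controlled B \<R>"
    and dims: "real (\<Sum>\<rho>\<in>\<R>. rep_dim \<rho>) * (\<alpha>\<^sup>2 * \<beta>\<^sup>2) \<le> 25 / 2 * (1 - \<alpha>\<^sup>2)"
    and small: "\<And>w. \<lbrakk>w \<in> H; \<forall>e\<in>B. hip w e = 0\<rbrakk> \<Longrightarrow> (\<alpha> - \<alpha>\<^sup>2) * Re (K w w) \<le> \<alpha>\<^sup>2 * \<beta> ^ 3 / 25 * (nrm w)\<^sup>2"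
  \<comment> \<open>For \<alpha> = 1 the variance vanishes and the empty system suffices; the
    threshold chosen in the other case divides by \<open>1 - \<alpha>\<close>.\<close>
  proof (cases "\<alpha> = 1")
    case True
    then show ?thesis using \<beta> by (intro that[OF K.controlled_empty]) auto
  next
    case False
    define \<delta> where "\<delta> = 1 - \<alpha>"
    have \<alpha>: "\<delta> > 0" using False \<alpha>1 by (simp add: \<delta>_def)
    (* A threshold q bounds the dimension by beta0 / q, while the complement of the spectral
       subspace contributes at most 2 sqrt((alpha - alpha^2) q beta) to the error in the last step.
       This q makes the latter 2/5 alpha beta^2; the spectral part contributes 1/2 alpha beta^2. *)
    define q where "q = \<alpha> * \<beta> ^ 3 / (25 * \<delta>)"
    have q: "q > 0" using \<alpha> A(3) \<beta>(1) by (simp add: q_def)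
    obtain B \<R> where c: "K.controlled B \<R>" and card: "q * real (card B) \<le> (nrm \<xi>)\<^sup>2"
      and K_le: "\<And>w. \<lbrakk>w \<in> H; \<forall>e\<in>B. hip w e = 0\<rbrakk> \<Longrightarrow> Re (K w w) \<le> q * (nrm w)\<^sup>2"
      by (rule K.spectral_subspace[OF q]) (rule that; assumption)
    have dim: "(\<Sum>\<rho>\<in>\<R>. rep_dim \<rho>) \<le> card B" using c by (simp add: K.controlled_def)
    show ?thesis
    proof (rule that[OF c])
      have "real (card B) * (\<alpha>\<^sup>2 * \<beta>\<^sup>2) * \<beta> \<le> 25 / 2 * (1 - \<alpha>\<^sup>2) * \<beta>"
      proof -
        have "q * real (card B) * (25 * \<delta> * \<alpha>) \<le> \<beta> * (25 * \<delta> * \<alpha>)"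
          using card \<xi>(2) \<beta>(2) \<alpha> A(3) by (intro mult_right_mono) auto
        also have "q * real (card B) * (25 * \<delta> * \<alpha>) = real (card B) * (\<alpha>\<^sup>2 * \<beta>\<^sup>2) * \<beta>"
          using \<alpha> by (simp add: q_def power2_eq_square power3_eq_cube)
        \<comment> \<open>The two sides differ by
          \<open>25 / 2 * (1 - \<alpha>)\<^sup>2\<close>.\<close>
        also have "25 * \<delta> * \<alpha> \<le> 25 / 2 * (1 - \<alpha>\<^sup>2)"
          using zero_le_power2[of "1 - \<alpha>"] by (simp add: \<delta>_def power2_eq_square algebra_simps)
        finally show ?thesis using \<beta>(1) by (simp add: mult.commute[of \<beta>] mult_right_mono)
      qed
      then have "real (card B) * (\<alpha>\<^sup>2 * \<beta>\<^sup>2) \<le> 25 / 2 * (1 - \<alpha>\<^sup>2)"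
        using \<beta>(1) by (simp only: mult_le_cancel_right_pos)
      moreover have "real (\<Sum>\<rho>\<in>\<R>. rep_dim \<rho>) * (\<alpha>\<^sup>2 * \<beta>\<^sup>2) \<le> real (card B) * (\<alpha>\<^sup>2 * \<beta>\<^sup>2)"
        by (rule mult_right_mono[OF of_nat_mono[OF dim]]) simp
      ultimately show "real (\<Sum>\<rho>\<in>\<R>. rep_dim \<rho>) * (\<alpha>\<^sup>2 * \<beta>\<^sup>2) \<le> 25 / 2 * (1 - \<alpha>\<^sup>2)" by simp
      fix w assume w: "w \<in> H" "\<forall>e\<in>B. hip w e = 0"
      have e: "\<alpha> - \<alpha>\<^sup>2 = \<alpha> * \<delta>" by (simp add: \<delta>_def algebra_simps power2_eq_square)
      have "(\<alpha> - \<alpha>\<^sup>2) * Re (K w w) \<le> (\<alpha> - \<alpha>\<^sup>2) * (q * (nrm w)\<^sup>2)"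
        using K_le[OF w] \<alpha> A(3) unfolding e by (intro mult_left_mono) auto
      also have "\<dots> = \<alpha>\<^sup>2 * \<beta> ^ 3 / 25 * (nrm w)\<^sup>2"
        unfolding e using \<alpha> by (simp add: q_def power2_eq_square)
      finally show "(\<alpha> - \<alpha>\<^sup>2) * Re (K w w) \<le> \<alpha>\<^sup>2 * \<beta> ^ 3 / 25 * (nrm w)\<^sup>2" .
    qed
  qed
  have B: "orthonormal B" "R.invariant (cfun.span B)"
    and \<R>: "finite \<R>" "\<And>\<rho>. \<rho> \<in> \<R> \<Longrightarrow> fd_irrep G \<rho> \<and> \<not> acts_trivially G \<rho>"
    using c by (simp_all add: K.controlled_def)
  have main: "\<exists>a\<in>A. 0 < \<kappa> (a, 0) (a0 \<otimes> \<gamma>, 0)"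
    if \<gamma>: "\<gamma> \<in> carrier G" and le: "\<forall>\<rho>\<in>\<R>. rep_seminorm \<rho> \<gamma> < \<beta> / 2" for \<gamma>
  proof (rule ccontr)
    assume neg: "\<not> ?thesis"
    have x: "(a0 \<otimes> \<gamma>, 0) \<in> ?X" using a0G \<gamma> by simp
    let ?E = "fproj B \<xi>"
    let ?M = "\<xi> - ?E"
    have EM: "?E \<in> H" "?M \<in> H" using B(1) \<xi>(1) by auto
    \<comment> \<open>The displacement from \<open>a0\<close> to
      \<open>a0 \<otimes> \<gamma>\<close> is split: \<open>u\<close> comes from the spectral
      component of \<xi> and is short, \<open>v\<close> comes from the rest and is only nearly
      orthogonal to \<eta>.\<close>
    define u where "u = shift a0 (shift \<gamma> ?E - ?E)"
    define v where "v = shift a0 (shift \<gamma> ?M - ?M)"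
    have uv: "u \<in> H" "v \<in> H" using EM \<gamma> a0G by (simp_all add: u_def v_def shift_in_H)
    have split: "kvec (a0 \<otimes> \<gamma>, 0) = kvec (a0, 0) + (u + v)"
    proof -
      have "u + v = shift a0 ((shift \<gamma> ?E - ?E) + (shift \<gamma> ?M - ?M))"
        unfolding u_def v_def by (rule shift_add[symmetric])
      also have "(shift \<gamma> ?E - ?E) + (shift \<gamma> ?M - ?M) = (shift \<gamma> ?E + shift \<gamma> ?M) - (?E + ?M)"
        by (rule add_diff_add[symmetric])
      also have "?E + ?M = \<xi>" by simp
      also have "shift \<gamma> ?E + shift \<gamma> ?M = shift \<gamma> \<xi>" using shift_add[of \<gamma> ?E ?M] by simp
      also have "shift a0 (shift \<gamma> \<xi> - \<xi>) = kvec (a0 \<otimes> \<gamma>, 0) - kvec (a0, 0)"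
        using \<gamma> a0G by (simp add: R.act_diff shift_in_H shift_kvec)
      finally have e: "u + v = kvec (a0 \<otimes> \<gamma>, 0) - kvec (a0, 0)" .
      show ?thesis unfolding e by (subst add.commute) (rule diff_add_cancel[symmetric])
    qed
    have "nrm u = nrm (shift \<gamma> ?E - ?E)" unfolding u_def using EM \<gamma> a0G by (simp add: nrm_shift shift_in_H)
    also have "\<dots> \<le> \<beta> / 2 * nrm ?E"
      using le \<beta>(1) by (intro K.controlledD[OF c] \<gamma> fproj_in_span[OF B(1)]) (auto intro: less_imp_le)
    also have "\<dots> \<le> \<beta> / 2 * nrm \<xi>" using nrm_fproj_le[OF B(1) \<xi>(1)] \<beta>(1) by (intro mult_left_mono) auto
    finally have nu: "nrm u \<le> \<beta> / 2 * nrm \<xi>" .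
    have "cmod (hip \<eta> u) \<le> \<alpha> * (nrm \<xi> * nrm u)" by (rule \<eta>_le[OF uv(1)])
    also have "\<dots> \<le> \<alpha> * (nrm \<xi> * (\<beta> / 2 * nrm \<xi>))"
      using nu A(3) \<xi> by (intro mult_left_mono) auto
    also have "\<dots> = \<alpha> * \<beta>0 * \<beta> / 2" using \<xi>(2) by (simp add: power2_eq_square algebra_simps)
    also have "\<dots> \<le> \<alpha> * \<beta> * \<beta> / 2"
      using \<beta> A(3) by (intro divide_right_mono mult_right_mono mult_left_mono) auto
    finally have hu: "cmod (hip \<eta> u) \<le> \<alpha> * \<beta>\<^sup>2 / 2" by (simp add: power2_eq_square mult.assoc)
    have Minv: "R.invariant (orth B)" by (rule R.invariant_orth[OF B])
    have "hip ?M e = 0" if "e \<in> B" for e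
      using that by (intro fproj_orth[OF B(1) \<xi>(1)] cfun.span_base)
    then have M: "?M \<in> orth B" using EM by blast
    have "shift \<gamma> ?M - ?M \<in> orth B"
    proof (rule cfun.subspace_diff)
      show "cfun.subspace (orth B)" using Minv by (simp add: R.invariant_def)
      show "shift \<gamma> ?M \<in> orth B"
        using Minv M \<gamma> unfolding R.invariant_def by blast
    qed (rule M)
    then have "v \<in> orth B"
      unfolding v_def using Minv a0G unfolding R.invariant_def by blast
    then have Kv: "(\<alpha> - \<alpha>\<^sup>2) * Re (K v v) \<le> \<alpha>\<^sup>2 * \<beta> ^ 3 / 25 * (nrm v)\<^sup>2" by (intro small) auto
    \<comment> \<open>Displacements are orthogonal to fixed vectors. This removes the mean term from
      \<open>variance\<close>, which then bounds \<open>hip \<eta> v\<close> itself.\<close>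
    have "hip p v = 0"
    proof -
      have "hip p (shift b w) = hip p w" if "b \<in> carrier G" "w \<in> H" for b w
        using hip_shift[of p w b] p that by simp
      then show ?thesis unfolding v_def using EM \<gamma> a0G p(1) by (simp add: shift_in_H ip_diff_right)
    qed
    then have "(cmod (hip \<eta> v))\<^sup>2 \<le> \<alpha>\<^sup>2 * \<beta> ^ 3 / 25 * (nrm v)\<^sup>2" using variance[OF uv(2)] Kv by simp
    also have "\<dots> \<le> \<alpha>\<^sup>2 * \<beta> ^ 3 / 25 * (4 * \<beta>)"
    proof (rule mult_left_mono)
      have "nrm v = nrm (shift \<gamma> ?M - ?M)" unfolding v_def using EM \<gamma> a0G by (simp add: nrm_shift shift_in_H)
      also have "\<dots> \<le> 2 * nrm \<xi>"
        using nrm_diff_le[of "shift \<gamma> ?M" ?M] nrm_diff_fproj_le[OF B(1) \<xi>(1)] EM \<gamma>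
        by (simp add: nrm_shift shift_in_H)
      finally have "(nrm v)\<^sup>2 \<le> (2 * nrm \<xi>)\<^sup>2" using uv by (intro power_mono) auto
      then show "(nrm v)\<^sup>2 \<le> 4 * \<beta>" using \<xi>(2) \<beta>(2) by (simp add: power_mult_distrib)
    qed (use \<beta>(1) in simp)
    also have "\<dots> = (2 / 5 * \<alpha> * \<beta>\<^sup>2)\<^sup>2" by (simp add: power2_eq_square power3_eq_cube)
    finally have hv: "cmod (hip \<eta> v) \<le> 2 / 5 * \<alpha> * \<beta>\<^sup>2" by (rule power2_le_imp_le) (use A(3) in simp)
    have "(99 / 100 * \<beta>)\<^sup>2 \<le> \<beta>0\<^sup>2" using \<beta> by (intro power_mono) auto
    then have "\<alpha> * (99 / 100 * \<beta>)\<^sup>2 \<le> \<alpha> * \<beta>0\<^sup>2" using A(3) by (intro mult_left_mono) auto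
    then have h0: "\<alpha> * \<beta>\<^sup>2 * (9801 / 10000) \<le> \<alpha> * \<beta>0\<^sup>2" by (simp add: power2_eq_square)
    have "Re (hip \<eta> (kvec (a0 \<otimes> \<gamma>, 0))) = Re (hip (kvec (a0, 0)) \<eta>) + Re (hip \<eta> u) + Re (hip \<eta> v)"
      unfolding split using \<eta> uv a0G hip_cnj[of \<eta> "kvec (a0, 0)"] by (simp add: ip_add_right)
    moreover have "Re (hip \<eta> u) \<ge> - cmod (hip \<eta> u)" "Re (hip \<eta> v) \<ge> - cmod (hip \<eta> v)"
      using abs_Re_le_cmod[of "hip \<eta> u"] abs_Re_le_cmod[of "hip \<eta> v"] by linarith+
    moreover have "\<alpha> * \<beta>\<^sup>2 > 0" using A(3) \<beta>(1) by simp
    \<comment> \<open>\<open>98 / 100 * (9801 / 10000)\<close> exceeds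
      \<open>1 / 2 + 2 / 5\<close>.\<close>
    ultimately have pos: "Re (hip \<eta> (kvec (a0 \<otimes> \<gamma>, 0))) > 0" using a0(2) hu hv h0 by simp
    have "Re (hip \<eta> (kvec (a0 \<otimes> \<gamma>, 0))) \<le> 0"
    proof (rule LIMSEQ_le_const2)
      show "(\<lambda>n. Re (avg (T (r n)) (\<lambda>a. of_real (ind a) * hip (kvec (a, 0)) (kvec (a0 \<otimes> \<gamma>, 0)))))
          \<longlonglongrightarrow> Re (hip \<eta> (kvec (a0 \<otimes> \<gamma>, 0)))"
        using x by (intro tendsto_Re lim_\<eta> kvec_in_H)
      have "avg (T n) (\<lambda>a. Re (of_real (ind a) * hip (kvec (a, 0)) (kvec (a0 \<otimes> \<gamma>, 0)))) \<le> avg (T n) (\<lambda>a. 0)" for n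
      proof (rule avg_mono)
        fix a assume "a \<in> T n"
        then have a: "a \<in> carrier G" by (rule Tn)
        show "Re (of_real (ind a) * hip (kvec (a, 0)) (kvec (a0 \<otimes> \<gamma>, 0))) \<le> 0"
        proof (cases "a \<in> A")
          case True
          then show ?thesis using neg a x by (auto simp: hip_kvec ind_def not_less)
        qed (simp add: ind_def)
      qed
      then show "\<exists>N. \<forall>n\<ge>N. Re (avg (T (r n)) (\<lambda>a. of_real (ind a) * hip (kvec (a, 0)) (kvec (a0 \<otimes> \<gamma>, 0)))) \<le> 0"
        by (simp add: Re_avg avg_def)
    qed
    with pos show False by simp
  qed
  show ?thesis by (rule that[OF a0(1) \<R> dims \<alpha>1 main])
qed

end

section \<open>The correlation kernel of a set along a Folner sequence\<close>

context group
begin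

text \<open>Once the symmetric difference is smaller than \<open>F n\<close>, the sets
  \<open>g <# F n\<close> and \<open>F n\<close> meet, so \<open>g\<close> is a quotient of two
  elements of \<open>F n\<close>. Hence countably many finite sets of quotients cover the
  group.\<close>

lemma countable_if_left_folner:
  assumes F: "left_folner G F"
  shows "countable (carrier G)"
proof -
  have Fn: "finite (F n)" "F n \<noteq> {}" "F n \<subseteq> carrier G" for n
    using F by (auto simp: left_folner_def finite_subset_seq_def)
  have "carrier G \<subseteq> (\<Union>n. (\<lambda>(x, y). x \<otimes> inv y) ` (F n \<times> F n))"
  proof
    fix g assume g: "g \<in> carrier G"
    have "(\<lambda>n. real (card (sym_diff (g <# F n) (F n))) / real (card (F n))) \<longlonglongrightarrow> 0"
      using F g by (simp add: left_folner_def)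
    then obtain n where n: "real (card (sym_diff (g <# F n) (F n))) / real (card (F n)) < 1"
      using LIMSEQ_D[of _ "0::real" 1] by fastforce
    have card: "card (F n) > 0" using Fn by (simp add: card_gt_0_iff)
    have "(g <# F n) \<inter> F n \<noteq> {}"
    proof
      assume "(g <# F n) \<inter> F n = {}"
      then have "F n \<subseteq> sym_diff (g <# F n) (F n)" by blast
      moreover have "finite (sym_diff (g <# F n) (F n))" using Fn by (simp add: l_coset_def)
      ultimately have "card (F n) \<le> card (sym_diff (g <# F n) (F n))" by (intro card_mono)
      then show False using n card by simp
    qed
    then obtain x y where xy: "x \<in> F n" "y \<in> F n" "x = g \<otimes> y" by (auto simp: l_coset_def)
    then have "g = x \<otimes> inv y" using g Fn(3)[of n] by (auto simp: m_assoc subset_eq)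
    then show "g \<in> (\<Union>n. (\<lambda>(x, y). x \<otimes> inv y) ` (F n \<times> F n))" using xy by force
  qed
  moreover have "countable ((\<lambda>(x, y). x \<otimes> inv y) ` (F n \<times> F n))" for n
    using Fn(1)[of n] by (intro countable_finite finite_imageI finite_SigmaI)
  then have "countable (\<Union>n. (\<lambda>(x, y). x \<otimes> inv y) ` (F n \<times> F n))" by simp
  ultimately show ?thesis by (rule countable_subset)
qed

lemma l_coset_mem_iff: "\<lbrakk>g \<in> carrier G; s \<in> carrier G; B \<subseteq> carrier G\<rbrakk> \<Longrightarrow> s \<in> g <# B \<longleftrightarrow> inv g \<otimes> s \<in> B"
proof
  assume a: "g \<in> carrier G" "s \<in> carrier G" "B \<subseteq> carrier G"
  show "inv g \<otimes> s \<in> B" if "s \<in> g <# B"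
    using that a by (auto simp: l_coset_def m_assoc[symmetric] subset_eq)
  show "s \<in> g <# B" if "inv g \<otimes> s \<in> B"
    using that a by (force simp: l_coset_def m_assoc[symmetric])
qed

text \<open>
  Index \<open>(g, 0)\<close> stands for the indicator function of \<open>gB\<close>, and \<open>(g, n)\<close> with \<open>n > 0\<close> for the
  constant function \<open>1\<close>.
\<close>

definition translate_indicator :: "'a set \<Rightarrow> 'a \<times> nat \<Rightarrow> 'a \<Rightarrow> real"
  where "translate_indicator B = (\<lambda>(g, n) s. of_bool (n = 0 \<longrightarrow> s \<in> g <# B))"

text \<open>Reindexing turns the translated sum into a sum of \<open>f\<close> over
  \<open>inv b <# F n\<close>, which differs from the sum over \<open>F n\<close> only on the
  symmetric difference, and there \<open>f\<close> is at most 1.\<close>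

lemma avg_translate_null:
  assumes F: "left_folner G F" and b: "b \<in> carrier G"
    and f: "\<And>s. s \<in> carrier G \<Longrightarrow> 0 \<le> f s \<and> f s \<le> (1 :: real)"
  shows "(\<lambda>n. avg (F n) (\<lambda>s. f (inv b \<otimes> s)) - avg (F n) f) \<longlonglongrightarrow> 0"
proof (rule Lim_null_comparison)
  have Fn: "finite (F n)" "F n \<noteq> {}" "F n \<subseteq> carrier G" for n
    using F by (auto simp: left_folner_def finite_subset_seq_def)
  show "(\<lambda>n. real (card (sym_diff (inv b <# F n) (F n))) / real (card (F n))) \<longlonglongrightarrow> 0"
    using F b by (simp add: left_folner_def)
  have "norm (avg (F n) (\<lambda>s. f (inv b \<otimes> s)) - avg (F n) f)
      \<le> real (card (sym_diff (inv b <# F n) (F n))) / real (card (F n))" for n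
  proof -
    let ?E = "inv b <# F n"
    have E: "finite ?E" "?E \<subseteq> carrier G" using Fn[of n] b by (auto simp: l_coset_def)
    have "inj_on (\<lambda>s. inv b \<otimes> s) (F n)" using Fn(3)[of n] b
      by (intro inj_onI) (auto simp: subset_eq)
    then have "(\<Sum>s\<in>F n. f (inv b \<otimes> s)) = sum f ((\<lambda>s. inv b \<otimes> s) ` F n)"
      by (simp add: sum.reindex)
    also have "(\<lambda>s. inv b \<otimes> s) ` F n = ?E" by (auto simp: l_coset_def)
    finally have e: "(\<Sum>s\<in>F n. f (inv b \<otimes> s)) = sum f ?E" .
    have split: "sum f ?E = sum f (?E - F n) + sum f (?E \<inter> F n)" "sum f (F n) = sum f (F n - ?E) + sum f (?E \<inter> F n)"
      using E Fn(1)[of n] sum.Int_Diff[of ?E f "F n"] sum.Int_Diff[of "F n" f ?E]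
      by (simp_all add: Int_commute add.commute)
    have D: "0 \<le> sum f D \<and> sum f D \<le> real (card D)" if "D \<subseteq> carrier G" for D
      using that f sum_mono[of D f "\<lambda>_. 1"] by (auto intro!: sum_nonneg)
    have "?E - F n \<subseteq> carrier G" "F n - ?E \<subseteq> carrier G" using E Fn(3)[of n] by auto
    from this[THEN D] split have "\<bar>sum f ?E - sum f (F n)\<bar> \<le> real (card (?E - F n)) + real (card (F n - ?E))"
      by linarith
    also have "\<dots> = real (card (sym_diff ?E (F n)))"
      using E Fn(1)[of n] by (subst card_Un_disjoint) auto
    finally show ?thesis
      using Fn[of n] by (simp add: avg_def e diff_divide_distrib[symmetric] divide_right_mono)
  qed
  then show "\<forall>\<^sub>F n in sequentially. norm (avg (F n) (\<lambda>s. f (inv b \<otimes> s)) - avg (F n) f)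
      \<le> real (card (sym_diff (inv b <# F n) (F n))) / real (card (F n))" by simp
qed

text \<open>Limits along a subsequence take the place of an invariant mean: only countably many
  correlations occur, so one subsequence makes all of them converge. It is drawn from
  \<open>r0\<close>, along which the upper density is a limit; the Folner property gives
  invariance.\<close>

lemma correlation_kernel:
  assumes F: "left_folner G F" and B: "B \<subseteq> carrier G" and dens: "upper_density F B = ereal \<beta>0"
  obtains r \<kappa> where "average_kernel G (\<lambda>n. F (r n)) (translate_indicator B) \<kappa>"
    "\<kappa> (\<one>, 0) (\<one>, 0) = \<beta>0" "\<And>g. g \<in> carrier G \<Longrightarrow> \<kappa> (g, 0) (\<one>, 1) = \<beta>0" "\<kappa> (\<one>, 1) (\<one>, 1) = 1"
    "\<And>g h. \<lbrakk>g \<in> carrier G; h \<in> carrier G; 0 < \<kappa> (g, 0) (h, 0)\<rbrakk> \<Longrightarrow> (g <# B) \<inter> (h <# B) \<noteq> {}"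
proof -
  let ?X = "carrier G \<times> (UNIV :: nat set)" and ?\<theta> = "translate_indicator B"
  have Fn: "finite (F n)" "F n \<noteq> {}" "F n \<subseteq> carrier G" for n
    using F by (auto simp: left_folner_def finite_subset_seq_def)
  have cG: "countable (carrier G)" by (rule countable_if_left_folner[OF F])
  have \<theta>: "0 \<le> ?\<theta> x s" "?\<theta> x s \<le> 1" for x s by (auto simp: translate_indicator_def split: prod.splits)
  have \<theta>\<theta>: "0 \<le> ?\<theta> x s * ?\<theta> y s \<and> ?\<theta> x s * ?\<theta> y s \<le> 1" for x y s
    using \<theta>[of x s] \<theta>[of y s] by (simp add: mult_le_one)
  obtain r0 where r0: "strict_mono r0" "(\<lambda>n. avg (F (r0 n)) (\<lambda>a. of_bool (a \<in> B))) \<longlonglongrightarrow> \<beta>0"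
    using upper_density_subsequence[OF dens] by blast
  have "norm (avg (F (r0 n)) (\<lambda>s. ?\<theta> x s * ?\<theta> y s)) \<le> 1" for n x y
    using order_trans[OF norm_avg_le[of "F (r0 n)" "\<lambda>s. ?\<theta> x s * ?\<theta> y s"] avg_mono[of "F (r0 n)" _ "\<lambda>_. 1"]] \<theta>\<theta>[of x _ y] Fn[of "r0 n"]
    by (simp add: avg_const abs_le_iff)
  then have bounded: "norm (avg (F (r0 n)) (\<lambda>s. ?\<theta> (fst z) s * ?\<theta> (snd z) s)) \<le> 1" for n z .
  have cX: "countable (?X \<times> ?X)" using cG by simp
  obtain r1 where r1: "strict_mono (r1 :: nat \<Rightarrow> nat)"
    and conv: "\<And>z. z \<in> ?X \<times> ?X \<Longrightarrow> \<exists>l. (\<lambda>n. avg (F (r0 (r1 n))) (\<lambda>s. ?\<theta> (fst z) s * ?\<theta> (snd z) s)) \<longlonglongrightarrow> l"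
    by (rule function_convergent_subsequence[of "?X \<times> ?X"
          "\<lambda>n z. avg (F (r0 n)) (\<lambda>s. ?\<theta> (fst z) s * ?\<theta> (snd z) s)" 1, OF cX bounded])
       (rule that; assumption)
  define r where "r = r0 \<circ> r1"
  define \<kappa> where "\<kappa> x y = lim (\<lambda>n. avg (F (r n)) (\<lambda>s. ?\<theta> x s * ?\<theta> y s))" for x y
  have lim: "(\<lambda>n. avg (F (r n)) (\<lambda>s. ?\<theta> x s * ?\<theta> y s)) \<longlonglongrightarrow> \<kappa> x y" if "x \<in> ?X" "y \<in> ?X" for x y
    using conv[of "(x, y)"] that
    by (simp add: r_def \<kappa>_def convergent_LIMSEQ_iff[symmetric] convergent_def)
  have r: "strict_mono r" unfolding r_def using r0(1) r1 by (rule strict_mono_o)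
  have F': "left_folner G (\<lambda>n. F (r n))"
    using F LIMSEQ_subseq_LIMSEQ[OF _ r] by (fastforce simp: left_folner_def finite_subset_seq_def o_def)
  have avgB: "(\<lambda>n. avg (F (r n)) (\<lambda>a. of_bool (a \<in> B))) \<longlonglongrightarrow> \<beta>0"
    using LIMSEQ_subseq_LIMSEQ[OF r0(2) r1] by (simp add: r_def o_def)
  have oneB: "\<one> <# B = B" using B by (force simp: l_coset_def)
  have inv_\<theta>: "?\<theta> (b \<otimes> g, m) s = ?\<theta> (g, m) (inv b \<otimes> s)"
    if "b \<in> carrier G" "g \<in> carrier G" "s \<in> carrier G" for b g m s
    using that B by (simp add: translate_indicator_def l_coset_mem_iff inv_mult_group m_assoc)
  have inv: "\<kappa> (b \<otimes> g, m) (b \<otimes> h, n) = \<kappa> (g, m) (h, n)"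
    if b: "b \<in> carrier G" and g: "g \<in> carrier G" and h: "h \<in> carrier G" for b g h m n
  proof (rule LIMSEQ_unique)
    let ?f = "\<lambda>s. ?\<theta> (g, m) s * ?\<theta> (h, n) s"
    show "(\<lambda>i. avg (F (r i)) (\<lambda>s. ?\<theta> (b \<otimes> g, m) s * ?\<theta> (b \<otimes> h, n) s)) \<longlonglongrightarrow> \<kappa> (b \<otimes> g, m) (b \<otimes> h, n)"
      using that by (intro lim) auto
    have "avg (F (r i)) (\<lambda>s. ?\<theta> (b \<otimes> g, m) s * ?\<theta> (b \<otimes> h, n) s) = avg (F (r i)) (\<lambda>s. ?f (inv b \<otimes> s))" for i
      using that Fn(3)[of "r i"] by (intro avg_cong) (auto simp: inv_\<theta>)
    moreover have "(\<lambda>i. (avg (F (r i)) (\<lambda>s. ?f (inv b \<otimes> s)) - avg (F (r i)) ?f) + avg (F (r i)) ?f) \<longlonglongrightarrow> 0 + \<kappa> (g, m) (h, n)"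
      using g h by (intro tendsto_add avg_translate_null[OF F' b] lim \<theta>\<theta>) auto
    ultimately show "(\<lambda>i. avg (F (r i)) (\<lambda>s. ?\<theta> (b \<otimes> g, m) s * ?\<theta> (b \<otimes> h, n) s)) \<longlonglongrightarrow> \<kappa> (g, m) (h, n)"
      by simp
  qed
  have \<theta>0: "?\<theta> (\<one>, 0) s = of_bool (s \<in> B)" and \<theta>1: "?\<theta> (g, Suc n) s = 1" for g n s
    by (simp_all add: translate_indicator_def oneB)
  have \<beta>1: "\<kappa> (\<one>, 0) (g, 1) = \<beta>0" if "g \<in> carrier G" for g
    using lim[of "(\<one>, 0)" "(g, 1)"] that avgB by (auto simp: \<theta>0 \<theta>1 intro: LIMSEQ_unique)
  show ?thesis
  proof (rule that[of r \<kappa>])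
    show "average_kernel G (\<lambda>n. F (r n)) ?\<theta> \<kappa>"
      by unfold_locales (use cG lim inv in auto)
    show "\<kappa> (\<one>, 0) (\<one>, 0) = \<beta>0"
      using lim[of "(\<one>, 0)" "(\<one>, 0)"] avgB
      by (auto simp: \<theta>0 of_bool_conj[symmetric] intro: LIMSEQ_unique)
    show "\<kappa> (g, 0) (\<one>, 1) = \<beta>0" if "g \<in> carrier G" for g
      using inv[of g \<one> "inv g" 0 1] \<beta>1[of "inv g"] that by simp
    show "\<kappa> (\<one>, 1) (\<one>, 1) = 1"
      using lim[of "(\<one>, 1)" "(\<one>, 1)"] Fn by (simp add: \<theta>1 avg_const LIMSEQ_const_iff)
    fix g h assume gh: "g \<in> carrier G" "h \<in> carrier G" and pos: "0 < \<kappa> (g, 0) (h, 0)"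
    show "(g <# B) \<inter> (h <# B) \<noteq> {}"
    proof
      assume "(g <# B) \<inter> (h <# B) = {}"
      then have "?\<theta> (g, 0) s * ?\<theta> (h, 0) s = 0" for s by (auto simp: translate_indicator_def)
      then have "avg (F (r n)) (\<lambda>s. ?\<theta> (g, 0) s * ?\<theta> (h, 0) s) = 0" for n
        by (simp only: avg_def sum.neutral_const scaleR_zero_right)
      then have "(\<lambda>n. 0) \<longlonglongrightarrow> \<kappa> (g, 0) (h, 0)"
        using lim[of "(g, 0)" "(h, 0)"] gh by simp
      then show False using pos by (simp add: LIMSEQ_const_iff)
    qed
  qed
qed

lemma mem_triple_product:
  assumes "A \<subseteq> carrier G" "B \<subseteq> carrier G" "a \<in> A" "h \<in> carrier G" "(a <# B) \<inter> (h <# B) \<noteq> {}"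
  shows "h \<in> A <#> B <#> set_inv B"
proof -
  obtain b b' where b: "b \<in> B" "b' \<in> B" "a \<otimes> b = h \<otimes> b'" using assms by (auto simp: l_coset_def)
  moreover have in_G: "a \<in> carrier G" "b \<in> carrier G" "b' \<in> carrier G" using assms b by auto
  ultimately have "a \<otimes> b \<otimes> inv b' = h" using assms by (simp add: m_assoc)
  moreover have "a \<otimes> b \<otimes> inv b' \<in> A <#> B <#> set_inv B"
    unfolding set_mult_def SET_INV_def using b(1,2) assms(3) by blast
  ultimately show ?thesis by simp
qed

end

section \<open>Classes of irreducible representations\<close>

definition irrep_class :: "('g, 'm) monoid_scheme \<Rightarrow> 'g rep \<Rightarrow> 'g rep set"
  where "irrep_class G \<rho> = {(R, R'). fd_irrep G R \<and> fd_irrep G R' \<and> unitarily_equiv G R R'} `` {\<rho>}"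

lemma mem_irrep_class:
  assumes "fd_irrep G \<rho>" shows "\<rho> \<in> irrep_class G \<rho>"
proof -
  have "unitarily_equiv G \<rho> \<rho>"
    unfolding unitarily_equiv_def by (rule exI[of _ id]) auto
  then show ?thesis using assms by (simp add: irrep_class_def)
qed

lemma irrep_class_in_fd_dual:
  "fd_irrep G \<rho> \<Longrightarrow> \<not> acts_trivially G \<rho> \<Longrightarrow> irrep_class G \<rho> \<in> fd_dual G - {trivial_class G}"
  using mem_irrep_class[of G \<rho>]
    quotientI[of \<rho> "{R. fd_irrep G R}" "{(R, R'). fd_irrep G R \<and> fd_irrep G R' \<and> unitarily_equiv G R R'}"]
  unfolding fd_dual_def irrep_class_def trivial_class_def by blast

lemma rep_dim_pos:
  assumes "unitary_rep G R" "fin_dim R" "\<not> acts_trivially G R"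
  shows "1 \<le> rep_dim R"
proof (rule ccontr)
  interpret unitary_rep G R by (rule assms)
  assume "\<not> ?thesis"
  then have "rep_dim R = 0" by simp
  obtain E where E: "E \<subseteq> vecs R" "cfun.independent E" "vecs R \<subseteq> cfun.span E" "card E = cfun.dim (vecs R)"
    by (rule cfun.basis_exists)
  obtain D where "finite D" "vecs R = cfun.span D" using assms by (auto simp: fin_dim_def)
  \<comment> \<open>An infinite \<open>E\<close> would have \<open>card E = 0\<close> as well, so
    finiteness has to come before \<open>E = {}\<close>.\<close>
  then have "finite E" using cfun.independent_span_bound[of D E] E by auto
  then have "E = {}" using E \<open>rep_dim R = 0\<close> by (simp add: rep_dim_def)
  then have V: "vecs R \<subseteq> {0}" using E by simp
  have "act R g 0 = 0" if "g \<in> carrier G" for g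
    using act_closed[OF that, of 0] V subspace by (auto dest: cfun.subspace_0)
  then show False using assms(3) V by (auto simp: acts_trivially_def)
qed

lemma min_nontrivial_dim_le:
  "\<lbrakk>unitary_rep G \<rho>; fin_dim \<rho>; \<not> acts_trivially G (\<rho> :: 'g rep)\<rbrakk> \<Longrightarrow> min_nontrivial_dim G \<le> enat (rep_dim \<rho>)"
  unfolding min_nontrivial_dim_def by (rule INF_lower) simp

lemma min_nontrivial_dim_ge_1: "1 \<le> min_nontrivial_dim G"
  unfolding min_nontrivial_dim_def by (rule INF_greatest) (auto simp: one_enat_def dest: rep_dim_pos)

theorem theorem1p1:
  fixes G :: "('g, 'm) monoid_scheme" (structure)
    and T :: "nat \<Rightarrow> 'g set"
    and A B :: "'g set"
    and \<alpha> \<beta> :: real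
  assumes "group G"
    and "amenable G"
    and "ergodic_seq G T"
    and "A \<subseteq> carrier G" and "B \<subseteq> carrier G"
    and "upper_density T A = ereal \<alpha>" and "\<alpha> > 0"
    and "upper_banach_density G B = ereal \<beta>" and "\<beta> > 0"
  shows "(\<exists>a\<^sub>o\<in>A. \<exists>S. S \<subseteq> fd_dual G - {trivial_class G} \<and> finite S \<and>
             ereal (real (card S)) \<le> ereal (17 * (1 - \<alpha>\<^sup>2)) /
               (ereal_of_enat (min_nontrivial_dim G) * ereal (\<alpha>\<^sup>2 * \<beta>\<^sup>2)) \<and>
             a\<^sub>o <# bohr_set G S (\<beta> / 2) \<subseteq> A <#> B <#> (set_inv B)) \<and>
         (min_nontrivial_dim G = \<infinity> \<or> \<alpha> = 1 \<longrightarrow> A <#> B <#> (set_inv B) = carrier G)"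
proof -
  interpret group G by fact
  \<comment> \<open>The supremum in the upper Banach density need not be attained, hence a Folner
    sequence that comes within one percent.\<close>
  have "ereal (99 / 100 * \<beta>) < upper_banach_density G B" using assms(8,9) by simp
  then obtain F where F: "left_folner G F" "ereal (99 / 100 * \<beta>) < upper_density F B"
    by (auto simp: upper_banach_density_def less_SUP_iff)
  have le: "upper_density F B \<le> ereal \<beta>"
    unfolding assms(8)[symmetric] upper_banach_density_def using F(1) by (intro SUP_upper) simp
  obtain \<beta>0 where \<beta>0: "upper_density F B = ereal \<beta>0"
    using F(2) le by (cases "upper_density F B") auto
  have \<beta>: "0 < \<beta>" "\<beta>0 \<le> \<beta>" "99 / 100 * \<beta> \<le> \<beta>0" using F(2) le assms(9) by (simp_all add: \<beta>0)
  obtain r \<kappa> where \<kappa>: "average_kernel G (\<lambda>n. F (r n)) (translate_indicator B) \<kappa>"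
    "\<kappa> (\<one>, 0) (\<one>, 0) = \<beta>0" "\<And>g. g \<in> carrier G \<Longrightarrow> \<kappa> (g, 0) (\<one>, 1) = \<beta>0" "\<kappa> (\<one>, 1) (\<one>, 1) = 1"
    and meet: "\<And>g h. \<lbrakk>g \<in> carrier G; h \<in> carrier G; 0 < \<kappa> (g, 0) (h, 0)\<rbrakk> \<Longrightarrow> (g <# B) \<inter> (h <# B) \<noteq> {}"
    by (rule correlation_kernel[OF F(1) assms(5) \<beta>0]) (rule that; assumption)
  interpret K: average_kernel G "\<lambda>n. F (r n)" "translate_indicator B" \<kappa> by (rule \<kappa>)
  obtain a0 and \<R> :: "'g rep set" where a0: "a0 \<in> A" and \<R>: "finite \<R>"
    "\<And>\<rho>. \<rho> \<in> \<R> \<Longrightarrow> fd_irrep G \<rho> \<and> \<not> acts_trivially G \<rho>"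
    and dims: "real (\<Sum>\<rho>\<in>\<R>. rep_dim \<rho>) * (\<alpha>\<^sup>2 * \<beta>\<^sup>2) \<le> 25 / 2 * (1 - \<alpha>\<^sup>2)" and \<alpha>1: "\<alpha> \<le> 1"
    and pos: "\<And>\<gamma>. \<lbrakk>\<gamma> \<in> carrier G; \<forall>\<rho>\<in>\<R>. rep_seminorm \<rho> \<gamma> < \<beta> / 2\<rbrakk> \<Longrightarrow> \<exists>a\<in>A. 0 < \<kappa> (a, 0) (a0 \<otimes> \<gamma>, 0)"
    by (rule K.bohr_estimate[OF assms(3,4,6,7) \<kappa>(2-4) \<beta>]) (assumption, (rule that; assumption))
  have a0G: "a0 \<in> carrier G" using a0 assms(4) by blast
  define S where "S = irrep_class G ` \<R>"
  have S_dual: "S \<subseteq> fd_dual G - {trivial_class G}"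
    unfolding S_def using irrep_class_in_fd_dual \<R>(2) by blast
  have sub: "a0 <# bohr_set G S (\<beta> / 2) \<subseteq> A <#> B <#> set_inv B"
  proof
    fix h assume "h \<in> a0 <# bohr_set G S (\<beta> / 2)"
    then obtain \<gamma> where \<gamma>: "\<gamma> \<in> bohr_set G S (\<beta> / 2)" "h = a0 \<otimes> \<gamma>" by (auto simp: l_coset_def)
    then have \<gamma>G: "\<gamma> \<in> carrier G" by (simp add: bohr_set_def)
    \<comment> \<open>\<open>bohr_set\<close> quantifies over all representatives of a class, so
      \<rho> itself is among them and no invariance of the semi-norm under equivalence
      enters.\<close>
    have "\<forall>\<rho>\<in>\<R>. rep_seminorm \<rho> \<gamma> < \<beta> / 2"
      using \<gamma>(1) mem_irrep_class \<R>(2) unfolding bohr_set_def S_def by blast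
    then obtain a where a: "a \<in> A" "0 < \<kappa> (a, 0) (a0 \<otimes> \<gamma>, 0)" using pos[OF \<gamma>G] by blast
    then have "(a <# B) \<inter> (h <# B) \<noteq> {}"
      unfolding \<gamma>(2) using assms(4) a0G \<gamma>G by (intro meet) auto
    then show "h \<in> A <#> B <#> set_inv B"
      using a(1) assms(4,5) a0G \<gamma>G \<gamma>(2) by (intro mem_triple_product) auto
  qed
  have unirep: "unitary_rep G \<rho>" "fin_dim \<rho>" "\<not> acts_trivially G \<rho>" if "\<rho> \<in> \<R>" for \<rho>
    using \<R>(2)[OF that] by (auto simp: fd_irrep_def)
  \<comment> \<open>If the least dimension is infinite, no representation can be a member; for
    \<alpha> = 1 the total dimension is 0, while each member contributes at least 1.\<close>
  have empty: "\<R> = {}" if "min_nontrivial_dim G = \<infinity> \<or> \<alpha> = 1"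
  proof (rule ccontr)
    assume "\<R> \<noteq> {}"
    then obtain \<rho> where \<rho>: "\<rho> \<in> \<R>" by blast
    have "min_nontrivial_dim G \<noteq> \<infinity>" using min_nontrivial_dim_le[OF unirep[OF \<rho>]]
      by (cases "min_nontrivial_dim G") auto
    then have "\<alpha> = 1" using that by metis
    then have "real (\<Sum>\<rho>\<in>\<R>. rep_dim \<rho>) * \<beta>\<^sup>2 \<le> 0" using dims by simp
    then have "(\<Sum>\<rho>\<in>\<R>. rep_dim \<rho>) = 0" using \<beta>(1) by (simp add: mult_le_0_iff del: of_nat_sum)
    then show False using \<rho> rep_dim_pos[OF unirep[OF \<rho>]] \<R>(1) by simp
  qed
  have "ereal (real (card S)) \<le> ereal (17 * (1 - \<alpha>\<^sup>2)) /
      (ereal_of_enat (min_nontrivial_dim G) * ereal (\<alpha>\<^sup>2 * \<beta>\<^sup>2))"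
  proof (cases "min_nontrivial_dim G")
    case (enat d)
    have d: "d \<ge> 1" using min_nontrivial_dim_ge_1[of G] by (simp add: enat one_enat_def)
    \<comment> \<open>Equivalent pieces share a class, so \<open>S\<close> may be smaller than
      \<open>\<R>\<close>. The bound on the total dimension yields the factor d in the
      denominator.\<close>
    have "card S * d \<le> card \<R> * d" unfolding S_def using \<R>(1) by (intro mult_right_mono card_image_le) auto
    also have "\<dots> \<le> (\<Sum>\<rho>\<in>\<R>. rep_dim \<rho>)"
      using min_nontrivial_dim_le[OF unirep] by (intro sum_bounded_below[of \<R> d rep_dim, simplified]) (auto simp: enat)
    finally have "real (card S * d) * (\<alpha>\<^sup>2 * \<beta>\<^sup>2) \<le> real (\<Sum>\<rho>\<in>\<R>. rep_dim \<rho>) * (\<alpha>\<^sup>2 * \<beta>\<^sup>2)"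
      by (intro mult_right_mono of_nat_mono) auto
    also have "\<dots> \<le> 25 / 2 * (1 - \<alpha>\<^sup>2)" by (rule dims)
    also have "\<dots> \<le> 17 * (1 - \<alpha>\<^sup>2)"
      using \<alpha>1 assms(7) by (intro mult_right_mono) (auto simp: power_le_one)
    finally have "real (card S) \<le> 17 * (1 - \<alpha>\<^sup>2) / (real d * (\<alpha>\<^sup>2 * \<beta>\<^sup>2))"
      using d \<beta>(1) assms(7) by (simp add: pos_le_divide_eq mult_ac)
    then show ?thesis using d \<beta>(1) assms(7) by (simp add: enat)
  next
    case infinity
    \<comment> \<open>A quotient by an infinite denominator is 0 in \<open>ereal\<close>, so the
      bound leaves only the empty set.\<close>
    then have "S = {}" using empty by (simp add: S_def)
    then show ?thesis using infinity \<beta>(1) assms(7) by simp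
  qed
  moreover have "A <#> B <#> set_inv B = carrier G" if "min_nontrivial_dim G = \<infinity> \<or> \<alpha> = 1"
  proof
    show "A <#> B <#> set_inv B \<subseteq> carrier G"
      using assms(4,5) by (auto simp: set_mult_def SET_INV_def)
    have "bohr_set G S (\<beta> / 2) = carrier G" using empty[OF that] by (simp add: S_def bohr_set_def)
    then show "carrier G \<subseteq> A <#> B <#> set_inv B"
      using sub a0G by (metis coset_join3 subgroup_self)
  qed
  moreover have "finite S" using \<R>(1) by (simp add: S_def)
  ultimately show ?thesis using a0 S_dual sub by blast
qed

end
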